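(* Let $k$ be any unital commutative ring, let $\delta\in k$ be any element and let $n$ be any positive integer. Then the homology and the cohomology of the dilute Temperley--Lieb algebra $dTL_n(\delta)$ are concentrated in degree zero, where they are isomorphic to $k$. That is, $$\operatorname{Tor}_{i}^{dTL_n(\delta)}(\mathbf{1},\mathbf{1})\cong\begin{cases}k & i=0\\ 0 & i>0\end{cases}\qquad\text{and}\qquad \operatorname{Ext}^{i}_{dTL_n(\delta)}(\mathbf{1},\mathbf{1})\cong\begin{cases}k & i=0\\ 0 & i>0,\end{cases}$$ where $\mathbf{1}$ denotes the trivial $dTL_n(\delta)$-module.
   Context: **Diagrams.** A dilute Temperley--Lieb $n$-diagram consists of two columns of $n$ vertices placed side by side, the left-hand column labelled $1,\dots,n$ and the right-hand column labelled $\overline{1},\dots,\overline{n}$ (both from top to bottom), such that each vertex is connected to at most one other vertex by an edge and the edges can be drawn without crossings within the rectangle formed by the vertices. Diagrams are identified up to isotopy. An edge joining the left column to the right column is a propagating edge; an edge joining two vertices of the same column is a non-propagating edge; a vertex on no edge is isolated. **The algebra.** For $\delta\in k$, $dTL_n(\delta)$ is the $k$-algebra with $k$-basis all dilute Temperley--Lieb $n$-diagrams, with multiplication extended $k$-linearly from the following product of diagrams $d_1,d_2$. Place $d_2$ to the right of $d_1$ and identify the vertices $\overline{1},\dots,\overline{n}$ of $d_1$ with the vertices $1,\dots,n$ of $d_2$, obtaining a graph $d_1\ast d_2$ with three columns of vertices (two vertices of the middle column may be joined by one edge from $d_1$ and one from $d_2$). Each connected component is a path (possibly a single vertex) or a loop.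 If some path component with at least one edge has an endpoint in the middle column (a "floating edge": either a path lying entirely within the middle column which is not a loop, or a path from the left or right column terminating in the middle column), then $d_1d_2=0$. Otherwise, let $\alpha$ be the number of loops (these lie entirely in the middle column) and let $d_3$ be the diagram in which two distinct vertices of $\{1,\overline{1},\dots,n,\overline{n}\}$ (outer columns of $d_1\ast d_2$) are joined by an edge exactly when there is a path between them in $d_1\ast d_2$; then $d_1d_2=\delta^{\alpha}d_3$. This product is associative. The identity element is the sum of all diagrams obtained from the unique diagram with $n$ propagating edges by omitting any (possibly empty) subset of its edges. **Trivial module.** There is an augmentation $\varepsilon\colon dTL_n(\delta)\to k$, a $k$-algebra map, sending the unique diagram with $n$ propagating edges to $1$ and all other diagrams to $0$. The trivial module $\mathbf{1}$ is a copy of $k$ on which $dTL_n(\delta)$ acts (on the left or on the right, as needed) via $\varepsilon$. The homology and cohomology of $dTL_n(\delta)$ are by definition $\operatorname{Tor}_{\star}^{dTL_n(\delta)}(\mathbf{1},\mathbf{1})$ and $\operatorname{Ext}^{\star}_{dTL_n(\delta)}(\mathbf{1},\mathbf{1})$. *)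

theory Defs
  imports "HOL-Algebra.Module" "HOL-Algebra.AbelCoset"
begin

section \<open>Modules over a possibly non-commutative ring\<close>

text \<open>
  The library locale \<^locale>\<open>module\<close> is for commutative rings only, so we repeat its axioms.
  A right module over \<open>R\<close> is encoded as a left module over \<open>opposite_ring R\<close>; thus
  \<open>a \<odot>\<^bsub>M\<^esub> x\<close> stands for \<open>x \<cdot> a\<close> when \<open>M\<close> is a right module.  The fields \<open>mult\<close> and \<open>one\<close>
  of a module record are irrelevant.
\<close>

locale left_module = M?: abelian_group M
  for R :: "('r, 'z) ring_scheme" (structure) and M :: "('r, 'm) module" (structure) +
  assumes smult_closed:
      "\<lbrakk>a \<in> carrier R; x \<in> carrier M\<rbrakk> \<Longrightarrow> a \<odot>\<^bsub>M\<^esub> x \<in> carrier M"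
    and smult_l_distr:
      "\<lbrakk>a \<in> carrier R; b \<in> carrier R; x \<in> carrier M\<rbrakk> \<Longrightarrow>
        (a \<oplus>\<^bsub>R\<^esub> b) \<odot>\<^bsub>M\<^esub> x = a \<odot>\<^bsub>M\<^esub> x \<oplus>\<^bsub>M\<^esub> b \<odot>\<^bsub>M\<^esub> x"
    and smult_r_distr:
      "\<lbrakk>a \<in> carrier R; x \<in> carrier M; y \<in> carrier M\<rbrakk> \<Longrightarrow>
        a \<odot>\<^bsub>M\<^esub> (x \<oplus>\<^bsub>M\<^esub> y) = a \<odot>\<^bsub>M\<^esub> x \<oplus>\<^bsub>M\<^esub> a \<odot>\<^bsub>M\<^esub> y"
    and smult_assoc:
      "\<lbrakk>a \<in> carrier R; b \<in> carrier R; x \<in> carrier M\<rbrakk> \<Longrightarrow>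
        (a \<otimes>\<^bsub>R\<^esub> b) \<odot>\<^bsub>M\<^esub> x = a \<odot>\<^bsub>M\<^esub> (b \<odot>\<^bsub>M\<^esub> x)"
    and smult_one:
      "x \<in> carrier M \<Longrightarrow> \<one>\<^bsub>R\<^esub> \<odot>\<^bsub>M\<^esub> x = x"

definition opposite_ring :: "('r, 'z) ring_scheme \<Rightarrow> ('r, 'z) ring_scheme" where
  "opposite_ring R = R\<lparr>mult := \<lambda>x y. y \<otimes>\<^bsub>R\<^esub> x\<rparr>"

definition module_hom ::
  "('r, 'z) ring_scheme \<Rightarrow> ('r, 'm) module \<Rightarrow> ('r, 'n) module \<Rightarrow> ('m \<Rightarrow> 'n) set" where
  "module_hom R M N = {f \<in> carrier M \<rightarrow> carrier N.
     (\<forall>x\<in>carrier M. \<forall>y\<in>carrier M. f (x \<oplus>\<^bsub>M\<^esub> y) = f x \<oplus>\<^bsub>N\<^esub> f y) \<and>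
     (\<forall>a\<in>carrier R. \<forall>x\<in>carrier M. f (a \<odot>\<^bsub>M\<^esub> x) = a \<odot>\<^bsub>N\<^esub> f x)}"

definition module_isomorphic ::
  "('r, 'z) ring_scheme \<Rightarrow> ('r, 'm) module \<Rightarrow> ('r, 'n) module \<Rightarrow> bool" where
  "module_isomorphic R M N \<longleftrightarrow> (\<exists>f\<in>module_hom R M N. bij_betw f (carrier M) (carrier N))"

definition quotient_module :: "('r, 'm) module \<Rightarrow> 'm set \<Rightarrow> ('r, 'm set) module" where
  "quotient_module M H = \<lparr>carrier = a_rcosets\<^bsub>M\<^esub> H, mult = undefined, one = undefined,
     zero = H, add = (<+>\<^bsub>M\<^esub>), smult = (\<lambda>a X. \<Union>x\<in>X. H +>\<^bsub>M\<^esub> (a \<odot>\<^bsub>M\<^esub> x))\<rparr>"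

text \<open>The free module \<open>R\<^sup>(\<^sup>X\<^sup>)\<close> on a set \<open>X\<close>: finitely supported functions.\<close>

definition free_module :: "('r, 'z) ring_scheme \<Rightarrow> 'x set \<Rightarrow> ('r, 'x \<Rightarrow> 'r) module" where
  "free_module R X = \<lparr>
     carrier = {f. (\<forall>x\<in>X. f x \<in> carrier R) \<and> (\<forall>x. x \<notin> X \<longrightarrow> f x = \<zero>\<^bsub>R\<^esub>) \<and> finite {x. f x \<noteq> \<zero>\<^bsub>R\<^esub>}},
     mult = undefined, one = undefined,
     zero = (\<lambda>x. \<zero>\<^bsub>R\<^esub>), add = (\<lambda>f g x. f x \<oplus>\<^bsub>R\<^esub> g x), smult = (\<lambda>a f x. a \<otimes>\<^bsub>R\<^esub> f x)\<rparr>"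

definition free_basis :: "('r, 'z) ring_scheme \<Rightarrow> 'x \<Rightarrow> ('x \<Rightarrow> 'r)" where
  "free_basis R x = (\<lambda>y. if y = x then \<one>\<^bsub>R\<^esub> else \<zero>\<^bsub>R\<^esub>)"

text \<open>
  Projective means: a direct summand (retract) of a free module.  Taking the generating set in
  the type of the elements of \<open>P\<close> is no restriction, since one may always use \<open>X = carrier P\<close>.
\<close>

definition projective_module :: "('r, 'z) ring_scheme \<Rightarrow> ('r, 'p) module \<Rightarrow> bool" where
  "projective_module R P \<longleftrightarrow> left_module R P \<and>
     (\<exists>X :: 'p set. \<exists>s \<in> module_hom R P (free_module R X). \<exists>r \<in> module_hom R (free_module R X) P.
        \<forall>x\<in>carrier P. r (s x) = x)"

text \<open>
  An exact sequence \<open>\<dots> \<rightarrow> P 2 \<rightarrow> P 1 \<rightarrow> P 0 \<rightarrow> M \<rightarrow> 0\<close> with all \<open>P i\<close> projective, where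
  \<open>d i : P (i + 1) \<rightarrow> P i\<close> and \<open>\<eta> : P 0 \<rightarrow> M\<close>.
\<close>

definition projective_resolution ::
  "('r, 'z) ring_scheme \<Rightarrow> (nat \<Rightarrow> ('r, 'p) module) \<Rightarrow> (nat \<Rightarrow> 'p \<Rightarrow> 'p) \<Rightarrow> ('p \<Rightarrow> 'm) \<Rightarrow>
     ('r, 'm) module \<Rightarrow> bool" where
  "projective_resolution R P d \<eta> M \<longleftrightarrow>
     (\<forall>i. projective_module R (P i)) \<and>
     (\<forall>i. d i \<in> module_hom R (P (Suc i)) (P i)) \<and>
     \<eta> \<in> module_hom R (P 0) M \<and>
     \<eta> ` carrier (P 0) = carrier M \<and>
     a_kernel (P 0) M \<eta> = d 0 ` carrier (P 1) \<and>
     (\<forall>i. a_kernel (P (Suc i)) (P i) (d i) = d (Suc i) ` carrier (P (Suc (Suc i))))"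


section \<open>Homology and cohomology of complexes\<close>

text \<open>Chain complexes \<open>b i : C (i + 1) \<rightarrow> C i\<close> and cochain complexes \<open>b i : C i \<rightarrow> C (i + 1)\<close>,
  indexed by the natural numbers and extended by zero in negative degrees.\<close>

fun cycles :: "(nat \<Rightarrow> ('k, 'c) module) \<Rightarrow> (nat \<Rightarrow> 'c \<Rightarrow> 'c) \<Rightarrow> nat \<Rightarrow> 'c set" where
  "cycles C b 0 = carrier (C 0)"
| "cycles C b (Suc i) = a_kernel (C (Suc i)) (C i) (b i)"

definition homology ::
  "(nat \<Rightarrow> ('k, 'c) module) \<Rightarrow> (nat \<Rightarrow> 'c \<Rightarrow> 'c) \<Rightarrow> nat \<Rightarrow> ('k, 'c set) module" where
  "homology C b i =
     quotient_module ((C i)\<lparr>carrier := cycles C b i\<rparr>) (b i ` carrier (C (Suc i)))"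

fun coboundaries :: "(nat \<Rightarrow> ('k, 'c) module) \<Rightarrow> (nat \<Rightarrow> 'c \<Rightarrow> 'c) \<Rightarrow> nat \<Rightarrow> 'c set" where
  "coboundaries C b 0 = {\<zero>\<^bsub>C 0\<^esub>}"
| "coboundaries C b (Suc i) = b i ` carrier (C i)"

definition cohomology ::
  "(nat \<Rightarrow> ('k, 'c) module) \<Rightarrow> (nat \<Rightarrow> 'c \<Rightarrow> 'c) \<Rightarrow> nat \<Rightarrow> ('k, 'c set) module" where
  "cohomology C b i =
     quotient_module ((C i)\<lparr>carrier := a_kernel (C i) (C (Suc i)) (b i)\<rparr>) (coboundaries C b i)"


section \<open>Tor and Ext over a \<open>k\<close>-algebra\<close>

text \<open>
  The base ring \<open>k\<close> is a type of sort \<open>{comm_ring, comm_monoid_mult}\<close>, that is, a commutative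
  ring with unit in which, unlike in \<^class>\<open>comm_ring_1\<close>, \<open>0 = 1\<close> is allowed.  A \<open>k\<close>-algebra \<open>A\<close>
  is a record of type \<open>('k, 'a) module\<close>: \<open>mult\<close>, \<open>one\<close>, \<open>zero\<close>, \<open>add\<close> give the ring structure
  and \<open>smult\<close> the \<open>k\<close>-module structure.  Every \<open>A\<close>-module becomes a \<open>k\<close>-module through
  \<open>c \<mapsto> c \<odot>\<^bsub>A\<^esub> \<one>\<^bsub>A\<^esub>\<close>.
\<close>

definition base_ring :: "'k::{comm_ring, comm_monoid_mult} ring" where
  "base_ring = \<lparr>carrier = UNIV, mult = (*), one = 1, zero = 0, add = (+)\<rparr>"

definition base_module :: "('k::{comm_ring, comm_monoid_mult}, 'k) module" where
  "base_module =
     \<lparr>carrier = UNIV, mult = (*), one = 1, zero = 0, add = (+), smult = (*)\<rparr>"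

text \<open>
  \<open>M \<otimes>\<^sub>A N\<close>, for a right module \<open>M\<close> and a left module \<open>N\<close>, is the quotient of the free
  \<open>k\<close>-module on \<open>M \<times> N\<close> by the \<open>k\<close>-submodule making \<open>(x, y) \<mapsto> x \<otimes> y\<close> additive in both
  arguments, \<open>A\<close>-balanced and \<open>k\<close>-linear.
\<close>

definition tensor_relations ::
  "('k::{comm_ring, comm_monoid_mult}, 'a) module \<Rightarrow> ('a, 'm) module \<Rightarrow> ('a, 'n) module \<Rightarrow>
     ('m \<times> 'n \<Rightarrow> 'k) set" where
  "tensor_relations A M N = (let e = free_basis base_ring in
     {\<lambda>q. e (x \<oplus>\<^bsub>M\<^esub> x', y) q - e (x, y) q - e (x', y) q | x x' y.
        x \<in> carrier M \<and> x' \<in> carrier M \<and> y \<in> carrier N} \<union>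
     {\<lambda>q. e (x, y \<oplus>\<^bsub>N\<^esub> y') q - e (x, y) q - e (x, y') q | x y y'.
        x \<in> carrier M \<and> y \<in> carrier N \<and> y' \<in> carrier N} \<union>
     {\<lambda>q. e (a \<odot>\<^bsub>M\<^esub> x, y) q - e (x, a \<odot>\<^bsub>N\<^esub> y) q | a x y.
        a \<in> carrier A \<and> x \<in> carrier M \<and> y \<in> carrier N} \<union>
     {\<lambda>q. e ((c \<odot>\<^bsub>A\<^esub> \<one>\<^bsub>A\<^esub>) \<odot>\<^bsub>M\<^esub> x, y) q - c * e (x, y) q | c x y.
        x \<in> carrier M \<and> y \<in> carrier N})"

definition tensor_kernel ::
  "('k::{comm_ring, comm_monoid_mult}, 'a) module \<Rightarrow> ('a, 'm) module \<Rightarrow> ('a, 'n) module \<Rightarrow>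
     ('m \<times> 'n \<Rightarrow> 'k) set" where
  "tensor_kernel A M N =
     \<Inter>{H. submodule H base_ring (free_module base_ring (carrier M \<times> carrier N)) \<and>
           tensor_relations A M N \<subseteq> H}"

definition tensor ::
  "('k::{comm_ring, comm_monoid_mult}, 'a) module \<Rightarrow> ('a, 'm) module \<Rightarrow> ('a, 'n) module \<Rightarrow>
     ('k, ('m \<times> 'n \<Rightarrow> 'k) set) module" where
  "tensor A M N =
     quotient_module (free_module base_ring (carrier M \<times> carrier N)) (tensor_kernel A M N)"

text \<open>
  The map \<open>f \<otimes> id\<close> into \<open>M' \<otimes>\<^sub>A N\<close>.  On representatives it is the linear extension of
  \<open>(x, y) \<mapsto> (f x, y)\<close>, i.e. it adds up the coefficients along the fibres of \<open>f\<close>.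
\<close>

definition tensor_map ::
  "('k::{comm_ring, comm_monoid_mult}, 'a) module \<Rightarrow> ('a, 'm') module \<Rightarrow> ('a, 'n) module \<Rightarrow>
     ('m \<Rightarrow> 'm') \<Rightarrow> ('m \<times> 'n \<Rightarrow> 'k) set \<Rightarrow> ('m' \<times> 'n \<Rightarrow> 'k) set" where
  "tensor_map A M' N f T =
     (\<Union>t\<in>T. tensor_kernel A M' N +>\<^bsub>free_module base_ring (carrier M' \<times> carrier N)\<^esub>
        (\<lambda>(x', y). \<Sum>x | t (x, y) \<noteq> 0 \<and> f x = x'. t (x, y)))"

definition hom_module ::
  "('k, 'a) module \<Rightarrow> ('a, 'm) module \<Rightarrow> ('a, 'n) module \<Rightarrow> ('k, 'm \<Rightarrow> 'n) module" where
  "hom_module A M N = \<lparr>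
     carrier = module_hom A M N \<inter> extensional (carrier M),
     mult = undefined, one = undefined,
     zero = (\<lambda>x\<in>carrier M. \<zero>\<^bsub>N\<^esub>),
     add = (\<lambda>f g. \<lambda>x\<in>carrier M. f x \<oplus>\<^bsub>N\<^esub> g x),
     smult = (\<lambda>c f. \<lambda>x\<in>carrier M. (c \<odot>\<^bsub>A\<^esub> \<one>\<^bsub>A\<^esub>) \<odot>\<^bsub>N\<^esub> f x)\<rparr>"

text \<open>
  \<open>Tor\<^sub>i\<^sup>A(M, N)\<close> as computed by a projective resolution \<open>(P, d)\<close> of the right module \<open>M\<close>, and
  \<open>Ext\<^sup>i\<^sub>A(M, N)\<close> as computed by a projective resolution \<open>(P, d)\<close> of the left module \<open>M\<close>.
  Since a definition cannot choose a resolution over an arbitrary type, the resolution is a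
  parameter; statements about Tor and Ext quantify over all resolutions, which exist by
  \<open>projective_resolution_exists\<close> at the end of this theory.
\<close>

definition Tor ::
  "('k::{comm_ring, comm_monoid_mult}, 'a) module \<Rightarrow> (nat \<Rightarrow> ('a, 'p) module) \<Rightarrow>
     (nat \<Rightarrow> 'p \<Rightarrow> 'p) \<Rightarrow> ('a, 'n) module \<Rightarrow> nat \<Rightarrow> ('k, ('p \<times> 'n \<Rightarrow> 'k) set set) module" where
  "Tor A P d N = homology (\<lambda>i. tensor A (P i) N) (\<lambda>i. tensor_map A (P i) N (d i))"

definition Ext ::
  "('k, 'a) module \<Rightarrow> (nat \<Rightarrow> ('a, 'p) module) \<Rightarrow> (nat \<Rightarrow> 'p \<Rightarrow> 'p) \<Rightarrow> ('a, 'n) module \<Rightarrow>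
     nat \<Rightarrow> ('k, ('p \<Rightarrow> 'n) set) module" where
  "Ext A P d N =
     cohomology (\<lambda>i. hom_module A (P i) N) (\<lambda>i f. compose (carrier (P (Suc i))) f (d i))"


section \<open>Dilute Temperley--Lieb diagrams\<close>

text \<open>
  \<open>Lft i\<close> is the vertex labelled \<open>i\<close> and \<open>Rgt i\<close> the one labelled \<open>i\<close> with a bar.  Up to isotopy a
  diagram is determined by its set of edges, an edge being the set of its two end points.
\<close>

datatype vertex = Lft nat | Rgt nat

type_synonym diagram = "vertex set set"

definition vertices :: "nat \<Rightarrow> vertex set" where
  "vertices n = Lft ` {1..n} \<union> Rgt ` {1..n}"

text \<open>Position of a vertex along the boundary of the rectangle: down the left-hand column, then
  up the right-hand column.\<close>

fun boundary_position :: "nat \<Rightarrow> vertex \<Rightarrow> nat" where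
  "boundary_position n (Lft i) = i"
| "boundary_position n (Rgt i) = 2 * n + 1 - i"

text \<open>Edges can be drawn in the rectangle without crossings iff the end points of no two of them
  interleave along the boundary.\<close>

definition noncrossing :: "nat \<Rightarrow> diagram \<Rightarrow> bool" where
  "noncrossing n D \<longleftrightarrow> \<not> (\<exists>u v x y. {u, v} \<in> D \<and> {x, y} \<in> D \<and>
     boundary_position n u < boundary_position n x \<and>
     boundary_position n x < boundary_position n v \<and>
     boundary_position n v < boundary_position n y)"

definition diagrams :: "nat \<Rightarrow> diagram set" where
  "diagrams n = {D. (\<forall>e\<in>D. e \<subseteq> vertices n \<and> card e = 2) \<and>
     (\<forall>e\<in>D. \<forall>e'\<in>D. e \<noteq> e' \<longrightarrow> e \<inter> e' = {}) \<and> noncrossing n D}"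

definition identity_diagram :: "nat \<Rightarrow> diagram" where
  "identity_diagram n = {{Lft i, Rgt i} | i. i \<in> {1..n}}"


text \<open>
  The graph \<open>d\<^sub>1 * d\<^sub>2\<close>.  Its edges are tagged with the diagram they come from, since two vertices
  of the middle column may be joined by one edge from each.
\<close>

datatype vertex3 = First nat | Middle nat | Last nat

fun left_half :: "vertex \<Rightarrow> vertex3" where
  "left_half (Lft i) = First i"
| "left_half (Rgt i) = Middle i"

fun right_half :: "vertex \<Rightarrow> vertex3" where
  "right_half (Lft i) = Middle i"
| "right_half (Rgt i) = Last i"

fun outer :: "vertex \<Rightarrow> vertex3" where
  "outer (Lft i) = First i"
| "outer (Rgt i) = Last i"

definition vertices3 :: "nat \<Rightarrow> vertex3 set" where
  "vertices3 n = First ` {1..n} \<union> Middle ` {1..n} \<union> Last ` {1..n}"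

definition edges3 :: "diagram \<Rightarrow> diagram \<Rightarrow> (vertex3 set + vertex3 set) set" where
  "edges3 D1 D2 = Inl ` ((`) left_half ` D1) \<union> Inr ` ((`) right_half ` D2)"

definition ends :: "vertex3 set + vertex3 set \<Rightarrow> vertex3 set" where
  "ends = case_sum id id"

definition degree3 :: "diagram \<Rightarrow> diagram \<Rightarrow> vertex3 \<Rightarrow> nat" where
  "degree3 D1 D2 v = card {e \<in> edges3 D1 D2. v \<in> ends e}"

definition connected3 :: "diagram \<Rightarrow> diagram \<Rightarrow> vertex3 \<Rightarrow> vertex3 \<Rightarrow> bool" where
  "connected3 D1 D2 = (\<lambda>u v. \<exists>e\<in>edges3 D1 D2. ends e = {u, v})\<^sup>*\<^sup>*"

definition components3 :: "nat \<Rightarrow> diagram \<Rightarrow> diagram \<Rightarrow> vertex3 set set" where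
  "components3 n D1 D2 =
     vertices3 n // {(u, v) \<in> vertices3 n \<times> vertices3 n. connected3 D1 D2 u v}"

text \<open>
  All degrees are at most 2.  A component is a loop iff all its vertices have degree 2; otherwise
  it is a path, and if that path has an edge then its end points are its vertices of degree 1.
\<close>

definition number_of_loops :: "nat \<Rightarrow> diagram \<Rightarrow> diagram \<Rightarrow> nat" where
  "number_of_loops n D1 D2 =
     card {C \<in> components3 n D1 D2. \<forall>v\<in>C. degree3 D1 D2 v = 2}"

definition has_floating_edge :: "nat \<Rightarrow> diagram \<Rightarrow> diagram \<Rightarrow> bool" where
  "has_floating_edge n D1 D2 \<longleftrightarrow>
     (\<exists>C\<in>components3 n D1 D2. \<exists>i. Middle i \<in> C \<and> degree3 D1 D2 (Middle i) = 1)"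

definition composite :: "nat \<Rightarrow> diagram \<Rightarrow> diagram \<Rightarrow> diagram" where
  "composite n D1 D2 = {{u, v} | u v. u \<in> vertices n \<and> v \<in> vertices n \<and> u \<noteq> v \<and>
     connected3 D1 D2 (outer u) (outer v)}"


section \<open>The dilute Temperley--Lieb algebra\<close>

text \<open>Elements are coefficient functions \<open>f\<close> of \<open>\<Sum>D. f D \<cdot> D\<close>.\<close>

definition diagram_product ::
  "nat \<Rightarrow> 'k \<Rightarrow> diagram \<Rightarrow> diagram \<Rightarrow> (diagram \<Rightarrow> 'k::{comm_ring, comm_monoid_mult})" where
  "diagram_product n \<delta> D1 D2 = (\<lambda>D. if has_floating_edge n D1 D2 then 0
     else if D = composite n D1 D2 then \<delta> ^ number_of_loops n D1 D2 else 0)"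

definition dTL ::
  "nat \<Rightarrow> 'k \<Rightarrow> ('k::{comm_ring, comm_monoid_mult}, diagram \<Rightarrow> 'k) module" where
  "dTL n \<delta> = \<lparr>
     carrier = {f. \<forall>D. D \<notin> diagrams n \<longrightarrow> f D = 0},
     mult = (\<lambda>f g D. \<Sum>D1\<in>diagrams n. \<Sum>D2\<in>diagrams n. f D1 * g D2 * diagram_product n \<delta> D1 D2 D),
     one = (\<lambda>D. if D \<subseteq> identity_diagram n then 1 else 0),
     zero = (\<lambda>D. 0), add = (\<lambda>f g D. f D + g D), smult = (\<lambda>c f D. c * f D)\<rparr>"

definition augmentation :: "nat \<Rightarrow> (diagram \<Rightarrow> 'k) \<Rightarrow> 'k" where
  "augmentation n f = f (identity_diagram n)"

text \<open>As \<open>k\<close> is commutative, this is both a left and a right module over \<open>dTL n \<delta>\<close>.\<close>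

definition trivial_module ::
  "nat \<Rightarrow> (diagram \<Rightarrow> 'k, 'k::{comm_ring, comm_monoid_mult}) module" where
  "trivial_module n = \<lparr>carrier = UNIV, mult = (*), one = 1, zero = 0, add = (+),
     smult = (\<lambda>f x. augmentation n f * x)\<rparr>"


section \<open>Existence of projective resolutions\<close>

definition linear_extension ::
  "('r, 'z) ring_scheme \<Rightarrow> ('r, 'm) module \<Rightarrow> ('x \<Rightarrow> 'm) \<Rightarrow> ('x \<Rightarrow> 'r) \<Rightarrow> 'm" where
  "linear_extension R M g f = (\<Oplus>\<^bsub>M\<^esub>x\<in>{x. f x \<noteq> \<zero>\<^bsub>R\<^esub>}. f x \<odot>\<^bsub>M\<^esub> g x)"

lemma left_module_smult_zero:
  assumes R: "ring R" and M: "left_module R M" and x: "x \<in> carrier M"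
  shows "\<zero>\<^bsub>R\<^esub> \<odot>\<^bsub>M\<^esub> x = \<zero>\<^bsub>M\<^esub>"
proof -
  interpret R: ring R by fact
  interpret M: left_module R M by fact
  have c: "\<zero>\<^bsub>R\<^esub> \<odot>\<^bsub>M\<^esub> x \<in> carrier M" using x by (simp add: M.smult_closed)
  have "\<zero>\<^bsub>R\<^esub> \<odot>\<^bsub>M\<^esub> x \<oplus>\<^bsub>M\<^esub> \<zero>\<^bsub>R\<^esub> \<odot>\<^bsub>M\<^esub> x = \<zero>\<^bsub>R\<^esub> \<odot>\<^bsub>M\<^esub> x"
    using M.smult_l_distr[of "\<zero>\<^bsub>R\<^esub>" "\<zero>\<^bsub>R\<^esub>" x] x by simp
  then show ?thesis using c by (metis M.add.l_cancel_one)
qed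

lemma left_module_smult_zero_right:
  assumes R: "ring R" and M: "left_module R M" and a: "a \<in> carrier R"
  shows "a \<odot>\<^bsub>M\<^esub> \<zero>\<^bsub>M\<^esub> = \<zero>\<^bsub>M\<^esub>"
proof -
  interpret M: left_module R M by fact
  have c: "a \<odot>\<^bsub>M\<^esub> \<zero>\<^bsub>M\<^esub> \<in> carrier M" using a by (simp add: M.smult_closed)
  have "a \<odot>\<^bsub>M\<^esub> \<zero>\<^bsub>M\<^esub> \<oplus>\<^bsub>M\<^esub> a \<odot>\<^bsub>M\<^esub> \<zero>\<^bsub>M\<^esub> = a \<odot>\<^bsub>M\<^esub> \<zero>\<^bsub>M\<^esub>"
    using M.smult_r_distr[of a "\<zero>\<^bsub>M\<^esub>" "\<zero>\<^bsub>M\<^esub>"] a by simp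
  then show ?thesis using c by (metis M.add.l_cancel_one)
qed

lemma left_module_smult_sum:
  assumes R: "ring R" and M: "left_module R M" and a: "a \<in> carrier R"
    and "finite S" "\<And>x. x \<in> S \<Longrightarrow> g x \<in> carrier M"
  shows "a \<odot>\<^bsub>M\<^esub> (\<Oplus>\<^bsub>M\<^esub>x\<in>S. g x) = (\<Oplus>\<^bsub>M\<^esub>x\<in>S. a \<odot>\<^bsub>M\<^esub> g x)"
proof -
  interpret M: left_module R M by fact
  show ?thesis using assms(4,5)
  proof (induction S)
    case empty
    then show ?case using left_module_smult_zero_right[OF R M a] by simp
  next
    case (insert y S)
    have g: "g \<in> S \<rightarrow> carrier M" "g y \<in> carrier M" using insert.prems by auto
    have ag: "(\<lambda>x. a \<odot>\<^bsub>M\<^esub> g x) \<in> S \<rightarrow> carrier M" "a \<odot>\<^bsub>M\<^esub> g y \<in> carrier M"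
      using g a M.smult_closed by auto
    have "a \<odot>\<^bsub>M\<^esub> (g y \<oplus>\<^bsub>M\<^esub> finsum M g S) = a \<odot>\<^bsub>M\<^esub> g y \<oplus>\<^bsub>M\<^esub> a \<odot>\<^bsub>M\<^esub> finsum M g S"
      using g a by (simp add: M.smult_r_distr)
    then show ?case using insert g ag by simp
  qed
qed

lemma free_module_simps:
  "carrier (free_module R A) =
     {f. (\<forall>x\<in>A. f x \<in> carrier R) \<and> (\<forall>x. x \<notin> A \<longrightarrow> f x = \<zero>\<^bsub>R\<^esub>) \<and> finite {x. f x \<noteq> \<zero>\<^bsub>R\<^esub>}}"
  "\<zero>\<^bsub>free_module R A\<^esub> = (\<lambda>x. \<zero>\<^bsub>R\<^esub>)"
  "f \<oplus>\<^bsub>free_module R A\<^esub> g = (\<lambda>x. f x \<oplus>\<^bsub>R\<^esub> g x)"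
  "a \<odot>\<^bsub>free_module R A\<^esub> f = (\<lambda>x. a \<otimes>\<^bsub>R\<^esub> f x)"
  by (simp_all add: free_module_def)

lemma free_module_apply:
  "ring R \<Longrightarrow> f \<in> carrier (free_module R A) \<Longrightarrow> f x \<in> carrier R"
  by (cases "x \<in> A") (auto simp: free_module_simps ring.ring_simprules(2))

lemma left_module_free_module:
  assumes "ring R" shows "left_module R (free_module R A)"
proof -
  interpret R: ring R by fact
  have add: "(\<lambda>x. f x \<oplus>\<^bsub>R\<^esub> g x) \<in> carrier (free_module R A)"
    if "f \<in> carrier (free_module R A)" "g \<in> carrier (free_module R A)" for f g
  proof -
    have "{x. f x \<oplus>\<^bsub>R\<^esub> g x \<noteq> \<zero>\<^bsub>R\<^esub>} \<subseteq> {x. f x \<noteq> \<zero>\<^bsub>R\<^esub>} \<union> {x. g x \<noteq> \<zero>\<^bsub>R\<^esub>}" by auto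
    then show ?thesis using that by (auto simp: free_module_simps intro: finite_subset)
  qed
  have sm: "(\<lambda>x. a \<otimes>\<^bsub>R\<^esub> f x) \<in> carrier (free_module R A)"
    if "f \<in> carrier (free_module R A)" "a \<in> carrier R" for f a
  proof -
    have "{x. a \<otimes>\<^bsub>R\<^esub> f x \<noteq> \<zero>\<^bsub>R\<^esub>} \<subseteq> {x. f x \<noteq> \<zero>\<^bsub>R\<^esub>}" using that by auto
    then show ?thesis using that by (auto simp: free_module_simps intro: finite_subset)
  qed
  have neg: "\<exists>g\<in>carrier (free_module R A). (\<lambda>x. g x \<oplus>\<^bsub>R\<^esub> f x) = (\<lambda>x. \<zero>\<^bsub>R\<^esub>)"
    if f: "f \<in> carrier (free_module R A)" for f
  proof
    have "{x. \<ominus>\<^bsub>R\<^esub> f x \<noteq> \<zero>\<^bsub>R\<^esub>} \<subseteq> {x. f x \<noteq> \<zero>\<^bsub>R\<^esub>}" by auto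
    then show "(\<lambda>x. \<ominus>\<^bsub>R\<^esub> f x) \<in> carrier (free_module R A)"
      using f by (auto simp: free_module_simps intro: finite_subset)
    show "(\<lambda>x. \<ominus>\<^bsub>R\<^esub> f x \<oplus>\<^bsub>R\<^esub> f x) = (\<lambda>x. \<zero>\<^bsub>R\<^esub>)"
      using free_module_apply[OF assms f] by (simp add: R.l_neg)
  qed
  have app: "f x \<in> carrier R" if "f \<in> carrier (free_module R A)" for f x
    using free_module_apply[OF assms that] .
  show ?thesis
  proof (intro left_module.intro abelian_groupI left_module_axioms.intro)
    fix f assume "f \<in> carrier (free_module R A)"
    then show "\<exists>g\<in>carrier (free_module R A).
        g \<oplus>\<^bsub>free_module R A\<^esub> f = \<zero>\<^bsub>free_module R A\<^esub>"
      using neg by (simp add: free_module_simps(2,3))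
  next
    show "\<zero>\<^bsub>free_module R A\<^esub> \<in> carrier (free_module R A)"
      by (simp add: free_module_simps)
  next
    fix f g h assume "f \<in> carrier (free_module R A)" "g \<in> carrier (free_module R A)"
      "h \<in> carrier (free_module R A)"
    from this[THEN app]
    show "f \<oplus>\<^bsub>free_module R A\<^esub> g \<oplus>\<^bsub>free_module R A\<^esub> h =
        f \<oplus>\<^bsub>free_module R A\<^esub> (g \<oplus>\<^bsub>free_module R A\<^esub> h)"
      by (simp add: free_module_simps(3) R.a_assoc)
  next
    fix f g assume "f \<in> carrier (free_module R A)" "g \<in> carrier (free_module R A)"
    from this[THEN app]
    show "f \<oplus>\<^bsub>free_module R A\<^esub> g = g \<oplus>\<^bsub>free_module R A\<^esub> f"
      by (simp add: free_module_simps(3) R.a_comm)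
  qed (simp_all add: free_module_simps(2-4) add sm, insert app,
       auto simp: fun_eq_iff R.l_distr R.r_distr R.m_assoc)
qed

lemma linear_extension_eq:
  assumes "ring R" "left_module R M" "f \<in> carrier (free_module R A)" "g \<in> A \<rightarrow> carrier M"
    and "finite S" "{x. f x \<noteq> \<zero>\<^bsub>R\<^esub>} \<subseteq> S" "S \<subseteq> A"
  shows "linear_extension R M g f = (\<Oplus>\<^bsub>M\<^esub>x\<in>S. f x \<odot>\<^bsub>M\<^esub> g x)"
proof -
  interpret M: left_module R M by fact
  have c: "f x \<odot>\<^bsub>M\<^esub> g x \<in> carrier M" if "x \<in> S" for x
    using that assms(4,7) free_module_apply[OF assms(1,3)] by (intro M.smult_closed) auto
  show ?thesis unfolding linear_extension_def
    using assms c
    by (intro M.add.finprod_mono_neutral_cong_left)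
       (auto intro!: left_module_smult_zero[OF assms(1,2)])
qed

lemma linear_extension_hom:
  assumes "ring R" "left_module R M" "g \<in> A \<rightarrow> carrier M"
  shows "linear_extension R M g \<in> module_hom R (free_module R A) M"
proof -
  interpret R: ring R by fact
  interpret M: left_module R M by fact
  interpret F: left_module R "free_module R A" using left_module_free_module[OF assms(1)] .
  note app = free_module_apply[OF assms(1)]
  have supp: "finite {x. f x \<noteq> \<zero>\<^bsub>R\<^esub>}" "{x. f x \<noteq> \<zero>\<^bsub>R\<^esub>} \<subseteq> A"
    if "f \<in> carrier (free_module R A)" for f
    using that by (auto simp: free_module_simps)
  have c: "f x \<odot>\<^bsub>M\<^esub> g x \<in> carrier M" if "f \<in> carrier (free_module R A)" "x \<in> A" for f x
    using that assms(3) app[OF that(1)] by (intro M.smult_closed) auto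
  show ?thesis unfolding module_hom_def
  proof (intro CollectI conjI ballI funcsetI)
    fix f assume f: "f \<in> carrier (free_module R A)"
    show "linear_extension R M g f \<in> carrier M"
      unfolding linear_extension_def using supp[OF f] c[OF f] by (intro M.finsum_closed) auto
  next
    fix f h assume f: "f \<in> carrier (free_module R A)" and h: "h \<in> carrier (free_module R A)"
    let ?S = "{x. f x \<noteq> \<zero>\<^bsub>R\<^esub>} \<union> {x. h x \<noteq> \<zero>\<^bsub>R\<^esub>}"
    have S: "finite ?S" "?S \<subseteq> A" using supp f h by auto
    have fh: "f \<oplus>\<^bsub>free_module R A\<^esub> h \<in> carrier (free_module R A)" using f h by simp
    have "linear_extension R M g (f \<oplus>\<^bsub>free_module R A\<^esub> h)
        = (\<Oplus>\<^bsub>M\<^esub>x\<in>?S. (f \<oplus>\<^bsub>free_module R A\<^esub> h) x \<odot>\<^bsub>M\<^esub> g x)"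
      by (rule linear_extension_eq[OF assms(1,2) fh assms(3) S(1) _ S(2)])
         (auto simp: free_module_simps)
    also have "\<dots> = (\<Oplus>\<^bsub>M\<^esub>x\<in>?S. f x \<odot>\<^bsub>M\<^esub> g x \<oplus>\<^bsub>M\<^esub> h x \<odot>\<^bsub>M\<^esub> g x)"
      using S(2) assms(3) app[OF f] app[OF h] c[OF f] c[OF h]
      by (intro M.finsum_cong') (auto simp: free_module_simps M.smult_l_distr Pi_iff)
    also have "\<dots> = (\<Oplus>\<^bsub>M\<^esub>x\<in>?S. f x \<odot>\<^bsub>M\<^esub> g x) \<oplus>\<^bsub>M\<^esub> (\<Oplus>\<^bsub>M\<^esub>x\<in>?S. h x \<odot>\<^bsub>M\<^esub> g x)"
      using S c[OF f] c[OF h] by (intro M.finsum_addf) auto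
    also have "\<dots> = linear_extension R M g f \<oplus>\<^bsub>M\<^esub> linear_extension R M g h"
      using linear_extension_eq[OF assms(1,2) f assms(3) S(1) _ S(2)]
        linear_extension_eq[OF assms(1,2) h assms(3) S(1) _ S(2)] by auto
    finally show "linear_extension R M g (f \<oplus>\<^bsub>free_module R A\<^esub> h) =
        linear_extension R M g f \<oplus>\<^bsub>M\<^esub> linear_extension R M g h" .
  next
    fix a f assume a: "a \<in> carrier R" and f: "f \<in> carrier (free_module R A)"
    let ?S = "{x. f x \<noteq> \<zero>\<^bsub>R\<^esub>}"
    have S: "finite ?S" "?S \<subseteq> A" using supp f by auto
    have af: "a \<odot>\<^bsub>free_module R A\<^esub> f \<in> carrier (free_module R A)"
      using a f by (rule F.smult_closed)
    have "linear_extension R M g (a \<odot>\<^bsub>free_module R A\<^esub> f)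
        = (\<Oplus>\<^bsub>M\<^esub>x\<in>?S. (a \<odot>\<^bsub>free_module R A\<^esub> f) x \<odot>\<^bsub>M\<^esub> g x)"
      by (rule linear_extension_eq[OF assms(1,2) af assms(3) S(1) _ S(2)])
         (use a in \<open>auto simp: free_module_simps\<close>)
    also have "\<dots> = (\<Oplus>\<^bsub>M\<^esub>x\<in>?S. a \<odot>\<^bsub>M\<^esub> (f x \<odot>\<^bsub>M\<^esub> g x))"
      using S(2) assms(3) app[OF f] c[OF f] a
      by (intro M.finsum_cong') (auto simp: free_module_simps M.smult_assoc Pi_iff M.smult_closed)
    also have "\<dots> = a \<odot>\<^bsub>M\<^esub> linear_extension R M g f"
      unfolding linear_extension_def
      using S c[OF f] by (intro left_module_smult_sum[OF assms(1,2) a, symmetric]) auto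
    finally show "linear_extension R M g (a \<odot>\<^bsub>free_module R A\<^esub> f) =
        a \<odot>\<^bsub>M\<^esub> linear_extension R M g f" .
  qed
qed

lemma free_basis_carrier:
  "ring R \<Longrightarrow> x \<in> A \<Longrightarrow> free_basis R x \<in> carrier (free_module R A)"
  using ring.ring_simprules(2,6)[of R]
  by (auto simp: free_module_simps free_basis_def intro: finite_subset[of _ "{x}"])

lemma linear_extension_basis:
  assumes "ring R" "left_module R M" "g \<in> A \<rightarrow> carrier M" "x \<in> A"
  shows "linear_extension R M g (free_basis R x) = g x"
proof -
  interpret M: left_module R M by fact
  have "linear_extension R M g (free_basis R x)
      = (\<Oplus>\<^bsub>M\<^esub>y\<in>{x}. free_basis R x y \<odot>\<^bsub>M\<^esub> g y)"
    using assms free_basis_carrier[OF assms(1,4)]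
    by (intro linear_extension_eq[where A = A]) (auto simp: free_basis_def)
  also have "\<dots> = g x"
    using assms(3,4) by (auto simp: free_basis_def M.smult_one Pi_iff)
  finally show ?thesis .
qed

lemma module_hom_zero:
  assumes "ring R" "left_module R M" "left_module R N" "h \<in> module_hom R M N"
  shows "h \<zero>\<^bsub>M\<^esub> = \<zero>\<^bsub>N\<^esub>"
proof -
  interpret R: ring R by fact
  interpret M: left_module R M by fact
  have h0: "h \<zero>\<^bsub>M\<^esub> \<in> carrier N" using assms(4) by (auto simp: module_hom_def)
  have "h (\<zero>\<^bsub>R\<^esub> \<odot>\<^bsub>M\<^esub> \<zero>\<^bsub>M\<^esub>) = \<zero>\<^bsub>R\<^esub> \<odot>\<^bsub>N\<^esub> h \<zero>\<^bsub>M\<^esub>"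
    using assms(4) by (auto simp: module_hom_def)
  then show ?thesis
    using left_module_smult_zero[OF assms(1,2) M.zero_closed]
      left_module_smult_zero[OF assms(1,3) h0] by simp
qed

lemma module_hom_sum:
  assumes "ring R" "left_module R M" "left_module R N" "h \<in> module_hom R M N"
    and "finite S" "\<And>x. x \<in> S \<Longrightarrow> g x \<in> carrier M"
  shows "h (\<Oplus>\<^bsub>M\<^esub>x\<in>S. g x) = (\<Oplus>\<^bsub>N\<^esub>x\<in>S. h (g x))"
proof -
  interpret M: left_module R M by fact
  interpret N: left_module R N by fact
  have hc: "h y \<in> carrier N" if "y \<in> carrier M" for y
    using assms(4) that by (auto simp: module_hom_def)
  have hadd: "h (y \<oplus>\<^bsub>M\<^esub> z) = h y \<oplus>\<^bsub>N\<^esub> h z" if "y \<in> carrier M" "z \<in> carrier M" for y z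
    using assms(4) that by (auto simp: module_hom_def)
  show ?thesis using assms(5,6)
  proof (induction S)
    case empty
    then show ?case using module_hom_zero[OF assms(1-4)] by simp
  next
    case (insert y S)
    have "g \<in> S \<rightarrow> carrier M" "g y \<in> carrier M" "(\<lambda>x. h (g x)) \<in> S \<rightarrow> carrier N"
      "h (g y) \<in> carrier N"
      using insert.prems hc by auto
    then show ?case using insert hadd by simp
  qed
qed

lemma hom_linear_extension:
  assumes "ring R" "left_module R M" "left_module R N" "h \<in> module_hom R M N"
    and "g \<in> A \<rightarrow> carrier M" "f \<in> carrier (free_module R A)"
  shows "h (linear_extension R M g f) = linear_extension R N (\<lambda>x. h (g x)) f"
proof -
  interpret M: left_module R M by fact
  interpret N: left_module R N by fact
  have S: "finite {x. f x \<noteq> \<zero>\<^bsub>R\<^esub>}" "{x. f x \<noteq> \<zero>\<^bsub>R\<^esub>} \<subseteq> A"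
    using assms(6) by (auto simp: free_module_simps)
  have hc: "h y \<in> carrier N" if "y \<in> carrier M" for y
    using assms(4) that by (auto simp: module_hom_def)
  have hs: "h (a \<odot>\<^bsub>M\<^esub> y) = a \<odot>\<^bsub>N\<^esub> h y" if "a \<in> carrier R" "y \<in> carrier M" for a y
    using assms(4) that by (auto simp: module_hom_def)
  have g: "g x \<in> carrier M" if "f x \<noteq> \<zero>\<^bsub>R\<^esub>" for x using that S assms(5) by auto
  note app = free_module_apply[OF assms(1,6)]
  have "h (linear_extension R M g f) = (\<Oplus>\<^bsub>N\<^esub>x\<in>{x. f x \<noteq> \<zero>\<^bsub>R\<^esub>}. h (f x \<odot>\<^bsub>M\<^esub> g x))"
    unfolding linear_extension_def using S g app
    by (intro module_hom_sum[OF assms(1-4)]) (auto simp: M.smult_closed)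
  also have "\<dots> = linear_extension R N (\<lambda>x. h (g x)) f"
    unfolding linear_extension_def using g app hs hc
    by (intro N.finsum_cong') (auto simp: N.smult_closed)
  finally show ?thesis .
qed

lemma linear_extension_free_basis:
  assumes "ring R" "f \<in> carrier (free_module R A)"
  shows "linear_extension R (free_module R A) (free_basis R) f = f"
proof
  fix y
  interpret R: ring R by fact
  have F: "left_module R (free_module R A)" using left_module_free_module[OF assms(1)] .
  interpret F: left_module R "free_module R A" by fact
  note app = free_module_apply[OF assms(1)]
  have *: "(\<Oplus>\<^bsub>free_module R A\<^esub>x\<in>S. f x \<odot>\<^bsub>free_module R A\<^esub> free_basis R x) y =
      (if y \<in> S then f y else \<zero>\<^bsub>R\<^esub>)" if "finite S" "S \<subseteq> A" for S
    using that
  proof (induction S)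
    case empty
    then show ?case by (simp add: free_module_simps)
  next
    case (insert x S)
    have "f z \<odot>\<^bsub>free_module R A\<^esub> free_basis R z \<in> carrier (free_module R A)" if "z \<in> A" for z
      using app[OF assms(2)] free_basis_carrier[OF assms(1) that] by (rule F.smult_closed)
    then have "(\<lambda>z. f z \<odot>\<^bsub>free_module R A\<^esub> free_basis R z) \<in> insert x S \<rightarrow> carrier (free_module R A)"
      using insert.prems by auto
    then have "(\<Oplus>\<^bsub>free_module R A\<^esub>z\<in>insert x S. f z \<odot>\<^bsub>free_module R A\<^esub> free_basis R z) y =
       f x \<otimes>\<^bsub>R\<^esub> free_basis R x y \<oplus>\<^bsub>R\<^esub>
       (\<Oplus>\<^bsub>free_module R A\<^esub>z\<in>S. f z \<odot>\<^bsub>free_module R A\<^esub> free_basis R z) y"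
      using insert.hyps by (simp add: free_module_simps(3,4))
    then show ?case using insert app[OF assms(2)] by (auto simp: free_basis_def)
  qed
  show "linear_extension R (free_module R A) (free_basis R) f y = f y"
    unfolding linear_extension_def
    using assms(2) by (subst *) (auto simp: free_module_simps)
qed

lemma projective_free_module:
  assumes "ring R" shows "projective_module R (free_module R A)"
proof -
  let ?F = "free_module R A" and ?G = "free_module R (carrier (free_module R A))"
  have F: "left_module R ?F" "left_module R ?G"
    using left_module_free_module[OF assms] by blast+
  define s where "s = linear_extension R ?G (\<lambda>x. free_basis R (free_basis R x))"
  define r where "r = linear_extension R ?F (\<lambda>f. f)"
  have b: "(\<lambda>x. free_basis R (free_basis R x)) \<in> A \<rightarrow> carrier ?G"
    by (intro funcsetI free_basis_carrier[OF assms])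
  have s: "s \<in> module_hom R ?F ?G"
    unfolding s_def using b by (intro linear_extension_hom assms F)
  have r: "r \<in> module_hom R ?G ?F"
    unfolding r_def by (intro linear_extension_hom assms F) auto
  have "r (s f) = f" if f: "f \<in> carrier ?F" for f
  proof -
    have "r (s f) = linear_extension R ?F (\<lambda>x. r (free_basis R (free_basis R x))) f"
      unfolding s_def by (rule hom_linear_extension[OF assms F(2,1) r b f])
    also have "\<dots> = linear_extension R ?F (free_basis R) f"
    proof -
      interpret F: left_module R ?F by fact
      have 1: "r (free_basis R (free_basis R x)) = free_basis R x" if "x \<in> A" for x
        unfolding r_def
        by (rule linear_extension_basis[OF assms F(1)])
           (auto intro: free_basis_carrier[OF assms that])
      have 2: "x \<in> A" if "f x \<noteq> \<zero>\<^bsub>R\<^esub>" for x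
        using f that by (auto simp: free_module_simps)
      have 3: "f x \<odot>\<^bsub>?F\<^esub> free_basis R x \<in> carrier ?F" if "x \<in> A" for x
        by (intro F.smult_closed free_module_apply[OF assms f] free_basis_carrier[OF assms that])
      show ?thesis
        unfolding linear_extension_def by (intro F.finsum_cong') (use 1 2 3 in auto)
    qed
    also have "\<dots> = f" using linear_extension_free_basis[OF assms f] .
    finally show ?thesis .
  qed
  then show ?thesis unfolding projective_module_def
    by (intro conjI F(1) exI[of _ "carrier ?F"] bexI[OF _ s] bexI[OF _ r] ballI)
qed

text \<open>
  A set of generators so large that its finitely supported functions are images of generators;
  the same free module can then be used in every degree of a resolution.
\<close>

datatype ('r, 'm) generator = Element 'm | Combination "(('r, 'm) generator \<times> 'r) list"

lemma free_module_cover: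
  fixes R :: "('r, 'z) ring_scheme" and M :: "('r, 'm) module"
  assumes "ring R" "left_module R M" "H \<subseteq> carrier M" "\<zero>\<^bsub>M\<^esub> \<in> H"
    and "\<And>x y. x \<in> H \<Longrightarrow> y \<in> H \<Longrightarrow> x \<oplus>\<^bsub>M\<^esub> y \<in> H"
    and "\<And>a x. a \<in> carrier R \<Longrightarrow> x \<in> H \<Longrightarrow> a \<odot>\<^bsub>M\<^esub> x \<in> H"
    and v: "H \<subseteq> range (v :: 'x \<Rightarrow> 'm)"
  shows "\<exists>h\<in>module_hom R (free_module R (UNIV :: 'x set)) M.
           h ` carrier (free_module R (UNIV :: 'x set)) = H"
proof -
  interpret M: left_module R M by fact
  define g where "g t = (if v t \<in> H then v t else \<zero>\<^bsub>M\<^esub>)" for t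
  have gH: "g t \<in> H" for t using assms(4) by (simp add: g_def)
  have gM: "g \<in> UNIV \<rightarrow> carrier M" using gH assms(3) by auto
  have sumH: "(\<Oplus>\<^bsub>M\<^esub>x\<in>S. c x) \<in> H" if "finite S" "\<And>x. x \<in> S \<Longrightarrow> c x \<in> H" for S :: "'x set" and c
    using that
  proof (induction S)
    case empty
    then show ?case using assms(4) by simp
  next
    case (insert y S)
    have "c \<in> S \<rightarrow> carrier M" "c y \<in> carrier M" using insert.prems assms(3) by auto
    then show ?case using insert assms(5) by simp
  qed
  have "linear_extension R M g f \<in> H" if "f \<in> carrier (free_module R UNIV)" for f
    unfolding linear_extension_def using that gH free_module_apply[OF assms(1) that] assms(6)
    by (intro sumH) (auto simp: free_module_simps)
  moreover have "y \<in> linear_extension R M g ` carrier (free_module R UNIV)" if y: "y \<in> H" for y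
  proof -
    obtain t where t: "y = v t" using v y by blast
    have "linear_extension R M g (free_basis R t) = y"
      using linear_extension_basis[OF assms(1,2) gM, of t] y t by (simp add: g_def)
    then show ?thesis using free_basis_carrier[OF assms(1), of t UNIV] by force
  qed
  ultimately show ?thesis using linear_extension_hom[OF assms(1,2) gM] by blast
qed

lemma kernel_cover:
  assumes "ring R" "left_module R M" "left_module R N" "h \<in> module_hom R M N"
    and "carrier M \<subseteq> range (v :: 'x \<Rightarrow> 'm)"
  shows "\<exists>d\<in>module_hom R (free_module R (UNIV :: 'x set)) M.
           a_kernel M N h = d ` carrier (free_module R (UNIV :: 'x set))"
proof -
  interpret M: left_module R M by fact
  interpret N: left_module R N by fact
  have k: "a_kernel M N h = {x \<in> carrier M. h x = \<zero>\<^bsub>N\<^esub>}"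
    by (simp add: a_kernel_def kernel_def)
  have "\<exists>d\<in>module_hom R (free_module R (UNIV :: 'x set)) M.
      d ` carrier (free_module R (UNIV :: 'x set)) = a_kernel M N h"
    by (rule free_module_cover[OF assms(1,2), where v = v])
       (use assms module_hom_zero[OF assms(1-4)] left_module_smult_zero_right[OF assms(1,3)] in
         \<open>auto simp: k module_hom_def M.smult_closed\<close>)
  then show ?thesis by blast
qed

theorem projective_resolution_exists:
  fixes R :: "('r, 'z) ring_scheme" and M :: "('r, 'm) module"
  assumes R: "ring R" and M: "left_module R M"
  shows "\<exists>(P :: nat \<Rightarrow> ('r, ('r, 'm) generator \<Rightarrow> 'r) module) d \<eta>.
           projective_resolution R P d \<eta> M"
proof -
  define F :: "('r, ('r, 'm) generator \<Rightarrow> 'r) module" where "F = free_module R UNIV"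
  have F: "left_module R F" unfolding F_def using left_module_free_module[OF R] .
  interpret M: left_module R M by fact
  define v :: "('r, 'm) generator \<Rightarrow> 'm" where
    "v t = (case t of Element x \<Rightarrow> x | Combination ts \<Rightarrow> undefined)" for t
  define w :: "('r, 'm) generator \<Rightarrow> ('r, 'm) generator \<Rightarrow> 'r" where
    "w t = (case t of Element x \<Rightarrow> undefined
       | Combination ts \<Rightarrow> (\<lambda>u. case map_of ts u of None \<Rightarrow> \<zero>\<^bsub>R\<^esub> | Some a \<Rightarrow> a))" for t
  have v: "carrier M \<subseteq> range v"
  proof
    fix x show "x \<in> range v" by (rule range_eqI[of _ _ "Element x"]) (simp add: v_def)
  qed
  have w: "carrier F \<subseteq> range w"
  proof
    fix f assume "f \<in> carrier F"
    then have "finite {u. f u \<noteq> \<zero>\<^bsub>R\<^esub>}" by (auto simp: F_def free_module_simps)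
    then obtain us where us: "set us = {u. f u \<noteq> \<zero>\<^bsub>R\<^esub>}" using finite_list by blast
    have "f u = w (Combination (map (\<lambda>u. (u, f u)) us)) u" for u
      using us by (cases "u \<in> set us") (auto simp: w_def map_of_map_restrict restrict_map_def)
    then have "f = w (Combination (map (\<lambda>u. (u, f u)) us))" by (rule ext)
    then show "f \<in> range w" by blast
  qed
  obtain \<eta> where \<eta>: "\<eta> \<in> module_hom R F M" "\<eta> ` carrier F = carrier M"
    using free_module_cover[OF R M _ _ _ _ v] M.smult_closed unfolding F_def by auto
  obtain d0 where d0: "d0 \<in> module_hom R F F" "a_kernel F M \<eta> = d0 ` carrier F"
    using kernel_cover[OF R F M \<eta>(1) w] unfolding F_def by blast
  have "\<exists>d. \<forall>i. (d i \<in> module_hom R F F \<and> (i = (0::nat) \<longrightarrow> d i = d0)) \<and>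
      a_kernel F F (d i) = d (Suc i) ` carrier F"
  proof (rule dependent_nat_choice)
    show "\<exists>x. x \<in> module_hom R F F \<and> ((0::nat) = 0 \<longrightarrow> x = d0)" using d0(1) by blast
  next
    fix x and i :: nat assume "x \<in> module_hom R F F \<and> (i = 0 \<longrightarrow> x = d0)"
    then show "\<exists>y. (y \<in> module_hom R F F \<and> (Suc i = 0 \<longrightarrow> y = d0)) \<and>
        a_kernel F F x = y ` carrier F"
      using kernel_cover[OF R F F _ w, folded F_def] by blast
  qed
  then obtain d where d: "\<And>i. d i \<in> module_hom R F F" "d 0 = d0"
    "\<And>i. a_kernel F F (d i) = d (Suc i) ` carrier F" by blast
  have "projective_resolution R (\<lambda>i. F) d \<eta> M"
    unfolding projective_resolution_def
    using d d0 \<eta> projective_free_module[OF R] by (auto simp: F_def)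
  then show ?thesis by blast
qed

end

theory Submission
  imports Defs
begin

text \<open>
  Let \<open>I\<close> be the augmentation ideal of \<open>A = dTL n \<delta>\<close> and \<open>P\<close> a projective resolution of \<open>\<one>\<close> by right
  modules.  The diagrams \<open>D \<noteq> 1\<close> are covered by finitely many cells: those whose occupied right-hand
  vertices form a given proper subset, and those with all right-hand vertices occupied and a cup
  joining \<open>j\<close> and \<open>j + 1\<close> on the right.  A nonempty intersection of cells spans a left
  ideal \<open>A u\<close>, where \<open>u\<close> consists of horizontal edges at heights \<open>S\<close> and cups, and right multiplication by \<open>u\<close>
  identifies it with \<open>A e\<close> for the idempotent \<open>e\<close> with horizontal edges at \<open>S\<close>.  As \<open>e\<close> acts by zero
  on \<open>\<one>\<close>, the complex \<open>P e\<close> is exact, hence so is \<open>P A u\<close>.  Mayer--Vietoris over the cells makes \<open>P I\<close>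
  exact in every degree, so that \<open>P / P I = P \<otimes>\<^sub>A \<one>\<close> has the homology of \<open>\<one>\<close>.  For
  cohomology, projectivity turns the exactness of \<open>I P\<close> into a homotopy modulo \<open>I P\<close>, and
  homomorphisms to \<open>\<one>\<close> vanish on \<open>I P\<close>.
\<close>

section \<open>Products with partial identities and cups\<close>

text \<open>The obstacle is that \<delta> is arbitrary, so a cup cannot be rescaled to an
  idempotent. Isolated vertices offer a way round. If \<open>D\<close> has right support
  \<open>S\<close>, multiplying \<open>D\<close> on the right by horizontal edges at
  \<open>S\<close> and cups on further vertices only adds these cups to \<open>D\<close>: no edge
  floats, no loop closes, and the cups can be stripped off again. Diagrams of any other right
  support are sent to zero. Hence adding cups identifies two ideals without dividing by anything,
  and no power of \<delta> survives in the products that are computed explicitly. Cups have to enter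
  because a diagram with full right support escapes every idempotent with fewer horizontal edges;
  planarity then supplies a cup between neighbours unless the diagram is the identity. The
  homological part is carried out once, for left modules over an abstract algebra. It is applied to
  the opposite algebra for Tor, and to the algebra itself, with the cells reflected in the vertical
  axis, for Ext.\<close>

definition right_support :: "diagram \<Rightarrow> nat set" where
  "right_support D = {i. \<exists>e\<in>D. Rgt i \<in> e}"

definition left_support :: "diagram \<Rightarrow> nat set" where
  "left_support D = {i. \<exists>e\<in>D. Lft i \<in> e}"

lemma diagram_edge:
  assumes "D \<in> diagrams n" "e \<in> D"
  shows "e \<subseteq> vertices n" "card e = 2"
  using assms by (auto simp: diagrams_def)

lemma diagram_edge_unique:
  assumes "D \<in> diagrams n" "e \<in> D" "e' \<in> D" "v \<in> e" "v \<in> e'"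
  shows "e = e'"
  using assms unfolding diagrams_def by blast

lemma diagrams_subset:
  assumes "D \<in> diagrams n" "D' \<subseteq> D" shows "D' \<in> diagrams n"
proof -
  have "noncrossing n D" using assms(1) by (simp add: diagrams_def)
  then have "noncrossing n D'" unfolding noncrossing_def by (meson assms(2) subsetD)
  moreover have "e \<subseteq> vertices n \<and> card e = 2" if "e \<in> D'" for e
    using diagram_edge[OF assms(1)] assms(2) that by blast
  moreover have "e \<inter> e' = {}" if "e \<in> D'" "e' \<in> D'" "e \<noteq> e'" for e e'
    using diagram_edge_unique[OF assms(1)] assms(2) that by blast
  ultimately show ?thesis unfolding diagrams_def by blast
qed

lemma finite_diagrams: "finite (diagrams n)"
proof -
  have "diagrams n \<subseteq> Pow (Pow (vertices n))" by (auto simp: diagrams_def)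
  moreover have "finite (vertices n)" by (simp add: vertices_def)
  ultimately show ?thesis by (meson finite_Pow_iff finite_subset)
qed

lemma Lft_vertices [simp]: "Lft i \<in> vertices n \<longleftrightarrow> i \<in> {1..n}"
  and Rgt_vertices [simp]: "Rgt i \<in> vertices n \<longleftrightarrow> i \<in> {1..n}"
  by (auto simp: vertices_def)

lemma right_support_subset: "D \<in> diagrams n \<Longrightarrow> right_support D \<subseteq> {1..n}"
  and left_support_subset: "D \<in> diagrams n \<Longrightarrow> left_support D \<subseteq> {1..n}"
  using diagram_edge(1) Rgt_vertices Lft_vertices
  unfolding right_support_def left_support_def by blast+

lemma right_support_Un: "right_support (D \<union> E) = right_support D \<union> right_support E"
  by (auto simp: right_support_def)

lemma left_support_Un: "left_support (D \<union> E) = left_support D \<union> left_support E"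
  by (auto simp: left_support_def)

lemma inj_left_half: "inj left_half"
proof (rule injI)
  fix u v show "left_half u = left_half v \<Longrightarrow> u = v" by (cases u; cases v) auto
qed

lemma inj_right_half: "inj right_half"
proof (rule injI)
  fix u v show "right_half u = right_half v \<Longrightarrow> u = v" by (cases u; cases v) auto
qed

lemma left_half_eq [simp]:
  "left_half u = Middle i \<longleftrightarrow> u = Rgt i" "left_half u = First i \<longleftrightarrow> u = Lft i" "left_half u \<noteq> Last i"
  by (cases u; auto)+

lemma right_half_eq [simp]:
  "right_half u = Middle i \<longleftrightarrow> u = Lft i" "right_half u = Last i \<longleftrightarrow> u = Rgt i" "right_half u \<noteq> First i"
  by (cases u; auto)+

section \<open>Degrees and floating edges in the product graph\<close>

lemma degree3_eq:
  assumes "finite D1" "finite D2"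
  shows "degree3 D1 D2 v = card {e \<in> D1. v \<in> left_half ` e} + card {e \<in> D2. v \<in> right_half ` e}"
proof -
  have "{e \<in> edges3 D1 D2. v \<in> ends e} =
      (\<lambda>e. Inl (left_half ` e)) ` {e \<in> D1. v \<in> left_half ` e} \<union>
      (\<lambda>e. Inr (right_half ` e)) ` {e \<in> D2. v \<in> right_half ` e}"
    by (auto simp: edges3_def ends_def)
  moreover have "inj_on (\<lambda>e. Inl (left_half ` e) :: _ + vertex3 set) A"
    "inj_on (\<lambda>e. Inr (right_half ` e) :: vertex3 set + _) A" for A
    using inj_left_half inj_right_half by (auto simp: inj_on_def inj_image_eq_iff)
  moreover have "card ((\<lambda>e. Inl (left_half ` e)) ` {e \<in> D1. v \<in> left_half ` e} \<union>
        (\<lambda>e. Inr (right_half ` e)) ` {e \<in> D2. v \<in> right_half ` e}) =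
      card ((\<lambda>e. Inl (left_half ` e) :: _ + vertex3 set) ` {e \<in> D1. v \<in> left_half ` e}) +
      card ((\<lambda>e. Inr (right_half ` e) :: vertex3 set + _) ` {e \<in> D2. v \<in> right_half ` e})"
    using assms by (intro card_Un_disjoint) auto
  ultimately show ?thesis unfolding degree3_def
    by (simp add: card_image)
qed

lemma finite_diagram: "D \<in> diagrams n \<Longrightarrow> finite D"
  by (rule finite_subset[of _ "Pow (vertices n)"]) (auto simp: diagrams_def vertices_def)

lemma card_edges_at:
  assumes "D \<in> diagrams n"
  shows "card {e \<in> D. v \<in> e} = (if \<exists>e\<in>D. v \<in> e then 1 else 0)"
proof (cases "\<exists>e\<in>D. v \<in> e")
  case True
  then obtain e where "e \<in> D" "v \<in> e" by blast
  then have "{e \<in> D. v \<in> e} = {e}" using diagram_edge_unique[OF assms] by blast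
  then show ?thesis using True by simp
qed (auto simp: card_eq_0_iff)

lemma degree3_Middle:
  assumes "D1 \<in> diagrams n" "D2 \<in> diagrams n"
  shows "degree3 D1 D2 (Middle i) =
    (if i \<in> right_support D1 then 1 else 0) + (if i \<in> left_support D2 then 1 else 0)"
proof -
  have "Middle i \<in> left_half ` e \<longleftrightarrow> Rgt i \<in> e" "Middle i \<in> right_half ` e \<longleftrightarrow> Lft i \<in> e" for e
    by (simp_all add: image_iff eq_commute[of "Middle i"])
  then show ?thesis
    using assms by (simp add: degree3_eq finite_diagram card_edges_at right_support_def left_support_def)
qed

lemma degree3_First_Last:
  assumes "D1 \<in> diagrams n" "D2 \<in> diagrams n"
  shows "degree3 D1 D2 (First i) \<le> 1" "degree3 D1 D2 (Last i) \<le> 1"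
proof -
  have "First i \<in> left_half ` e \<longleftrightarrow> Lft i \<in> e" "First i \<notin> right_half ` e"
       "Last i \<in> right_half ` e \<longleftrightarrow> Rgt i \<in> e" "Last i \<notin> left_half ` e" for e
    by (simp_all add: image_iff eq_commute[of "First i"] eq_commute[of "Last i"])
  then show "degree3 D1 D2 (First i) \<le> 1" "degree3 D1 D2 (Last i) \<le> 1"
    using assms by (simp_all add: degree3_eq finite_diagram card_edges_at)
qed

lemma connected3_refl: "connected3 D1 D2 u u"
  by (simp add: connected3_def)

text \<open>Each factor contributes at most one edge at a middle vertex, so degree 1 means
  membership in exactly one of the two supports. Floating edges are thus detected without following
  any path.\<close>

lemma has_floating_edge_iff:
  assumes "D1 \<in> diagrams n" "D2 \<in> diagrams n"
  shows "has_floating_edge n D1 D2 \<longleftrightarrow> right_support D1 \<noteq> left_support D2"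
proof -
  have "has_floating_edge n D1 D2 \<longleftrightarrow> (\<exists>i\<in>{1..n}. degree3 D1 D2 (Middle i) = 1)"
  proof
    assume "has_floating_edge n D1 D2"
    then show "\<exists>i\<in>{1..n}. degree3 D1 D2 (Middle i) = 1"
      unfolding has_floating_edge_def components3_def quotient_def vertices3_def by auto
  next
    assume "\<exists>i\<in>{1..n}. degree3 D1 D2 (Middle i) = 1"
    then obtain i where i: "Middle i \<in> vertices3 n" "degree3 D1 D2 (Middle i) = 1"
      by (auto simp: vertices3_def)
    then show "has_floating_edge n D1 D2"
      unfolding has_floating_edge_def components3_def
      by (intro bexI[OF _ quotientI[OF i(1)]] exI[of _ i]) (auto simp: connected3_refl)
  qed
  also have "\<dots> \<longleftrightarrow> right_support D1 \<noteq> left_support D2"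
    using right_support_subset[OF assms(1)] left_support_subset[OF assms(2)]
    by (auto simp: degree3_Middle[OF assms] split: if_splits)
  finally show ?thesis .
qed

section \<open>Horizontal edges and cups\<close>

definition partial_identity :: "nat set \<Rightarrow> diagram" where
  "partial_identity S = (\<lambda>i. {Lft i, Rgt i}) ` S"

definition cup :: "nat \<Rightarrow> vertex set" where
  "cup j = {Rgt j, Rgt (Suc j)}"

definition cups :: "nat \<Rightarrow> diagram set" where
  "cups n = {C. (\<forall>e\<in>C. \<exists>j\<in>{1..<n}. e = cup j) \<and> (\<forall>e\<in>C. \<forall>e'\<in>C. e \<noteq> e' \<longrightarrow> e \<inter> e' = {})}"

lemma cupsE:
  assumes "C \<in> cups n" "e \<in> C" obtains j where "j \<in> {1..<n}" "e = cup j"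
  using assms by (auto simp: cups_def)

lemma identity_diagram_eq: "identity_diagram n = partial_identity {1..n}"
  by (auto simp: identity_diagram_def partial_identity_def)

lemma partial_identity_diagram: "S \<subseteq> {1..n} \<Longrightarrow> partial_identity S \<in> diagrams n"
proof -
  assume S: "S \<subseteq> {1..n}"
  have "noncrossing n (partial_identity S)" unfolding noncrossing_def
  proof (rule notI, elim exE conjE)
    fix u v x y
    assume *: "{u, v} \<in> partial_identity S" "{x, y} \<in> partial_identity S"
      "boundary_position n u < boundary_position n x"
      "boundary_position n x < boundary_position n v" "boundary_position n v < boundary_position n y"
    then obtain i j where "i \<in> S" "j \<in> S" "{u, v} = {Lft i, Rgt i}" "{x, y} = {Lft j, Rgt j}"
      by (auto simp: partial_identity_def)
    then show False using *(3-5) S by (auto simp: doubleton_eq_iff)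
  qed
  then show ?thesis using S unfolding diagrams_def partial_identity_def by auto
qed

lemma support_partial_identity [simp]:
  "right_support (partial_identity S) = S" "left_support (partial_identity S) = S"
  by (auto simp: right_support_def left_support_def partial_identity_def)

lemma cups_left_support: "C \<in> cups n \<Longrightarrow> left_support C = {}"
  by (fastforce simp: cups_def cup_def left_support_def)

lemma diagram_Un_cups:
  assumes D: "D \<in> diagrams n" and C: "C \<in> cups n" and disj: "right_support D \<inter> right_support C = {}"
  shows "D \<union> C \<in> diagrams n"
proof -
  have 1: "e \<inter> e' = {}" if e: "e \<in> D" "e' \<in> C" for e e'
  proof -
    obtain j where j: "e' = cup j" using cupsE[OF C e(2)] .
    then have "j \<in> right_support C" "Suc j \<in> right_support C"
      using e(2) by (auto simp: right_support_def cup_def)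
    then have "j \<notin> right_support D" "Suc j \<notin> right_support D" using disj by blast+
    then have "Rgt j \<notin> e" "Rgt (Suc j) \<notin> e" using e(1) by (auto simp: right_support_def)
    then show ?thesis using j by (auto simp: cup_def)
  qed
  have cupE: "\<exists>j::nat. 1 \<le> j \<and> j < n \<and> (u = Rgt j \<and> v = Rgt (Suc j) \<or> v = Rgt j \<and> u = Rgt (Suc j))"
    if e: "{u, v} \<in> C" for u v
  proof -
    obtain j where "j \<in> {1..<n}" "{u, v} = cup j" using cupsE[OF C e] .
    then show ?thesis by (auto simp: cup_def doubleton_eq_iff)
  qed
  have nc: "noncrossing n (D \<union> C)" unfolding noncrossing_def
  proof (rule notI, elim exE conjE)
    fix u v x y
    assume *: "{u, v} \<in> D \<union> C" "{x, y} \<in> D \<union> C" "boundary_position n u < boundary_position n x"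
      "boundary_position n x < boundary_position n v" "boundary_position n v < boundary_position n y"
    have "{u, v} \<notin> C" using cupE[of u v] *(3,4) by auto
    moreover have "{x, y} \<notin> C" using cupE[of x y] *(4,5) by auto
    ultimately have "{u, v} \<in> D" "{x, y} \<in> D" using *(1,2) by blast+
    moreover have "noncrossing n D" using D by (simp add: diagrams_def)
    ultimately show False using *(3-5) unfolding noncrossing_def by meson
  qed
  have "e \<subseteq> vertices n \<and> card e = 2" if e: "e \<in> C" for e
  proof -
    obtain j where "j \<in> {1..<n}" "e = cup j" using cupsE[OF C e] .
    then show ?thesis by (auto simp: cup_def)
  qed
  moreover have "e \<inter> e' = {}" if e: "e \<in> D \<union> C" "e' \<in> D \<union> C" "e \<noteq> e'" for e e'
  proof -
    have "e \<inter> e' = {}" if "e \<in> D" "e' \<in> D" using diagram_edge_unique[OF D that] e(3) by blast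
    moreover have "e \<inter> e' = {}" if "e \<in> C" "e' \<in> C"
      using C that e(3) by (simp add: cups_def)
    moreover have "e \<inter> e' = {}" if "e \<in> C" "e' \<in> D" using 1[OF that(2,1)] by blast
    ultimately show ?thesis using e(1,2) 1 by (elim UnE) simp_all
  qed
  moreover have "e \<subseteq> vertices n \<and> card e = 2" if "e \<in> D" for e
    using diagram_edge[OF D that] by blast
  ultimately have "\<forall>e\<in>D \<union> C. e \<subseteq> vertices n \<and> card e = 2"
    "\<forall>e\<in>D \<union> C. \<forall>e'\<in>D \<union> C. e \<noteq> e' \<longrightarrow> e \<inter> e' = {}" by blast+
  then show ?thesis using nc by (simp add: diagrams_def)
qed

section \<open>Multiplying a diagram by horizontal edges and cups\<close>

context
  fixes n :: nat and D C :: diagram and S :: "nat set"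
  assumes D: "D \<in> diagrams n" and C: "C \<in> cups n" and S: "right_support D = S"
    and disj: "S \<inter> right_support C = {}"
begin

lemma partial_identity_Un_cups: "partial_identity S \<union> C \<in> diagrams n"
  using right_support_subset[OF D] S disj
  by (intro diagram_Un_cups C partial_identity_diagram) auto

lemma not_floating_cups: "\<not> has_floating_edge n D (partial_identity S \<union> C)"
  using S by (simp add: has_floating_edge_iff[OF D partial_identity_Un_cups]
      left_support_Un cups_left_support[OF C])

lemma right_edge_connected3:
  assumes "e \<in> partial_identity S \<union> C" "right_half ` e = {u, v}"
  shows "connected3 D (partial_identity S \<union> C) u v"
proof -
  have "Inr {u, v} \<in> edges3 D (partial_identity S \<union> C)"
    using assms(1) unfolding edges3_def assms(2)[symmetric] by (rule UnI2[OF imageI[OF imageI]])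
  then have "\<exists>e\<in>edges3 D (partial_identity S \<union> C). ends e = {u, v}"
    by (rule bexI[rotated]) (simp add: ends_def)
  then show ?thesis unfolding connected3_def by (rule r_into_rtranclp)
qed

lemma left_edge_connected3:
  assumes "e \<in> D" "left_half ` e = {u, v}"
  shows "connected3 D (partial_identity S \<union> C) u v"
proof -
  have "Inl {u, v} \<in> edges3 D (partial_identity S \<union> C)"
    using assms(1) unfolding edges3_def assms(2)[symmetric] by (rule UnI1[OF imageI[OF imageI]])
  then have "\<exists>e\<in>edges3 D (partial_identity S \<union> C). ends e = {u, v}"
    by (rule bexI[rotated]) (simp add: ends_def)
  then show ?thesis unfolding connected3_def by (rule r_into_rtranclp)
qed

lemma strand_connected3:
  assumes "i \<in> S"
  shows "connected3 D (partial_identity S \<union> C) (Middle i) (Last i)"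
    "connected3 D (partial_identity S \<union> C) (Last i) (Middle i)"
proof -
  have "{Lft i, Rgt i} \<in> partial_identity S \<union> C" using assms by (auto simp: partial_identity_def)
  from right_edge_connected3[OF this]
  show "connected3 D (partial_identity S \<union> C) (Middle i) (Last i)"
    "connected3 D (partial_identity S \<union> C) (Last i) (Middle i)" by auto
qed

text \<open>A loop could only pass through middle vertices of degree 2, and these lie in
  \<open>S\<close>. But the strand at such a vertex leads on to \<open>Last i\<close>, whose degree
  is at most 1.\<close>

lemma number_of_loops_cups: "number_of_loops n D (partial_identity S \<union> C) = 0"
proof -
  let ?U = "partial_identity S \<union> C"
  note deg = degree3_First_Last[OF D partial_identity_Un_cups]
    degree3_Middle[OF D partial_identity_Un_cups]
  have ne: "degree3 D ?U (First i) \<noteq> 2" "degree3 D ?U (Last i) \<noteq> 2" for i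
    using deg(1,2)[of i] by linarith+
  have "\<exists>v\<in>K. degree3 D ?U v \<noteq> 2" if K: "K \<in> components3 n D ?U" for K
  proof -
    obtain v where v: "v \<in> vertices3 n" "K = {w \<in> vertices3 n. connected3 D ?U v w}"
      using K by (auto simp: components3_def quotient_def)
    have vK: "v \<in> K" using v by (simp add: connected3_refl)
    show ?thesis
    proof (cases "\<exists>i. v = Middle i \<and> i \<in> S")
      case True
      then obtain i where i: "v = Middle i" "i \<in> S" by blast
      then have "Last i \<in> K"
        using v strand_connected3(1)[OF i(2)] by (auto simp: vertices3_def)
      then show ?thesis using deg(2)[of i] by (intro bexI[of _ "Last i"]) auto
    next
      case False
      then have "degree3 D ?U v \<noteq> 2"
        using ne by (cases v) (simp_all add: deg(3) left_support_Un cups_left_support[OF C])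
      then show ?thesis using vK by blast
    qed
  qed
  then have none: "{K \<in> components3 n D ?U. \<forall>v\<in>K. degree3 D ?U v = 2} = {}" by blast
  show ?thesis unfolding number_of_loops_def none by simp
qed

text \<open>Contracting the strands at \<open>S\<close> turns the product graph into
  \<open>D \<union> C\<close>. As this is a matching, its connected components are single edges or
  single vertices.\<close>

lemma composite_cups: "composite n D (partial_identity S \<union> C) = D \<union> C"
proof -
  let ?U = "partial_identity S \<union> C"
  have DC: "D \<union> C \<in> diagrams n" using diagram_Un_cups[OF D C] S disj by simp
  \<comment> \<open>The contraction: it folds the middle column onto the right-hand one and inverts
    \<open>outer\<close> on the two outer columns.\<close>
  define p where "p x = (case x of First i \<Rightarrow> Lft i | Middle i \<Rightarrow> Rgt i | Last i \<Rightarrow> Rgt i)" for x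
  have p_left: "p ` left_half ` e = e" for e
  proof -
    have "p (left_half v) = v" for v by (cases v) (auto simp: p_def)
    then show ?thesis by (simp add: image_image)
  qed
  have p_outer: "p (outer v) = v" for v by (cases v) (auto simp: p_def)
  have edge: "p u = p v \<or> {p u, p v} \<in> D \<union> C" if e: "e \<in> edges3 D ?U" "ends e = {u, v}" for e u v
  proof -
    have puv: "p ` ends e = {p u, p v}" using e(2) by simp
    consider e' where "e = Inl (left_half ` e')" "e' \<in> D"
      | i where "e = Inr (right_half ` {Lft i, Rgt i})" "i \<in> S"
      | e' where "e = Inr (right_half ` e')" "e' \<in> C"
      using e(1) by (auto simp: edges3_def partial_identity_def)
    then show ?thesis
    proof cases
      case 1
      then show ?thesis using puv p_left[of e'] by (auto simp: ends_def)
    next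
      case 2
      then have "{p u, p v} = {Rgt i}" using puv by (auto simp: ends_def p_def)
      then show ?thesis by auto
    next
      case 3
      obtain j where j: "e' = cup j" using cupsE[OF C 3(2)] .
      have "p ` ends e = e'" using 3(1) j by (simp add: ends_def cup_def p_def)
      then show ?thesis using puv 3(2) by simp
    qed
  qed
  have conn: "p u = p v \<or> {p u, p v} \<in> D \<union> C" if "connected3 D ?U u v" for u v
    using that unfolding connected3_def
  proof (induction rule: rtranclp_induct)
    case (step v w)
    then have vw: "p v = p w \<or> {p v, p w} \<in> D \<union> C"
      using edge by blast
    show ?case
    proof (cases "p u = p v \<or> p v = p w")
      case False
      \<comment> \<open>Two successive edges that survive the contraction share the vertex
        \<open>p v\<close>. In a matching they coincide, so the walk is back at
        \<open>p u\<close>.\<close>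
      then have "{p u, p v} \<in> D \<union> C" "{p v, p w} \<in> D \<union> C" using vw step.IH by blast+
      then have "{p u, p v} = {p v, p w}" using diagram_edge_unique[OF DC] by blast
      then show ?thesis by (auto simp: doubleton_eq_iff)
    qed (use vw step.IH in auto)
  qed simp
  have trans: "connected3 D ?U a b \<Longrightarrow> connected3 D ?U b c \<Longrightarrow> connected3 D ?U a c" for a b c
    unfolding connected3_def by (rule rtranclp_trans)
  \<comment> \<open>For the converse, an edge of \<open>D\<close> is prolonged along strands at
    those of its ends that lie in the middle column; such ends belong to the right support of
    \<open>D\<close>, which is \<open>S\<close>.\<close>
  have conn': "connected3 D ?U (outer u) (outer v)" if uv: "{u, v} \<in> D" for u v
  proof -
    have S': "i \<in> S" if "Rgt i \<in> {u, v}" for i using that uv S by (auto simp: right_support_def)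
    have "connected3 D ?U (left_half u) (left_half v)"
      using uv by (rule left_edge_connected3) simp
    moreover have "connected3 D ?U (outer w) (left_half w)" if "w \<in> {u, v}" for w
      using S' strand_connected3(2) that by (cases w) (auto simp: connected3_refl)
    moreover have "connected3 D ?U (left_half w) (outer w)" if "w \<in> {u, v}" for w
      using S' strand_connected3(1) that by (cases w) (auto simp: connected3_refl)
    ultimately show ?thesis by (meson trans insertI1 insertI2)
  qed
  have conn'': "connected3 D ?U (outer u) (outer v)" if uv: "{u, v} \<in> C" for u v
  proof -
    obtain j where j: "{u, v} = cup j" using cupsE[OF C uv] .
    then have "right_half ` {u, v} = {outer u, outer v}"
      by (auto simp: cup_def doubleton_eq_iff)
    then show ?thesis using uv by (intro right_edge_connected3[of "{u, v}"]) auto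
  qed
  show ?thesis
  proof (intro equalityI subsetI)
    fix e assume "e \<in> composite n D ?U"
    then obtain u v where uv: "e = {u, v}" "u \<noteq> v" "connected3 D ?U (outer u) (outer v)"
      by (auto simp: composite_def)
    then show "e \<in> D \<union> C" using conn[OF uv(3)] by (simp add: p_outer)
  next
    fix e assume e: "e \<in> D \<union> C"
    obtain u v where uv: "e = {u, v}" "u \<noteq> v" using diagram_edge(2)[OF DC e] by (auto simp: card_2_iff)
    then show "e \<in> composite n D ?U"
      using diagram_edge(1)[OF DC e] e conn' conn'' unfolding composite_def by blast
  qed
qed

end

lemma diagram_product_cups:
  assumes D: "D \<in> diagrams n" and C: "C \<in> cups n" and S: "S \<subseteq> {1..n}"
    and disj: "S \<inter> right_support C = {}"
  shows "diagram_product n \<delta> D (partial_identity S \<union> C) E =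
    (if right_support D = S \<and> E = D \<union> C then 1 else 0)"
proof (cases "right_support D = S")
  case True
  then show ?thesis
    using not_floating_cups[OF D C True disj] number_of_loops_cups[OF D C True disj]
      composite_cups[OF D C True disj] by (simp add: diagram_product_def)
next
  case False
  have "partial_identity S \<union> C \<in> diagrams n"
    using S disj by (intro diagram_Un_cups C partial_identity_diagram) auto
  from has_floating_edge_iff[OF D this] False show ?thesis
    by (simp add: diagram_product_def left_support_Un cups_left_support[OF C])
qed

section \<open>Coefficients of products in the algebra, and the unit\<close>

lemma dTL_simps:
  "carrier (dTL n \<delta>) = {f. \<forall>D. D \<notin> diagrams n \<longrightarrow> f D = 0}"
  "\<zero>\<^bsub>dTL n \<delta>\<^esub> = (\<lambda>D. 0)"
  "f \<oplus>\<^bsub>dTL n \<delta>\<^esub> g = (\<lambda>D. f D + g D)"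
  "c \<odot>\<^bsub>dTL n \<delta>\<^esub> f = (\<lambda>D. c * f D)"
  "\<one>\<^bsub>dTL n \<delta>\<^esub> = (\<lambda>D. if D \<subseteq> identity_diagram n then 1 else 0)"
  by (simp_all add: dTL_def)

lemma dTL_mult:
  "(f \<otimes>\<^bsub>dTL n \<delta>\<^esub> g) D =
    (\<Sum>D1\<in>diagrams n. \<Sum>D2\<in>diagrams n. f D1 * g D2 * diagram_product n \<delta> D1 D2 D)"
  by (simp add: dTL_def)

definition diagram_element :: "diagram \<Rightarrow> diagram \<Rightarrow> 'k::{comm_ring, comm_monoid_mult}" where
  "diagram_element D = (\<lambda>E. if E = D then 1 else 0)"

text \<open>When \<open>C\<close> is a set of cups disjoint from \<open>S\<close>, these are the
  diagrams \<open>D \<union> C\<close> with \<open>D\<close> of right support \<open>S\<close>: the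
  diagrams that span the left ideal generated by \<open>partial_identity S \<union> C\<close>. For
  \<open>C = {}\<close> only the right support is prescribed.\<close>

definition right_part :: "nat \<Rightarrow> nat set \<Rightarrow> diagram \<Rightarrow> diagram set" where
  "right_part n S C = {D \<in> diagrams n. C \<subseteq> D \<and> right_support D = S \<union> right_support C}"

context
  fixes n :: nat and S :: "nat set" and C :: diagram
  assumes C: "C \<in> cups n" and S: "S \<subseteq> {1..n}" and disj: "S \<inter> right_support C = {}"
begin

lemma right_part_Diff:
  assumes "E \<in> right_part n S C"
  shows "E - C \<in> diagrams n" "right_support (E - C) = S" "E - C \<union> C = E"
proof -
  have E: "E \<in> diagrams n" "C \<subseteq> E" "right_support E = S \<union> right_support C"
    using assms by (auto simp: right_part_def)
  show "E - C \<in> diagrams n" using diagrams_subset[OF E(1)] by blast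
  show EC: "E - C \<union> C = E" using E(2) by blast
  have "i \<notin> right_support C" if i: "i \<in> right_support (E - C)" for i
  proof
    assume "i \<in> right_support C"
    then obtain e e' where "e \<in> E" "e \<notin> C" "e' \<in> C" "Rgt i \<in> e" "Rgt i \<in> e'"
      using i unfolding right_support_def by blast
    then show False using diagram_edge_unique[OF E(1), of e e' "Rgt i"] E(2) by blast
  qed
  moreover have "right_support (E - C) \<union> right_support C = S \<union> right_support C"
    using right_support_Un[of "E - C" C] E(3) EC by simp
  ultimately show "right_support (E - C) = S" using disj by blast
qed

lemma right_part_Un:
  assumes "D \<in> diagrams n" "right_support D = S"
  shows "D \<union> C \<in> right_part n S C" "D \<union> C - C = D"
proof -
  show "D \<union> C \<in> right_part n S C"
    using diagram_Un_cups[OF assms(1) C] assms(2) disj by (auto simp: right_part_def right_support_Un)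
  have "e \<notin> D" if e: "e \<in> C" for e
  proof
    assume "e \<in> D"
    obtain j where "e = cup j" using cupsE[OF C e] .
    then have "j \<in> right_support C" "j \<in> right_support D"
      using e \<open>e \<in> D\<close> by (auto simp: right_support_def cup_def)
    then show False using assms(2) disj by blast
  qed
  then show "D \<union> C - C = D" by blast
qed

lemma cups_element_diagram: "partial_identity S \<union> C \<in> diagrams n"
  using S disj by (intro diagram_Un_cups C partial_identity_diagram) auto

text \<open>Removing \<open>C\<close> is inverse to adding \<open>C\<close>, so each coefficient of
  the product stems from a single diagram. Right multiplication keeps the diagrams of right support
  \<open>S\<close>, drops all others, and relabels what is kept.\<close>

lemma dTL_mult_cups:
  "a \<otimes>\<^bsub>dTL n \<delta>\<^esub> diagram_element (partial_identity S \<union> C) =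
    (\<lambda>E. if E \<in> right_part n S C then a (E - C) else 0)"
proof
  let ?A = "dTL n \<delta>" and ?u = "diagram_element (partial_identity S \<union> C)"
  fix E
  have "(a \<otimes>\<^bsub>?A\<^esub> ?u) E =
      (\<Sum>D\<in>diagrams n. a D * diagram_product n \<delta> D (partial_identity S \<union> C) E)"
    unfolding dTL_mult
  proof (rule sum.cong[OF refl])
    fix D
    have "(\<Sum>D2\<in>diagrams n. a D * ?u D2 * diagram_product n \<delta> D D2 E)
      = (\<Sum>D2\<in>{partial_identity S \<union> C}. a D * ?u D2 * diagram_product n \<delta> D D2 E)"
      using cups_element_diagram finite_diagrams
      by (intro sum.mono_neutral_right) (auto simp: diagram_element_def)
    then show "(\<Sum>D2\<in>diagrams n. a D * ?u D2 * diagram_product n \<delta> D D2 E)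
      = a D * diagram_product n \<delta> D (partial_identity S \<union> C) E"
      by (simp add: diagram_element_def)
  qed
  also have "\<dots> = (\<Sum>D\<in>diagrams n. if right_support D = S \<and> E = D \<union> C then a D else 0)"
    by (rule sum.cong[OF refl]) (simp add: diagram_product_cups[OF _ C S disj])
  also have "\<dots> = (if E \<in> right_part n S C then a (E - C) else 0)"
  proof (cases "E \<in> right_part n S C")
    case True
    have "(\<Sum>D\<in>diagrams n. if right_support D = S \<and> E = D \<union> C then a D else 0) =
      (\<Sum>D\<in>{E - C}. if right_support D = S \<and> E = D \<union> C then a D else 0)"
      using right_part_Diff[OF True] right_part_Un finite_diagrams
      by (intro sum.mono_neutral_right) auto
    then show ?thesis using True right_part_Diff[OF True] by simp
  next
    case False
    then have "(if right_support D = S \<and> E = D \<union> C then a D else 0) = 0" if "D \<in> diagrams n" for D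
      using right_part_Un(1)[OF that] by auto
    then show ?thesis using False by simp
  qed
  finally show "(a \<otimes>\<^bsub>?A\<^esub> ?u) E =
      (if E \<in> right_part n S C then a (E - C) else 0)" .
qed

end

lemma subset_identity_diagram:
  assumes "D \<subseteq> identity_diagram n"
  shows "D = partial_identity (right_support D)" "right_support D \<subseteq> {1..n}"
proof -
  have strand: "\<exists>i\<in>{1..n}. e = {Lft i, Rgt i}" if "e \<in> D" for e
    using subsetD[OF assms that] by (auto simp: identity_diagram_def)
  have "e \<in> partial_identity (right_support D)" if e: "e \<in> D" for e
  proof -
    obtain i where "e = {Lft i, Rgt i}" using strand[OF e] by blast
    then show ?thesis using e unfolding partial_identity_def right_support_def by blast
  qed
  then have "D \<subseteq> partial_identity (right_support D)" by blast
  moreover have "e \<in> D" if e: "e \<in> partial_identity (right_support D)" for e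
  proof -
    obtain i where i: "e = {Lft i, Rgt i}" "i \<in> right_support D"
      using e by (auto simp: partial_identity_def)
    then obtain e' where e': "e' \<in> D" "Rgt i \<in> e'" by (auto simp: right_support_def)
    then have "e' = {Lft i, Rgt i}" using strand[OF e'(1)] by auto
    then show ?thesis using e' i by simp
  qed
  ultimately show "D = partial_identity (right_support D)" by blast
  show "right_support D \<subseteq> {1..n}"
    using strand by (force simp: right_support_def)
qed

text \<open>The unit is the sum of all partial identities. For a given \<open>D\<close> only the one
  at the right support of \<open>D\<close> produces no floating edge, and it returns
  \<open>D\<close>; this is the case without cups of \<open>diagram_product_cups\<close>.\<close>

lemma dTL_right_one:
  assumes "a \<in> carrier (dTL n \<delta>)"
  shows "a \<otimes>\<^bsub>dTL n \<delta>\<^esub> \<one>\<^bsub>dTL n \<delta>\<^esub> = a"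
proof
  fix E
  have *: "a D * \<one>\<^bsub>dTL n \<delta>\<^esub> D2 * diagram_product n \<delta> D D2 E =
      (if D2 = partial_identity (right_support D) \<and> E = D then a D else 0)"
    if D: "D \<in> diagrams n" "D2 \<in> diagrams n" for D D2
  proof (cases "D2 \<subseteq> identity_diagram n")
    case True
    note D2 = subset_identity_diagram[OF True]
    have "diagram_product n \<delta> D (partial_identity (right_support D2) \<union> {}) E =
      (if right_support D = right_support D2 \<and> E = D \<union> {} then 1 else 0)"
      using D(1) D2(2) by (intro diagram_product_cups) (auto simp: cups_def right_support_def)
    then have "diagram_product n \<delta> D D2 E = (if right_support D = right_support D2 \<and> E = D then 1 else 0)"
      using D2(1) by simp
    moreover have "D2 = partial_identity (right_support D) \<longleftrightarrow> right_support D = right_support D2"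
      using D2(1) by (metis support_partial_identity(1))
    ultimately show ?thesis using True by (simp add: dTL_simps)
  next
    case False
    then have "D2 \<noteq> partial_identity (right_support D)"
      using right_support_subset[OF D(1)] by (auto simp: identity_diagram_eq partial_identity_def)
    then show ?thesis using False by (simp add: dTL_simps)
  qed
  have "(a \<otimes>\<^bsub>dTL n \<delta>\<^esub> \<one>\<^bsub>dTL n \<delta>\<^esub>) E = (\<Sum>D\<in>diagrams n. \<Sum>D2\<in>diagrams n.
      if D2 = partial_identity (right_support D) \<and> E = D then a D else 0)"
    unfolding dTL_mult by (intro sum.cong refl *)
  also have "\<dots> = (\<Sum>D\<in>diagrams n. if E = D then a D else 0)"
  proof (rule sum.cong[OF refl])
    fix D assume D: "D \<in> diagrams n"
    have "partial_identity (right_support D) \<in> diagrams n"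
      by (rule partial_identity_diagram[OF right_support_subset[OF D]])
    then show "(\<Sum>D2\<in>diagrams n. if D2 = partial_identity (right_support D) \<and> E = D then a D else 0) =
        (if E = D then a D else 0)"
      using finite_diagrams by (cases "E = D") (simp_all add: sum.delta)
  qed
  also have "\<dots> = a E" using assms finite_diagrams by (simp add: sum.delta' dTL_simps)
  finally show "(a \<otimes>\<^bsub>dTL n \<delta>\<^esub> \<one>\<^bsub>dTL n \<delta>\<^esub>) E = a E" .
qed

section \<open>Reflection in the vertical axis\<close>

fun flip :: "vertex \<Rightarrow> vertex" where
  "flip (Lft i) = Rgt i"
| "flip (Rgt i) = Lft i"

fun flip3 :: "vertex3 \<Rightarrow> vertex3" where
  "flip3 (First i) = Last i"
| "flip3 (Middle i) = Middle i"
| "flip3 (Last i) = First i"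

definition mirror :: "diagram \<Rightarrow> diagram" where
  "mirror D = (`) flip ` D"

lemma flip_flip [simp]: "flip (flip v) = v"
  by (cases v) auto

lemma flip3_flip3 [simp]: "flip3 (flip3 v) = v"
  by (cases v) auto

lemma mirror_mirror [simp]: "mirror (mirror D) = D"
  by (simp add: mirror_def image_image)

lemma inj_flip: "inj flip"
  by (metis injI flip_flip)

lemma inj_flip3: "inj flip3"
  by (metis injI flip3_flip3)

lemma flip_image_flip_image [simp]: "flip ` flip ` e = e" "flip3 ` flip3 ` e' = e'"
  by (simp_all add: image_image)

lemma mem_mirror_iff: "e \<in> mirror D \<longleftrightarrow> flip ` e \<in> D"
  unfolding mirror_def by (metis flip_image_flip_image(1) imageI image_iff)

lemma flip_mem_vertices [simp]: "flip v \<in> vertices n \<longleftrightarrow> v \<in> vertices n"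
  by (cases v) (simp_all only: flip.simps Lft_vertices Rgt_vertices)

lemma boundary_position_flip:
  "v \<in> vertices n \<Longrightarrow> boundary_position n (flip v) = 2 * n + 1 - boundary_position n v"
  by (cases v) auto

lemma boundary_position_le: "v \<in> vertices n \<Longrightarrow> boundary_position n v \<le> 2 * n"
  by (cases v) auto

lemma mirror_diagrams_imp:
  assumes D: "D \<in> diagrams n" shows "mirror D \<in> diagrams n"
proof -
  have edge: "e \<subseteq> vertices n \<and> card e = 2" if e: "e \<in> mirror D" for e
  proof -
    have "flip ` e \<in> D" using e by (simp add: mem_mirror_iff)
    from diagram_edge[OF D this] show ?thesis
      by (auto simp: card_image[OF inj_on_subset[OF inj_flip subset_UNIV]])
  qed
  have disj: "e \<inter> e' = {}" if e: "e \<in> mirror D" "e' \<in> mirror D" "e \<noteq> e'" for e e'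
  proof (rule ccontr)
    assume "e \<inter> e' \<noteq> {}"
    then obtain v where "flip v \<in> flip ` e" "flip v \<in> flip ` e'" by blast
    then have "flip ` e = flip ` e'"
      using diagram_edge_unique[OF D] e(1,2) by (meson mem_mirror_iff)
    then have "e = e'" by (metis flip_image_flip_image(1))
    then show False using e(3) by simp
  qed
  have nc: "noncrossing n (mirror D)" unfolding noncrossing_def
  proof (rule notI, elim exE conjE)
    fix u v x y
    assume *: "{u, v} \<in> mirror D" "{x, y} \<in> mirror D" "boundary_position n u < boundary_position n x"
      "boundary_position n x < boundary_position n v" "boundary_position n v < boundary_position n y"
    have V: "u \<in> vertices n" "v \<in> vertices n" "x \<in> vertices n" "y \<in> vertices n"
      using edge[OF *(1)] edge[OF *(2)] by auto
    \<comment> \<open>Reflection reverses the order along the boundary, so both the two edges and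
      the ends of each of them change places.\<close>
    have D': "{flip y, flip x} \<in> D" "{flip v, flip u} \<in> D"
      using *(1,2) by (simp_all add: mem_mirror_iff insert_commute)
    have "boundary_position n (flip y) < boundary_position n (flip v)"
      "boundary_position n (flip v) < boundary_position n (flip x)"
      "boundary_position n (flip x) < boundary_position n (flip u)"
      using *(3-5) V[THEN boundary_position_le] by (simp_all add: boundary_position_flip V)
    moreover have "noncrossing n D" using D by (simp add: diagrams_def)
    ultimately show False using D' unfolding noncrossing_def by meson
  qed
  show ?thesis using edge disj nc by (simp add: diagrams_def)
qed

lemma mirror_diagrams [simp]: "mirror D \<in> diagrams n \<longleftrightarrow> D \<in> diagrams n"
  using mirror_diagrams_imp[of D n] mirror_diagrams_imp[of "mirror D" n] by auto

lemma mirror_identity_diagram [simp]: "mirror (identity_diagram n) = identity_diagram n"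
proof -
  have "flip ` {Lft i, Rgt i} = {Lft i, Rgt i}" for i by auto
  then have "(\<lambda>i. flip ` {Lft i, Rgt i}) ` {1..n} = (\<lambda>i. {Lft i, Rgt i}) ` {1..n}" by presburger
  then show ?thesis unfolding mirror_def identity_diagram_eq partial_identity_def image_image .
qed

lemma mirror_subset_iff: "mirror D \<subseteq> mirror E \<longleftrightarrow> D \<subseteq> E"
  by (metis image_mono mirror_def mirror_mirror)

section \<open>Reflection of the product graph\<close>

definition mirror_edge :: "vertex3 set + vertex3 set \<Rightarrow> vertex3 set + vertex3 set" where
  "mirror_edge = case_sum (\<lambda>X. Inr (flip3 ` X)) (\<lambda>X. Inl (flip3 ` X))"

lemma mirror_edge_mirror_edge [simp]: "mirror_edge (mirror_edge e) = e"
  by (cases e) (simp_all add: mirror_edge_def)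

lemma ends_mirror_edge [simp]: "ends (mirror_edge e) = flip3 ` ends e"
  by (cases e) (simp_all add: mirror_edge_def ends_def)

lemma half_flip: "left_half (flip v) = flip3 (right_half v)" "right_half (flip v) = flip3 (left_half v)"
  by (cases v; simp)+

lemma edges3_mirror: "edges3 (mirror D2) (mirror D1) = mirror_edge ` edges3 D1 D2"
proof -
  have "left_half ` flip ` e = flip3 ` right_half ` e" "right_half ` flip ` e = flip3 ` left_half ` e" for e
    by (simp_all add: image_image half_flip)
  then show ?thesis unfolding edges3_def mirror_def
    by (simp add: image_Un image_image mirror_edge_def Un_commute)
qed

lemma degree3_mirror: "degree3 (mirror D2) (mirror D1) (flip3 v) = degree3 D1 D2 v"
proof -
  have "{e \<in> edges3 (mirror D2) (mirror D1). flip3 v \<in> ends e} =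
      mirror_edge ` {e \<in> edges3 D1 D2. v \<in> ends e}"
    by (auto simp: edges3_mirror inj_image_mem_iff[OF inj_flip3])
  moreover have "inj_on mirror_edge A" for A by (metis inj_onI mirror_edge_mirror_edge)
  ultimately show ?thesis by (simp add: degree3_def card_image)
qed

lemma connected3_mirror_imp:
  assumes "connected3 D1 D2 u v"
  shows "connected3 (mirror D2) (mirror D1) (flip3 u) (flip3 v)"
  using assms unfolding connected3_def
proof (induction rule: rtranclp_induct)
  case (step v w)
  then obtain e where e: "e \<in> edges3 D1 D2" "ends e = {v, w}" by blast
  then have "mirror_edge e \<in> edges3 (mirror D2) (mirror D1)" "ends (mirror_edge e) = {flip3 v, flip3 w}"
    by (simp_all add: edges3_mirror)
  then have "\<exists>e\<in>edges3 (mirror D2) (mirror D1). ends e = {flip3 v, flip3 w}" by blast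
  then show ?case using step.IH by (rule rtranclp.rtrancl_into_rtrancl[rotated])
qed simp

lemma connected3_mirror:
  "connected3 (mirror D2) (mirror D1) (flip3 u) (flip3 v) \<longleftrightarrow> connected3 D1 D2 u v"
  using connected3_mirror_imp[of D1 D2 u v]
    connected3_mirror_imp[of "mirror D2" "mirror D1" "flip3 u" "flip3 v"] by auto

lemma flip3_mem_vertices3 [simp]: "flip3 v \<in> vertices3 n \<longleftrightarrow> v \<in> vertices3 n"
  by (cases v) (auto simp: vertices3_def)

lemma components3_eq:
  "components3 n D1 D2 = (\<lambda>v. {w \<in> vertices3 n. connected3 D1 D2 v w}) ` vertices3 n"
  by (auto simp: components3_def quotient_def)

lemma components3_mirror: "components3 n (mirror D2) (mirror D1) = (`) flip3 ` components3 n D1 D2"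
proof -
  have V: "vertices3 n = flip3 ` vertices3 n"
    by (metis flip3_mem_vertices3 flip3_flip3 image_eqI subsetI subset_antisym image_subsetI)
  have "flip3 ` {w \<in> vertices3 n. connected3 D1 D2 v w} =
      {w \<in> vertices3 n. connected3 (mirror D2) (mirror D1) (flip3 v) w}" (is "?A = ?B") for v
  proof
    show "?A \<subseteq> ?B" by (auto simp: connected3_mirror)
    show "?B \<subseteq> ?A"
    proof
      fix w assume "w \<in> ?B"
      then have "flip3 w \<in> {w \<in> vertices3 n. connected3 D1 D2 v w}"
        using connected3_mirror[of D2 D1 v "flip3 w"] by simp
      then show "w \<in> ?A" by (rule image_eqI[rotated]) simp
    qed
  qed
  then show ?thesis unfolding components3_eq by (subst V) (simp add: image_image)
qed

lemma number_of_loops_mirror: "number_of_loops n (mirror D2) (mirror D1) = number_of_loops n D1 D2"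
proof -
  have "{K \<in> components3 n (mirror D2) (mirror D1). \<forall>v\<in>K. degree3 (mirror D2) (mirror D1) v = 2}
      = (`) flip3 ` {K \<in> components3 n D1 D2. \<forall>v\<in>K. degree3 D1 D2 v = 2}"
    by (auto simp: components3_mirror degree3_mirror)
  moreover have "inj_on ((`) flip3) A" for A by (metis inj_onI flip_image_flip_image(2))
  ultimately show ?thesis by (simp add: number_of_loops_def card_image)
qed

lemma support_mirror [simp]:
  "right_support (mirror D) = left_support D" "left_support (mirror D) = right_support D"
proof -
  have "Rgt i \<in> flip ` e \<longleftrightarrow> Lft i \<in> e" "Lft i \<in> flip ` e \<longleftrightarrow> Rgt i \<in> e" for i e
    using inj_image_mem_iff[OF inj_flip, of "Lft i" e] inj_image_mem_iff[OF inj_flip, of "Rgt i" e]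
    by simp_all
  then show "right_support (mirror D) = left_support D" "left_support (mirror D) = right_support D"
    by (simp_all add: right_support_def left_support_def mirror_def)
qed

lemma outer_flip: "outer (flip v) = flip3 (outer v)"
  by (cases v) auto

lemma composite_mirror: "composite n (mirror D2) (mirror D1) = mirror (composite n D1 D2)"
proof -
  have sub: "mirror (composite n D1 D2) \<subseteq> composite n (mirror D2) (mirror D1)" for D1 D2
  proof
    fix e assume "e \<in> mirror (composite n D1 D2)"
    then obtain u v where *: "e = {flip u, flip v}" "u \<in> vertices n" "v \<in> vertices n" "u \<noteq> v"
      "connected3 D1 D2 (outer u) (outer v)"
      by (auto simp: mirror_def composite_def)
    have "connected3 (mirror D2) (mirror D1) (outer (flip u)) (outer (flip v))"
      using *(5) by (simp add: connected3_mirror outer_flip)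
    moreover have "flip u \<noteq> flip v" using *(4) by (metis flip_flip)
    ultimately show "e \<in> composite n (mirror D2) (mirror D1)"
      using *(1-3) unfolding composite_def by (metis (mono_tags, lifting) flip_mem_vertices mem_Collect_eq)
  qed
  show ?thesis using sub[of D1 D2] sub[of "mirror D2" "mirror D1"]
    by (metis mirror_mirror mirror_subset_iff subset_antisym)
qed

lemma diagram_product_mirror:
  assumes "D1 \<in> diagrams n" "D2 \<in> diagrams n"
  shows "diagram_product n \<delta> (mirror D2) (mirror D1) E = diagram_product n \<delta> D1 D2 (mirror E)"
proof -
  have "has_floating_edge n (mirror D2) (mirror D1) \<longleftrightarrow> has_floating_edge n D1 D2"
    using assms by (auto simp: has_floating_edge_iff)
  moreover have "E = mirror (composite n D1 D2) \<longleftrightarrow> mirror E = composite n D1 D2"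
    by (metis mirror_mirror)
  ultimately show ?thesis
    by (simp add: diagram_product_def number_of_loops_mirror composite_mirror)
qed

definition reflect :: "(diagram \<Rightarrow> 'k) \<Rightarrow> diagram \<Rightarrow> 'k" where
  "reflect f = (\<lambda>D. f (mirror D))"

lemma reflect_reflect [simp]: "reflect (reflect f) = f"
  by (simp add: reflect_def)

text \<open>Reflection reverses products of diagrams, and since scalars commute it becomes an
  anti-automorphism. It converts statements about right multiplication into statements about left
  multiplication: the unit law here, and later the ideals needed for left modules.\<close>

lemma reflect_mult:
  "reflect f \<otimes>\<^bsub>dTL n \<delta>\<^esub> reflect g = reflect (g \<otimes>\<^bsub>dTL n \<delta>\<^esub> f)"
proof
  fix D
  have "(reflect f \<otimes>\<^bsub>dTL n \<delta>\<^esub> reflect g) D =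
      (\<Sum>D1\<in>diagrams n. \<Sum>D2\<in>diagrams n.
        f D1 * g D2 * diagram_product n \<delta> (mirror D1) (mirror D2) D)"
    unfolding dTL_mult reflect_def
    by (rule sum.reindex_bij_witness[of _ mirror mirror];
        (rule sum.reindex_bij_witness[of _ mirror mirror])?; simp)
  also have "\<dots> = (\<Sum>D1\<in>diagrams n. \<Sum>D2\<in>diagrams n.
        g D2 * f D1 * diagram_product n \<delta> D2 D1 (mirror D))"
    by (intro sum.cong refl) (simp add: diagram_product_mirror mult.commute)
  also have "\<dots> = reflect (g \<otimes>\<^bsub>dTL n \<delta>\<^esub> f) D"
    unfolding dTL_mult reflect_def by (rule sum.swap)
  finally show "(reflect f \<otimes>\<^bsub>dTL n \<delta>\<^esub> reflect g) D = reflect (g \<otimes>\<^bsub>dTL n \<delta>\<^esub> f) D" .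
qed

lemma reflect_carrier: "f \<in> carrier (dTL n \<delta>) \<Longrightarrow> reflect f \<in> carrier (dTL n \<delta>)"
  by (simp add: dTL_simps reflect_def)

lemma reflect_one: "reflect \<one>\<^bsub>dTL n \<delta>\<^esub> = \<one>\<^bsub>dTL n \<delta>\<^esub>"
  using mirror_subset_iff[of _ "identity_diagram n"] by (simp add: dTL_simps reflect_def)

lemma dTL_left_one:
  assumes "a \<in> carrier (dTL n \<delta>)"
  shows "\<one>\<^bsub>dTL n \<delta>\<^esub> \<otimes>\<^bsub>dTL n \<delta>\<^esub> a = a"
  using reflect_mult[where f = "\<one>\<^bsub>dTL n \<delta>\<^esub>" and g = "reflect a" and n = n and \<delta> = \<delta>] dTL_right_one[OF reflect_carrier[OF assms]]
  by (simp add: reflect_one)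

section \<open>Diagrams other than the identity\<close>

lemma noncrossingD:
  assumes "D \<in> diagrams n" "{u, v} \<in> D" "{x, y} \<in> D"
    "boundary_position n u < boundary_position n x" "boundary_position n x < boundary_position n v"
    "boundary_position n v < boundary_position n y"
  shows False
proof -
  have "noncrossing n D" using assms(1) by (simp add: diagrams_def)
  then show False using assms(2-) unfolding noncrossing_def by meson
qed

lemma edge_other_end:
  assumes "D \<in> diagrams n" "e \<in> D" "v \<in> e"
  obtains w where "e = {v, w}" "w \<noteq> v" "w \<in> vertices n" "v \<in> vertices n"
proof -
  have "card e = 2" "e \<subseteq> vertices n" using diagram_edge[OF assms(1,2)] by auto
  then show ?thesis using assms(3) that by (auto simp: card_2_iff)
qed

text \<open>An innermost-arc argument. Full support gives \<open>Suc a\<close> a partner, and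
  planarity traps that partner strictly between \<open>a\<close> and \<open>b\<close> in the same
  column. This is a shorter arc, unless \<open>b = Suc a\<close> already.\<close>

lemma cup_below_right_edge:
  assumes D: "D \<in> diagrams n" and full: "right_support D = {1..n}"
  shows "{Rgt a, Rgt b} \<in> D \<Longrightarrow> a < b \<Longrightarrow> \<exists>j\<in>{1..<n}. cup j \<in> D"
proof (induction "b - a" arbitrary: a b rule: less_induct)
  case less
  note ab = less.prems
  have V: "1 \<le> a" "b \<le> n" using diagram_edge(1)[OF D ab(1)] by auto
  show ?case
  proof (cases "b = Suc a")
    case True
    then show ?thesis using ab V by (intro bexI[of _ a]) (auto simp: cup_def)
  next
    case False
    then have sab: "Suc a < b" using ab by simp
    then have "Suc a \<in> right_support D" using V full by simp
    then obtain e where e: "e \<in> D" "Rgt (Suc a) \<in> e" by (auto simp: right_support_def)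
    then obtain y where y: "e = {Rgt (Suc a), y}" "y \<noteq> Rgt (Suc a)" "y \<in> vertices n"
      using edge_other_end[OF D] by metis
    have ne: "e \<noteq> {Rgt a, Rgt b}" using sab y by (auto simp: doubleton_eq_iff)
    then have "Rgt a \<notin> e" "Rgt b \<notin> e" using diagram_edge_unique[OF D e(1) ab(1)] by auto
    then have ny: "y \<noteq> Rgt a" "y \<noteq> Rgt b" using y by auto
    have e1: "{Rgt (Suc a), y} \<in> D" "{y, Rgt (Suc a)} \<in> D" "{Rgt b, Rgt a} \<in> D"
      using e y ab by (simp_all add: insert_commute)
    show ?thesis
    proof (cases y)
      case (Lft c)
      then have "boundary_position n y < boundary_position n (Rgt b)"
        "boundary_position n (Rgt b) < boundary_position n (Rgt (Suc a))"
        "boundary_position n (Rgt (Suc a)) < boundary_position n (Rgt a)"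
        using y(3) V sab by auto
      then have False using noncrossingD[OF D e1(2,3)] by blast
      then show ?thesis ..
    next
      case (Rgt c)
      then have c: "c \<noteq> a" "c \<noteq> b" "c \<noteq> Suc a" "1 \<le> c" "c \<le> n" using ny y by auto
      have "\<not> c < a"
      proof
        assume "c < a"
        \<comment> \<open>The right-hand column is read upwards along the boundary, so larger labels
          come earlier.\<close>
        then have "2 * n + 1 - b < 2 * n + 1 - Suc a" "2 * n + 1 - Suc a < 2 * n + 1 - a"
          "2 * n + 1 - a < 2 * n + 1 - c" using V sab c by arith+
        then show False using noncrossingD[OF D e1(3,1)] Rgt by simp
      qed
      moreover have "\<not> b < c"
      proof
        assume "b < c"
        then have "2 * n + 1 - c < 2 * n + 1 - b" "2 * n + 1 - b < 2 * n + 1 - Suc a"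
          "2 * n + 1 - Suc a < 2 * n + 1 - a" using V sab c by arith+
        then show False using noncrossingD[OF D e1(2,3)] Rgt by simp
      qed
      ultimately have "Suc a < c" "c < b" using c by auto
      then show ?thesis using less.hyps[of c "Suc a"] e1(1) Rgt by auto
    qed
  qed
qed

text \<open>Without a cup no edge joins two right-hand vertices, so every one of them is joined to
  the left-hand column. Planarity makes this assignment strictly increasing, and the only strictly
  increasing self-map of \<open>{1..n}\<close> is the identity.\<close>

lemma identity_or_cup:
  assumes D: "D \<in> diagrams n" and full: "right_support D = {1..n}"
  shows "D = identity_diagram n \<or> (\<exists>j\<in>{1..<n}. cup j \<in> D)"
proof (rule disjCI)
  assume no_cup: "\<not> (\<exists>j\<in>{1..<n}. cup j \<in> D)"
  have "\<exists>k. {Lft k, Rgt i} \<in> D" if i: "i \<in> {1..n}" for i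
  proof -
    have "i \<in> right_support D" using i full by simp
    then obtain e where e: "e \<in> D" "Rgt i \<in> e" by (auto simp: right_support_def)
    then obtain y where y: "e = {Rgt i, y}" "y \<noteq> Rgt i" using edge_other_end[OF D] by metis
    show ?thesis
    proof (cases y)
      case (Lft k)
      then show ?thesis using e y by (auto simp: insert_commute)
    next
      case (Rgt k)
      then have "{Rgt i, Rgt k} \<in> D" "{Rgt k, Rgt i} \<in> D" "i \<noteq> k"
        using e y by (auto simp: insert_commute)
      then have False using no_cup cup_below_right_edge[OF D full] by (metis linorder_neqE_nat)
      then show ?thesis ..
    qed
  qed
  then obtain f where f: "\<And>i. i \<in> {1..n} \<Longrightarrow> {Lft (f i), Rgt i} \<in> D" by metis
  have range: "f i \<in> {1..n}" if "i \<in> {1..n}" for i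
    using diagram_edge(1)[OF D f[OF that]] by simp
  have mono: "f i < f j" if ij: "i \<in> {1..n}" "j \<in> {1..n}" "i < j" for i j
  proof (rule ccontr)
    assume "\<not> f i < f j"
    moreover have "f i \<noteq> f j"
      using diagram_edge_unique[OF D f[OF ij(1)] f[OF ij(2)], of "Lft (f i)"] ij(3)
      by (auto simp: doubleton_eq_iff)
    ultimately have "f j < f i" by simp
    moreover have "f i < 2 * n + 1 - j" "2 * n + 1 - j < 2 * n + 1 - i"
      using range[OF ij(1)] ij by auto
    ultimately show False using noncrossingD[OF D f[OF ij(2)] f[OF ij(1)]] by simp
  qed
  \<comment> \<open>Strict monotonicity forces \<open>i \<le> f i\<close> by induction from the
    bottom and \<open>f i \<le> i\<close> by induction from the top.\<close>
  have ge: "i \<le> f i" if "i \<in> {1..n}" for i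
    using that
  proof (induction i)
    case (Suc i)
    show ?case
    proof (cases "i = 0")
      case False
      then have "i \<le> f i" "f i < f (Suc i)" using Suc mono[of i "Suc i"] by auto
      then show ?thesis by simp
    qed (use range[OF Suc.prems] in auto)
  qed simp
  have le: "f i \<le> i" if i: "i \<in> {1..n}" for i
    using i
  proof (induction "n - i" arbitrary: i)
    case 0
    then show ?case using range[of i] by auto
  next
    case (Suc m)
    then have "f (Suc i) \<le> Suc i" "f i < f (Suc i)" using mono[of i "Suc i"] by auto
    then show ?case by simp
  qed
  have strand: "{Lft i, Rgt i} \<in> D" if "i \<in> {1..n}" for i
    using f[OF that] ge[OF that] le[OF that] by simp
  have "e \<in> identity_diagram n" if e: "e \<in> D" for e
  proof -
    have "card e = 2" "e \<subseteq> vertices n" using diagram_edge[OF D e] by auto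
    then obtain v where v: "v \<in> e" "v \<in> vertices n" by (auto simp: card_2_iff)
    then obtain i where i: "i \<in> {1..n}" "v \<in> {Lft i, Rgt i}" by (auto simp: vertices_def)
    then have "e = {Lft i, Rgt i}" using diagram_edge_unique[OF D e strand] v by blast
    then show ?thesis using i by (auto simp: identity_diagram_def)
  qed
  moreover have "identity_diagram n \<subseteq> D" using strand by (auto simp: identity_diagram_def)
  ultimately show "D = identity_diagram n" by blast
qed

text \<open>A cell of the second family is also a \<open>right_part\<close>, with
  \<open>{cup j}\<close> as cups and horizontal edges at the complement of
  \<open>{j, Suc j}\<close>. Writing it through the full support makes intersections simply
  accumulate cups.\<close>

definition right_cells :: "nat \<Rightarrow> diagram set set" where
  "right_cells n = (\<lambda>S. right_part n S {}) ` {S. S \<subset> {1..n}} \<union>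
     (\<lambda>j. {D \<in> diagrams n. cup j \<in> D \<and> right_support D = {1..n}}) ` {1..<n}"

lemma finite_right_cells: "finite (right_cells n)"
proof -
  have "finite {S. S \<subset> {1..n}}" by (rule finite_subset[of _ "Pow {1..n}"]) auto
  then show ?thesis by (simp add: right_cells_def)
qed

lemma right_part_empty: "right_part n S {} = {D \<in> diagrams n. right_support D = S}"
  by (auto simp: right_part_def right_support_def)

lemma identity_diagram_diagrams: "identity_diagram n \<in> diagrams n"
  by (simp add: identity_diagram_eq partial_identity_diagram)

lemma Union_right_cells: "\<Union>(right_cells n) = diagrams n - {identity_diagram n}"
proof (intro equalityI subsetI)
  fix D assume "D \<in> \<Union>(right_cells n)"
  then consider "D \<in> diagrams n" "right_support D \<noteq> {1..n}"
    | j where "D \<in> diagrams n" "cup j \<in> D" by (auto simp: right_cells_def right_part_empty)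
  then show "D \<in> diagrams n - {identity_diagram n}"
  proof cases
    case 1
    then show ?thesis by (auto simp: identity_diagram_eq)
  next
    case 2
    have "cup j \<notin> identity_diagram n" by (auto simp: cup_def identity_diagram_def doubleton_eq_iff)
    then show ?thesis using 2 by auto
  qed
next
  fix D assume D: "D \<in> diagrams n - {identity_diagram n}"
  show "D \<in> \<Union>(right_cells n)"
  proof (cases "right_support D = {1..n}")
    case True
    then show ?thesis using identity_or_cup[of D n] D by (auto simp: right_cells_def)
  next
    case False
    then have "right_support D \<subset> {1..n}" using D right_support_subset[of D n] by blast
    then show ?thesis using D unfolding right_cells_def right_part_empty by blast
  qed
qed

text \<open>A common element \<open>D\<close> determines the right support prescribed by every
  member of \<open>T\<close>. If it is not full, \<open>T\<close> consists of one cell. If it is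
  full, the members prescribe cups that all occur in the one diagram \<open>D\<close> and are
  therefore pairwise disjoint.\<close>

lemma Inter_right_cells:
  assumes T: "T \<subseteq> right_cells n" "T \<noteq> {}" "\<Inter>T \<noteq> {}"
  shows "\<exists>S C. S \<subset> {1..n} \<and> C \<in> cups n \<and> S \<inter> right_support C = {} \<and> \<Inter>T = right_part n S C"
proof -
  obtain D where D: "D \<in> \<Inter>T" using T(3) by blast
  have Dd: "D \<in> diagrams n" using D T(1,2) Union_right_cells[of n] by blast
  show ?thesis
  proof (cases "right_support D = {1..n}")
    case False
    have "X = right_part n (right_support D) {}" if X: "X \<in> T" for X
    proof -
      have "X \<in> right_cells n" "D \<in> X" using X D T(1) by blast+
      then show ?thesis using False by (auto simp: right_cells_def right_part_empty)
    qed
    then have "\<Inter>T = right_part n (right_support D) {}" using T(2) by blast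
    moreover have "right_support D \<subset> {1..n}" using False right_support_subset[OF Dd] by blast
    moreover have "{} \<in> cups n" "right_support {} = {}" by (simp_all add: cups_def right_support_def)
    ultimately show ?thesis by blast
  next
    case True
    define Y where "Y j = {D \<in> diagrams n. cup j \<in> D \<and> right_support D = {1..n}}" for j
    define J where "J = {j \<in> {1..<n}. Y j \<in> T}"
    define C where "C = cup ` J"
    have TJ: "T = Y ` J"
    proof
      show "T \<subseteq> Y ` J"
      proof
        fix X assume X: "X \<in> T"
        then obtain j where "j \<in> {1..<n}" "X = Y j"
          using D T(1) True unfolding right_cells_def right_part_empty Y_def by blast
        then show "X \<in> Y ` J" using X by (auto simp: J_def)
      qed
    qed (auto simp: J_def)
    have J: "J \<noteq> {}" using TJ T(2) by blast
    have CD: "C \<subseteq> D" using D TJ by (auto simp: C_def Y_def)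
    have C: "C \<in> cups n"
      unfolding cups_def
    proof (intro CollectI conjI ballI impI)
      show "\<exists>j\<in>{1..<n}. e = cup j" if "e \<in> C" for e using that by (auto simp: C_def J_def)
      show "e \<inter> e' = {}" if "e \<in> C" "e' \<in> C" "e \<noteq> e'" for e e'
        using diagram_edge_unique[OF Dd] CD that by blast
    qed
    have "\<Inter>T = {D \<in> diagrams n. C \<subseteq> D \<and> right_support D = {1..n}}"
      using J by (auto simp: TJ C_def Y_def)
    moreover have sub: "right_support C \<subseteq> {1..n}"
      using CD right_support_subset[OF Dd] by (auto simp: right_support_def)
    moreover have "{1..n} - right_support C \<union> right_support C = {1..n}" using sub by blast
    ultimately have "\<Inter>T = right_part n ({1..n} - right_support C) C"
      by (simp add: right_part_def)
    \<comment> \<open>At least one cup occurs, so the horizontal edges do not reach full height.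
      This properness later makes the idempotent act by zero on the trivial module.\<close>
    moreover have "right_support C \<noteq> {}" using J by (auto simp: C_def right_support_def cup_def)
    then have "{1..n} - right_support C \<subset> {1..n}" using sub by blast
    moreover have "({1..n} - right_support C) \<inter> right_support C = {}" by blast
    ultimately show ?thesis using C by blast
  qed
qed

section \<open>Dual bases of projective modules\<close>

lemma (in abelian_group_hom) hom_finsum:
  assumes "finite S" "g \<in> S \<rightarrow> carrier G"
  shows "h (finsum G g S) = finsum H (\<lambda>x. h (g x)) S"
  using assms
proof (induction S)
  case (insert y S)
  then have "g \<in> S \<rightarrow> carrier G" "g y \<in> carrier G" "(\<lambda>x. h (g x)) \<in> S \<rightarrow> carrier H"
    "h (g y) \<in> carrier H"
    by (auto simp: Pi_iff)
  then show ?case using insert by simp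
qed simp

lemma (in abelian_group) finsum_mem:
  assumes "finite S" "H \<subseteq> carrier G" "\<zero> \<in> H" "\<And>x y. x \<in> H \<Longrightarrow> y \<in> H \<Longrightarrow> x \<oplus> y \<in> H"
    and "\<And>x. x \<in> S \<Longrightarrow> f x \<in> H"
  shows "finsum G f S \<in> H"
  using assms(1,5)
proof (induction S)
  case (insert y S)
  then have "f \<in> S \<rightarrow> carrier G" "f y \<in> carrier G" using assms(2) by auto
  then show ?case using insert assms(4) by simp
qed (simp add: assms(3))

lemma module_hom_closed: "h \<in> module_hom R M N \<Longrightarrow> x \<in> carrier M \<Longrightarrow> h x \<in> carrier N"
  and module_hom_smult: "h \<in> module_hom R M N \<Longrightarrow> a \<in> carrier R \<Longrightarrow> x \<in> carrier M \<Longrightarrow>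
    h (a \<odot>\<^bsub>M\<^esub> x) = a \<odot>\<^bsub>N\<^esub> h x"
  and module_hom_add: "h \<in> module_hom R M N \<Longrightarrow> x \<in> carrier M \<Longrightarrow> y \<in> carrier M \<Longrightarrow>
    h (x \<oplus>\<^bsub>M\<^esub> y) = h x \<oplus>\<^bsub>N\<^esub> h y"
  by (auto simp: module_hom_def)

lemma abelian_group_homI':
  assumes "abelian_group M" "abelian_group N" "\<And>x. x \<in> carrier M \<Longrightarrow> h x \<in> carrier N"
    "\<And>x y. x \<in> carrier M \<Longrightarrow> y \<in> carrier M \<Longrightarrow> h (x \<oplus>\<^bsub>M\<^esub> y) = h x \<oplus>\<^bsub>N\<^esub> h y"
  shows "abelian_group_hom M N h"
proof -
  interpret M: abelian_group M by fact
  interpret N: abelian_group N by fact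
  show ?thesis
    using M.a_group N.a_group assms
    by (intro abelian_group_homI) (auto simp: group_hom_def group_hom_axioms_def hom_def)
qed

lemma module_hom_group_hom:
  assumes "left_module R M" "left_module R N" "h \<in> module_hom R M N"
  shows "abelian_group_hom M N h"
  using assms(1,2)[THEN left_module.axioms(1)] module_hom_closed[OF assms(3)] module_hom_add[OF assms(3)]
  by (rule abelian_group_homI')

lemma (in left_module) smult_group_hom:
  assumes "a \<in> carrier R" shows "abelian_group_hom M M (\<lambda>x. a \<odot>\<^bsub>M\<^esub> x)"
  using assms by (intro abelian_group_homI' abelian_group_axioms smult_closed smult_r_distr)

lemma (in abelian_group) add_self_eq_zero: "x \<in> carrier G \<Longrightarrow> x \<oplus> x = x \<Longrightarrow> x = \<zero>"
  by (metis add.l_cancel_one)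

text \<open>The dual basis description of a projective module: linear forms \<open>c x\<close> and
  elements \<open>g x\<close> with every \<open>p\<close> equal to the finite sum of the
  \<open>c x p\<close> times \<open>g x\<close>. It allows submodules to be cut out by conditions on
  the values \<open>c x p\<close>.\<close>

definition dual_basis ::
  "('r, 'z) ring_scheme \<Rightarrow> ('r, 'p) module \<Rightarrow> ('x \<Rightarrow> 'p \<Rightarrow> 'r) \<Rightarrow> ('x \<Rightarrow> 'p) \<Rightarrow> bool" where
  "dual_basis R P c g \<longleftrightarrow>
     (\<forall>x. \<forall>p\<in>carrier P. c x p \<in> carrier R) \<and>
     (\<forall>p\<in>carrier P. finite {x. c x p \<noteq> \<zero>\<^bsub>R\<^esub>}) \<and>
     (\<forall>x. \<forall>p\<in>carrier P. \<forall>q\<in>carrier P. c x (p \<oplus>\<^bsub>P\<^esub> q) = c x p \<oplus>\<^bsub>R\<^esub> c x q) \<and>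
     (\<forall>x. \<forall>a\<in>carrier R. \<forall>p\<in>carrier P. c x (a \<odot>\<^bsub>P\<^esub> p) = a \<otimes>\<^bsub>R\<^esub> c x p) \<and>
     (\<forall>x. g x \<in> carrier P) \<and>
     (\<forall>p\<in>carrier P. linear_extension R P g (\<lambda>x. c x p) = p)"

definition augmentation_module :: "'b \<Rightarrow> ('b \<Rightarrow> 'k, 'k::{comm_ring, comm_monoid_mult}) module" where
  "augmentation_module b0 = \<lparr>carrier = UNIV, mult = (*), one = 1, zero = 0, add = (+),
     smult = (\<lambda>f x. f b0 * x)\<rparr>"

text \<open>A structure weaker than a ring: for diagrams, a closed associative multiplication would
  involve the planarity of products and a count of loops in triple products.\<close>

locale based_algebra =
  fixes R :: "('b \<Rightarrow> 'k::{comm_ring, comm_monoid_mult}, 'z) ring_scheme" (structure)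
    and B :: "'b set" and b0 :: 'b
  assumes carrier_R: "carrier R = {f. \<forall>D. D \<notin> B \<longrightarrow> f D = 0}"
    and zero_R: "\<zero> = (\<lambda>D. 0)"
    and add_R: "f \<oplus> g = (\<lambda>D. f D + g D)"
    and l_distr: "(f \<oplus> g) \<otimes> h = f \<otimes> h \<oplus> g \<otimes> h"
    and r_distr: "h \<otimes> (f \<oplus> g) = h \<otimes> f \<oplus> h \<otimes> g"
    and mult_scalar_l: "(\<lambda>D. a * f D) \<otimes> g = (\<lambda>D. a * (f \<otimes> g) D)"
    and mult_scalar_r: "f \<otimes> (\<lambda>D. a * g D) = (\<lambda>D. a * (f \<otimes> g) D)"
    and one_closed: "\<one> \<in> carrier R"
    and l_one: "f \<in> carrier R \<Longrightarrow> \<one> \<otimes> f = f"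
    and r_one: "f \<in> carrier R \<Longrightarrow> f \<otimes> \<one> = f"
    and one_base: "\<one> b0 = 1"
    and mult_base: "f \<in> carrier R \<Longrightarrow> g \<in> carrier R \<Longrightarrow> (f \<otimes> g) b0 = f b0 * g b0"
begin

lemma abelian_group_R: "abelian_group R"
proof (rule abelian_groupI)
  fix f assume "f \<in> carrier R"
  then show "\<exists>g\<in>carrier R. g \<oplus> f = \<zero>"
    by (intro bexI[of _ "\<lambda>D. - f D"]) (auto simp: carrier_R add_R zero_R)
qed (auto simp: carrier_R add_R zero_R algebra_simps)

lemma mult_zero: "f \<otimes> \<zero> = \<zero>"
  using mult_scalar_r[of f 0 "\<lambda>D. 0"] by (simp add: zero_R)

lemma smult_zero:
  assumes "left_module R M" "x \<in> carrier M" shows "\<zero> \<odot>\<^bsub>M\<^esub> x = \<zero>\<^bsub>M\<^esub>"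
proof -
  interpret M: left_module R M by fact
  interpret R: abelian_group R by (rule abelian_group_R)
  show ?thesis
    using M.smult_l_distr[of "\<zero>" "\<zero>" x] assms(2) M.smult_closed
    by (intro M.add_self_eq_zero) auto
qed

lemma linear_extension_superset:
  assumes "left_module R M" "finite S" "{x. f x \<noteq> \<zero>} \<subseteq> S"
    "\<And>x. x \<in> S \<Longrightarrow> f x \<in> carrier R" "\<And>x. x \<in> S \<Longrightarrow> z x \<in> carrier M"
  shows "linear_extension R M z f = (\<Oplus>\<^bsub>M\<^esub>x\<in>S. f x \<odot>\<^bsub>M\<^esub> z x)"
proof -
  interpret M: left_module R M by fact
  show ?thesis unfolding linear_extension_def
    using assms(2-) by (intro M.add.finprod_mono_neutral_cong_left)
      (auto intro!: smult_zero[OF assms(1)] M.smult_closed)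
qed

text \<open>The coordinates come from the section into a free module and the generators are the
  images of its basis under the retraction. The earlier results on free modules are stated for
  rings, so the retraction is expanded directly, removing one point of the support at a
  time.\<close>

lemma projective_dual_basis:
  fixes P :: "('b \<Rightarrow> 'k, 'p) module"
  assumes "projective_module R P"
  shows "\<exists>(c :: 'p \<Rightarrow> 'p \<Rightarrow> 'b \<Rightarrow> 'k) g. dual_basis R P c g"
proof -
  interpret R: abelian_group R by (rule abelian_group_R)
  obtain X :: "'p set" and s r where P: "left_module R P" and s: "s \<in> module_hom R P (free_module R X)"
    and r: "r \<in> module_hom R (free_module R X) P" and rs: "\<And>p. p \<in> carrier P \<Longrightarrow> r (s p) = p"
    using assms unfolding projective_module_def by blast
  interpret P: left_module R P by fact
  define g where "g x = (if x \<in> X then r (free_basis R x) else \<zero>\<^bsub>P\<^esub>)" for x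
  have fb: "free_basis R x \<in> carrier (free_module R X)" if "x \<in> X" for x
    using that one_closed by (auto simp: free_module_simps free_basis_def intro: finite_subset[of _ "{x}"])
  have g: "g x \<in> carrier P" for x
    using module_hom_closed[OF r] fb by (auto simp: g_def)
  have app: "f x \<in> carrier R" if "f \<in> carrier (free_module R X)" for f x
    using that by (cases "x \<in> X") (auto simp: free_module_simps)
  have expand: "r f = (\<Oplus>\<^bsub>P\<^esub>x\<in>S. f x \<odot>\<^bsub>P\<^esub> g x)"
    if "finite S" "S \<subseteq> X" "f \<in> carrier (free_module R X)" "{x. f x \<noteq> \<zero>} \<subseteq> S" for S f
    using that
  proof (induction S arbitrary: f)
    case empty
    then have "f = \<zero>\<^bsub>free_module R X\<^esub>" by (auto simp: free_module_simps)
    moreover have "\<zero>\<^bsub>free_module R X\<^esub> \<oplus>\<^bsub>free_module R X\<^esub> \<zero>\<^bsub>free_module R X\<^esub> = \<zero>\<^bsub>free_module R X\<^esub>"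
      by (simp add: free_module_simps)
    ultimately have "r f \<oplus>\<^bsub>P\<^esub> r f = r f" using module_hom_add[OF r] empty.prems(2) by metis
    then show ?case using module_hom_closed[OF r] empty.prems(2) by (simp add: P.add_self_eq_zero)
  next
    case (insert y S)
    note f = insert.prems(2)
    define f0 where "f0 = f(y := \<zero>)"
    define f1 where "f1 = f y \<odot>\<^bsub>free_module R X\<^esub> free_basis R y"
    have y: "y \<in> X" using insert.prems(1) by simp
    have "{x. f0 x \<noteq> \<zero>} \<subseteq> {x. f x \<noteq> \<zero>}" by (auto simp: f0_def)
    then have f0: "f0 \<in> carrier (free_module R X)"
      using f by (auto simp: free_module_simps f0_def intro: finite_subset)
    have "f1 = (\<lambda>x. if x = y then f y else \<zero>)"
      using app[OF f] by (auto simp: f1_def free_module_simps free_basis_def r_one mult_zero)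
    moreover from this have f1: "f1 \<in> carrier (free_module R X)"
      using app[OF f] y by (auto simp: free_module_simps intro: finite_subset[of _ "{y}"])
    ultimately have "f = f1 \<oplus>\<^bsub>free_module R X\<^esub> f0"
      using app[OF f] by (auto simp: free_module_simps f0_def)
    then have "r f = r f1 \<oplus>\<^bsub>P\<^esub> r f0" using module_hom_add[OF r f1 f0] by simp
    also have "r f1 = f y \<odot>\<^bsub>P\<^esub> g y"
      using module_hom_smult[OF r app[OF f] fb[OF y]] y by (simp add: f1_def g_def)
    also have "r f0 = (\<Oplus>\<^bsub>P\<^esub>x\<in>S. f0 x \<odot>\<^bsub>P\<^esub> g x)"
      using insert.prems by (intro insert.IH f0) (auto simp: f0_def)
    also have "\<dots> = (\<Oplus>\<^bsub>P\<^esub>x\<in>S. f x \<odot>\<^bsub>P\<^esub> g x)"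
      using insert.hyps app[OF f] g by (intro P.finsum_cong') (auto simp: f0_def P.smult_closed)
    finally show ?case using insert.hyps app[OF f] g by (simp add: P.smult_closed Pi_iff)
  qed
  have "dual_basis R P (\<lambda>x p. s p x) g" unfolding dual_basis_def
  proof (intro conjI allI ballI)
    fix x p assume p: "p \<in> carrier P"
    show "s p x \<in> carrier R" using app[OF module_hom_closed[OF s p]] .
    show "s (p \<oplus>\<^bsub>P\<^esub> q) x = s p x \<oplus> s q x" if "q \<in> carrier P" for q
      using module_hom_add[OF s p that] by (simp add: free_module_simps)
  next
    fix x a p assume "a \<in> carrier R" "p \<in> carrier P"
    then show "s (a \<odot>\<^bsub>P\<^esub> p) x = a \<otimes> s p x"
      using module_hom_smult[OF s] by (simp add: free_module_simps)
  next
    fix p assume p: "p \<in> carrier P"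
    note sp = module_hom_closed[OF s p]
    show fin: "finite {x. s p x \<noteq> \<zero>}" using sp by (simp add: free_module_simps)
    have "{x. s p x \<noteq> \<zero>} \<subseteq> X" using sp by (auto simp: free_module_simps)
    then show "linear_extension R P g (\<lambda>x. s p x) = p"
      using expand[OF fin _ sp] rs[OF p] by (simp add: linear_extension_def)
  qed (rule g)
  then show ?thesis by blast
qed

text \<open>Projectivity in the form used below: any family \<open>z\<close> yields a homomorphism.
  It need not send \<open>g x\<close> to \<open>z x\<close>, because the generators may satisfy
  relations; what counts is that it is compatible with the expansion of elements.\<close>

lemma dual_basis_extension_hom:
  assumes P: "left_module R P" and db: "dual_basis R P c g"
    and M: "left_module R M" and z: "\<And>x. z x \<in> carrier M"
  shows "(\<lambda>p. linear_extension R M z (\<lambda>x. c x p)) \<in> module_hom R P M"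
proof -
  interpret P: left_module R P by fact
  interpret M: left_module R M by fact
  interpret R: abelian_group R by (rule abelian_group_R)
  have c: "c x p \<in> carrier R" and fin: "finite {x. c x p \<noteq> \<zero>}" if "p \<in> carrier P" for x p
    using db that by (auto simp: dual_basis_def)
  have cz: "c x p \<odot>\<^bsub>M\<^esub> z x \<in> carrier M" if "p \<in> carrier P" for x p
    using c[OF that] z by (rule M.smult_closed)
  show ?thesis unfolding module_hom_def
  proof (intro CollectI conjI ballI funcsetI)
    fix p assume "p \<in> carrier P"
    then show "linear_extension R M z (\<lambda>x. c x p) \<in> carrier M"
      unfolding linear_extension_def using cz by (intro M.finsum_closed) auto
  next
    fix p q assume p: "p \<in> carrier P" and q: "q \<in> carrier P"
    let ?S = "{x. c x p \<noteq> \<zero>} \<union> {x. c x q \<noteq> \<zero>}"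
    have S: "finite ?S" using fin p q by simp
    have cpq: "c x (p \<oplus>\<^bsub>P\<^esub> q) = c x p \<oplus> c x q" for x
      using db p q by (simp add: dual_basis_def)
    have "linear_extension R M z (\<lambda>x. c x (p \<oplus>\<^bsub>P\<^esub> q)) = (\<Oplus>\<^bsub>M\<^esub>x\<in>?S. c x (p \<oplus>\<^bsub>P\<^esub> q) \<odot>\<^bsub>M\<^esub> z x)"
      using p q by (intro linear_extension_superset M S z) (auto simp: cpq c)
    also have "\<dots> = (\<Oplus>\<^bsub>M\<^esub>x\<in>?S. c x p \<odot>\<^bsub>M\<^esub> z x \<oplus>\<^bsub>M\<^esub> c x q \<odot>\<^bsub>M\<^esub> z x)"
      unfolding cpq using p q c z cz by (intro M.finsum_cong') (auto simp: M.smult_l_distr)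
    also have "\<dots> = (\<Oplus>\<^bsub>M\<^esub>x\<in>?S. c x p \<odot>\<^bsub>M\<^esub> z x) \<oplus>\<^bsub>M\<^esub> (\<Oplus>\<^bsub>M\<^esub>x\<in>?S. c x q \<odot>\<^bsub>M\<^esub> z x)"
      using cz p q by (intro M.finsum_addf) auto
    also have "(\<Oplus>\<^bsub>M\<^esub>x\<in>?S. c x p \<odot>\<^bsub>M\<^esub> z x) = linear_extension R M z (\<lambda>x. c x p)"
      using p by (intro linear_extension_superset[symmetric] M S z) (auto simp: c)
    also have "(\<Oplus>\<^bsub>M\<^esub>x\<in>?S. c x q \<odot>\<^bsub>M\<^esub> z x) = linear_extension R M z (\<lambda>x. c x q)"
      using q by (intro linear_extension_superset[symmetric] M S z) (auto simp: c)
    finally show "linear_extension R M z (\<lambda>x. c x (p \<oplus>\<^bsub>P\<^esub> q)) =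
      linear_extension R M z (\<lambda>x. c x p) \<oplus>\<^bsub>M\<^esub> linear_extension R M z (\<lambda>x. c x q)" .
  next
    fix a p assume a: "a \<in> carrier R" and p: "p \<in> carrier P"
    let ?S = "{x. c x p \<noteq> \<zero>}"
    interpret a: abelian_group_hom M M "\<lambda>x. a \<odot>\<^bsub>M\<^esub> x" using a by (rule M.smult_group_hom)
    have cap: "c x (a \<odot>\<^bsub>P\<^esub> p) = a \<otimes> c x p" for x
      using db a p by (simp add: dual_basis_def)
    have "linear_extension R M z (\<lambda>x. c x (a \<odot>\<^bsub>P\<^esub> p)) = (\<Oplus>\<^bsub>M\<^esub>x\<in>?S. c x (a \<odot>\<^bsub>P\<^esub> p) \<odot>\<^bsub>M\<^esub> z x)"
      using a p c[OF P.smult_closed[OF a p]]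
      by (intro linear_extension_superset M fin z) (auto simp: cap mult_zero)
    also have "\<dots> = (\<Oplus>\<^bsub>M\<^esub>x\<in>?S. a \<odot>\<^bsub>M\<^esub> (c x p \<odot>\<^bsub>M\<^esub> z x))"
      unfolding cap using a p c z cz by (intro M.finsum_cong') (auto simp: M.smult_assoc M.smult_closed)
    also have "\<dots> = a \<odot>\<^bsub>M\<^esub> linear_extension R M z (\<lambda>x. c x p)"
      unfolding linear_extension_def using fin[OF p] cz[OF p] by (intro a.hom_finsum[symmetric]) auto
    finally show "linear_extension R M z (\<lambda>x. c x (a \<odot>\<^bsub>P\<^esub> p)) =
      a \<odot>\<^bsub>M\<^esub> linear_extension R M z (\<lambda>x. c x p)" .
  qed
qed

end

section \<open>Acyclic parts of a projective resolution\<close>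

text \<open>The span of \<open>X\<close> is the right ideal generated by \<open>u\<close>. The last
  clause says that \<open>u \<otimes> a\<close> determines \<open>e \<otimes> a\<close>; with
  \<open>u \<otimes> e = u\<close> this stands in for an isomorphism between the ideals of
  \<open>u\<close> and \<open>e\<close>. Over the opposite algebra these are left ideals.\<close>

definition idempotent_part ::
  "('b \<Rightarrow> 'k::{comm_ring, comm_monoid_mult}, 'z) ring_scheme \<Rightarrow> 'b \<Rightarrow> 'b set \<Rightarrow> bool" where
  "idempotent_part R b0 X \<longleftrightarrow> b0 \<notin> X \<and>
     (\<exists>u\<in>carrier R. \<exists>e\<in>carrier R. e b0 = 0 \<and> u \<otimes>\<^bsub>R\<^esub> e = u \<and>
        {f \<in> carrier R. \<forall>D. f D \<noteq> 0 \<longrightarrow> D \<in> X} = (\<lambda>a. u \<otimes>\<^bsub>R\<^esub> a) ` carrier R \<and>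
        (\<forall>a\<in>carrier R. u \<otimes>\<^bsub>R\<^esub> a = \<zero>\<^bsub>R\<^esub> \<longrightarrow> e \<otimes>\<^bsub>R\<^esub> a = \<zero>\<^bsub>R\<^esub>))"

locale augmented_resolution = based_algebra R B b0
  for R :: "('b \<Rightarrow> 'k::{comm_ring, comm_monoid_mult}, 'z) ring_scheme" (structure) and B b0 +
  fixes P :: "nat \<Rightarrow> ('b \<Rightarrow> 'k, 'p) module" and d :: "nat \<Rightarrow> 'p \<Rightarrow> 'p" and \<eta> :: "'p \<Rightarrow> 'k"
    and c :: "nat \<Rightarrow> 'x \<Rightarrow> 'p \<Rightarrow> 'b \<Rightarrow> 'k" and g :: "nat \<Rightarrow> 'x \<Rightarrow> 'p"
  assumes resolution: "projective_resolution R P d \<eta> (augmentation_module b0)"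
    and basis: "dual_basis R (P i) (c i) (g i)"
begin

sublocale P: left_module R "P i" for i
  using resolution by (simp add: projective_resolution_def projective_module_def)

sublocale R: abelian_group R
  by (rule abelian_group_R)

lemma d_hom: "d i \<in> module_hom R (P (Suc i)) (P i)"
  using resolution by (simp add: projective_resolution_def)

sublocale d: abelian_group_hom "P (Suc i)" "P i" "d i" for i
  by (rule module_hom_group_hom[OF _ _ d_hom]) (rule P.left_module_axioms)+

lemma d_smult: "a \<in> carrier R \<Longrightarrow> p \<in> carrier (P (Suc i)) \<Longrightarrow>
    d i (a \<odot>\<^bsub>P (Suc i)\<^esub> p) = a \<odot>\<^bsub>P i\<^esub> d i p"
  using d_hom by (rule module_hom_smult)

lemma \<eta>_add: "p \<in> carrier (P 0) \<Longrightarrow> q \<in> carrier (P 0) \<Longrightarrow> \<eta> (p \<oplus>\<^bsub>P 0\<^esub> q) = \<eta> p + \<eta> q"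
  and \<eta>_smult: "a \<in> carrier R \<Longrightarrow> p \<in> carrier (P 0) \<Longrightarrow> \<eta> (a \<odot>\<^bsub>P 0\<^esub> p) = a b0 * \<eta> p"
  using resolution by (auto simp: projective_resolution_def module_hom_def augmentation_module_def)

lemma \<eta>_surj: "\<exists>p\<in>carrier (P 0). \<eta> p = x"
proof -
  have "\<eta> ` carrier (P 0) = UNIV"
    using resolution by (simp add: projective_resolution_def augmentation_module_def)
  then show ?thesis by (metis UNIV_I imageE)
qed

lemma exact_0: "p \<in> carrier (P 0) \<Longrightarrow> \<eta> p = 0 \<longleftrightarrow> p \<in> d 0 ` carrier (P 1)"
proof -
  have "a_kernel (P 0) (augmentation_module b0) \<eta> = d 0 ` carrier (P 1)"
    using resolution by (simp add: projective_resolution_def)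
  then show "p \<in> carrier (P 0) \<Longrightarrow> \<eta> p = 0 \<longleftrightarrow> p \<in> d 0 ` carrier (P 1)"
    by (auto simp: a_kernel_def kernel_def augmentation_module_def)
qed

lemma exact_Suc: "p \<in> carrier (P (Suc i)) \<Longrightarrow>
    d i p = \<zero>\<^bsub>P i\<^esub> \<longleftrightarrow> p \<in> d (Suc i) ` carrier (P (Suc (Suc i)))"
proof -
  have "a_kernel (P (Suc i)) (P i) (d i) = d (Suc i) ` carrier (P (Suc (Suc i)))"
    using resolution by (simp add: projective_resolution_def)
  then show "p \<in> carrier (P (Suc i)) \<Longrightarrow>
      d i p = \<zero>\<^bsub>P i\<^esub> \<longleftrightarrow> p \<in> d (Suc i) ` carrier (P (Suc (Suc i)))"
    by (auto simp: a_kernel_def kernel_def)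
qed

lemma d_d: "p \<in> carrier (P (Suc (Suc i))) \<Longrightarrow> d i (d (Suc i) p) = \<zero>\<^bsub>P i\<^esub>"
  using exact_Suc[of "d (Suc i) p" i] by simp

lemma \<eta>_d: "p \<in> carrier (P (Suc 0)) \<Longrightarrow> \<eta> (d 0 p) = 0"
  using exact_0[of "d 0 p"] by simp

lemma coord_closed: "p \<in> carrier (P i) \<Longrightarrow> c i x p \<in> carrier R"
  and coord_finite: "p \<in> carrier (P i) \<Longrightarrow> finite {x. c i x p \<noteq> \<zero>}"
  and coord_smult: "a \<in> carrier R \<Longrightarrow> p \<in> carrier (P i) \<Longrightarrow> c i x (a \<odot>\<^bsub>P i\<^esub> p) = a \<otimes> c i x p"
  and g_closed: "g i x \<in> carrier (P i)"
  and coord_expand: "p \<in> carrier (P i) \<Longrightarrow> linear_extension R (P i) (g i) (\<lambda>x. c i x p) = p"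
  using basis[of i] by (simp_all add: dual_basis_def)

sublocale c: abelian_group_hom "P i" R "c i x" for i x
  by (rule abelian_group_homI')
     (use basis[of i] P.abelian_group_axioms R.abelian_group_axioms in \<open>simp_all add: dual_basis_def\<close>)

lemma coord_term_closed: "p \<in> carrier (P i) \<Longrightarrow> q \<in> carrier (P j) \<Longrightarrow> c i x p \<odot>\<^bsub>P j\<^esub> q \<in> carrier (P j)"
  by (intro P.smult_closed coord_closed)

text \<open>This is \<open>J P\<^sub>i\<close>, where \<open>J\<close> is the right ideal of elements supported on \<open>X\<close>; described by
  coordinates it commutes with intersections without appeal to flatness.\<close>

definition part :: "nat \<Rightarrow> 'b set \<Rightarrow> 'p set" where
  "part i X = {p \<in> carrier (P i). \<forall>x D. c i x p D \<noteq> 0 \<longrightarrow> D \<in> X}"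

lemma part_carrier: "p \<in> part i X \<Longrightarrow> p \<in> carrier (P i)"
  and part_coord: "p \<in> part i X \<Longrightarrow> c i x p D \<noteq> 0 \<Longrightarrow> D \<in> X"
  by (auto simp: part_def)

lemma part_zero: "\<zero>\<^bsub>P i\<^esub> \<in> part i X"
  by (simp add: part_def zero_R)

lemma part_add: "p \<in> part i X \<Longrightarrow> q \<in> part i X \<Longrightarrow> p \<oplus>\<^bsub>P i\<^esub> q \<in> part i X"
  unfolding part_def by (auto simp: add_R) (metis add.right_neutral)

lemma R_uminus: "f \<in> carrier R \<Longrightarrow> \<ominus> f = (\<lambda>D. - f D)"
  by (rule R.minus_equality) (auto simp: add_R zero_R carrier_R)

lemma part_uminus: "p \<in> part i X \<Longrightarrow> \<ominus>\<^bsub>P i\<^esub> p \<in> part i X"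
  by (auto simp: part_def R_uminus coord_closed)

lemma part_minus: "p \<in> part i X \<Longrightarrow> q \<in> part i X \<Longrightarrow> p \<ominus>\<^bsub>P i\<^esub> q \<in> part i X"
  unfolding a_minus_def by (intro part_add part_uminus)

lemma part_mono: "X \<subseteq> Y \<Longrightarrow> part i X \<subseteq> part i Y"
  by (auto simp: part_def)

lemma part_Int: "part i (X \<inter> Y) = part i X \<inter> part i Y"
  by (auto simp: part_def)

lemma part_sum: "finite S \<Longrightarrow> (\<And>x. x \<in> S \<Longrightarrow> f x \<in> part i X) \<Longrightarrow> (\<Oplus>\<^bsub>P i\<^esub>x\<in>S. f x) \<in> part i X"
  by (rule P.finsum_mem) (auto intro: part_add part_zero part_carrier)

text \<open>Every element is a cycle in degree 0: the complexes of parts are compared with zero, not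
  with the trivial module, so exactness there means that \<open>d 0\<close> is onto.\<close>

definition cycle :: "nat \<Rightarrow> 'p \<Rightarrow> bool" where
  "cycle i p \<longleftrightarrow> (case i of 0 \<Rightarrow> True | Suc j \<Rightarrow> d j p = \<zero>\<^bsub>P j\<^esub>)"

text \<open>The first clause says that the span of \<open>X\<close> behaves as a right ideal, tested
  on the modules themselves as the algebra is not assumed associative. Only with it does
  \<open>part i X\<close> have its intended meaning. The second clause is exactness in all
  degrees.\<close>

definition acyclic_part :: "'b set \<Rightarrow> bool" where
  "acyclic_part X \<longleftrightarrow>
     (\<forall>i. \<forall>a\<in>carrier R. \<forall>p\<in>carrier (P i). (\<forall>D. a D \<noteq> 0 \<longrightarrow> D \<in> X) \<longrightarrow> a \<odot>\<^bsub>P i\<^esub> p \<in> part i X) \<and>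
     (\<forall>i. \<forall>p\<in>part i X. cycle i p \<longrightarrow> p \<in> d i ` part (Suc i) X)"

lemma acyclic_part_smult:
  "acyclic_part X \<Longrightarrow> a \<in> carrier R \<Longrightarrow> (\<And>D. a D \<noteq> 0 \<Longrightarrow> D \<in> X) \<Longrightarrow> p \<in> carrier (P i) \<Longrightarrow>
    a \<odot>\<^bsub>P i\<^esub> p \<in> part i X"
  and acyclic_part_exact:
  "acyclic_part X \<Longrightarrow> p \<in> part i X \<Longrightarrow> cycle i p \<Longrightarrow> \<exists>q\<in>part (Suc i) X. p = d i q"
  unfolding acyclic_part_def by blast+

text \<open>The coordinates of \<open>d i p\<close> have no direct relation to those of
  \<open>p\<close>. Instead \<open>p\<close> is expanded, and by linearity \<open>d i p\<close> is a
  sum of coordinates of \<open>p\<close> times elements of \<open>P i\<close>, to which the ideal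
  clause applies.\<close>

lemma acyclic_part_d:
  assumes X: "acyclic_part X" and p: "p \<in> part (Suc i) X"
  shows "d i p \<in> part i X"
proof -
  note pc = part_carrier[OF p]
  have fin: "finite {x. c (Suc i) x p \<noteq> \<zero>}" using coord_finite[OF pc] .
  have "d i p = d i (\<Oplus>\<^bsub>P (Suc i)\<^esub>x\<in>{x. c (Suc i) x p \<noteq> \<zero>}. c (Suc i) x p \<odot>\<^bsub>P (Suc i)\<^esub> g (Suc i) x)"
    using coord_expand[OF pc] by (simp add: linear_extension_def)
  also have "\<dots> = (\<Oplus>\<^bsub>P i\<^esub>x\<in>{x. c (Suc i) x p \<noteq> \<zero>}. d i (c (Suc i) x p \<odot>\<^bsub>P (Suc i)\<^esub> g (Suc i) x))"
    using coord_term_closed[OF pc g_closed] by (intro d.hom_finsum fin) auto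
  also have "\<dots> \<in> part i X"
  proof (rule part_sum[OF fin])
    fix x
    have "c (Suc i) x p \<odot>\<^bsub>P i\<^esub> d i (g (Suc i) x) \<in> part i X"
      using p by (intro acyclic_part_smult[OF X] coord_closed pc) (auto intro: part_coord d.hom_closed[OF g_closed])
    then show "d i (c (Suc i) x p \<odot>\<^bsub>P (Suc i)\<^esub> g (Suc i) x) \<in> part i X"
      by (simp add: d_smult coord_closed pc g_closed)
  qed
  finally show ?thesis .
qed

text \<open>Each coordinate is cut into its restriction to \<open>X\<close> and the rest, which is
  supported on \<open>Y\<close>; the ideal clauses put the two resulting sums into the respective
  parts.\<close>

lemma part_Un_split:
  assumes X: "acyclic_part X" and Y: "acyclic_part Y" and p: "p \<in> part i (X \<union> Y)"
  shows "\<exists>q\<in>part i X. \<exists>r\<in>part i Y. p = q \<oplus>\<^bsub>P i\<^esub> r"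
proof -
  note pc = part_carrier[OF p]
  let ?S = "{x. c i x p \<noteq> \<zero>}"
  define a where "a x = (\<lambda>D. if D \<in> X then c i x p D else 0)" for x
  define b where "b x = (\<lambda>D. if D \<in> X then 0 else c i x p D)" for x
  have ab: "a x \<in> carrier R" "b x \<in> carrier R" for x
    using coord_closed[OF pc, of x] by (auto simp: carrier_R a_def b_def)
  have a: "a x \<odot>\<^bsub>P i\<^esub> g i x \<in> part i X" for x
    by (intro acyclic_part_smult[OF X] ab g_closed) (simp add: a_def split: if_splits)
  have b: "b x \<odot>\<^bsub>P i\<^esub> g i x \<in> part i Y" for x
    using part_coord[OF p, of x]
    by (intro acyclic_part_smult[OF Y] ab g_closed) (auto simp: b_def split: if_splits)
  have "p = (\<Oplus>\<^bsub>P i\<^esub>x\<in>?S. c i x p \<odot>\<^bsub>P i\<^esub> g i x)"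
    using coord_expand[OF pc] by (simp add: linear_extension_def)
  also have "\<dots> = (\<Oplus>\<^bsub>P i\<^esub>x\<in>?S. a x \<odot>\<^bsub>P i\<^esub> g i x \<oplus>\<^bsub>P i\<^esub> b x \<odot>\<^bsub>P i\<^esub> g i x)"
  proof (rule P.finsum_cong')
    fix x
    have "c i x p = a x \<oplus> b x" by (auto simp: a_def b_def add_R)
    then show "c i x p \<odot>\<^bsub>P i\<^esub> g i x = a x \<odot>\<^bsub>P i\<^esub> g i x \<oplus>\<^bsub>P i\<^esub> b x \<odot>\<^bsub>P i\<^esub> g i x"
      using ab g_closed by (simp add: P.smult_l_distr)
  qed (use a b in \<open>auto intro: part_carrier\<close>)
  also have "\<dots> = (\<Oplus>\<^bsub>P i\<^esub>x\<in>?S. a x \<odot>\<^bsub>P i\<^esub> g i x) \<oplus>\<^bsub>P i\<^esub> (\<Oplus>\<^bsub>P i\<^esub>x\<in>?S. b x \<odot>\<^bsub>P i\<^esub> g i x)"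
    using a b by (intro P.finsum_addf) (auto intro: part_carrier)
  finally have "p = \<dots>" .
  moreover have "(\<Oplus>\<^bsub>P i\<^esub>x\<in>?S. a x \<odot>\<^bsub>P i\<^esub> g i x) \<in> part i X" by (intro part_sum coord_finite[OF pc] a)
  moreover have "(\<Oplus>\<^bsub>P i\<^esub>x\<in>?S. b x \<odot>\<^bsub>P i\<^esub> g i x) \<in> part i Y" by (intro part_sum coord_finite[OF pc] b)
  ultimately show ?thesis by blast
qed

lemma acyclic_part_empty: "acyclic_part {}"
proof -
  have zero: "p = \<zero>\<^bsub>P i\<^esub>" if p: "p \<in> part i {}" for i p
  proof -
    have "c i x p = \<zero>" for x using part_coord[OF p] by (auto simp: zero_R)
    then show ?thesis using coord_expand[OF part_carrier[OF p]] by (simp add: linear_extension_def)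
  qed
  have "p \<in> d i ` part (Suc i) {}" if p: "p \<in> part i {}" for i p
    unfolding zero[OF p] using part_zero[of "Suc i" "{}"] d.hom_zero[of i] by (metis imageI)
  moreover have "a \<odot>\<^bsub>P i\<^esub> p \<in> part i {}" if "\<forall>D. \<not> a D \<noteq> 0" "p \<in> carrier (P i)" for i a p
  proof -
    have "a = \<zero>" using that(1) by (auto simp: zero_R)
    then show ?thesis using smult_zero[OF P.left_module_axioms that(2)] part_zero by simp
  qed
  ultimately show ?thesis unfolding acyclic_part_def by auto
qed

text \<open>Mayer--Vietoris: the two summands of a cycle have opposite boundaries, which therefore lie
  in the intersection and bound there.\<close>

lemma acyclic_part_Un:
  assumes X: "acyclic_part X" and Y: "acyclic_part Y" and XY: "acyclic_part (X \<inter> Y)"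
  shows "acyclic_part (X \<union> Y)"
proof -
  have "p \<in> d i ` part (Suc i) (X \<union> Y)" if p: "p \<in> part i (X \<union> Y)" "cycle i p" for i p
  proof -
    obtain q r where q: "q \<in> part i X" and r: "r \<in> part i Y" and pqr: "p = q \<oplus>\<^bsub>P i\<^esub> r"
      using part_Un_split[OF X Y p(1)] by blast
    note qr = part_carrier[OF q] part_carrier[OF r]
    \<comment> \<open>The correction \<open>z\<close> is moved from one summand to the other, which
      leaves their sum unchanged and makes both of them cycles.\<close>
    have "\<exists>z\<in>part i (X \<inter> Y). cycle i (q \<ominus>\<^bsub>P i\<^esub> z) \<and> cycle i (r \<oplus>\<^bsub>P i\<^esub> z)"
    proof (cases i)
      case 0
      then show ?thesis using part_zero[of i "X \<inter> Y"] by (auto simp: cycle_def)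
    next
      case (Suc j)
      have dqr: "d j q \<oplus>\<^bsub>P j\<^esub> d j r = \<zero>\<^bsub>P j\<^esub>"
        using p(2) qr by (simp add: pqr Suc cycle_def)
      have dq: "d j q = \<ominus>\<^bsub>P j\<^esub> d j r"
        using dqr qr Suc by (metis P.minus_equality d.hom_closed)
      have "d j q \<in> part j X" using acyclic_part_d[OF X] q Suc by simp
      moreover have "d j q \<in> part j Y" unfolding dq using acyclic_part_d[OF Y] r Suc by (simp add: part_uminus)
      ultimately have "d j q \<in> part j (X \<inter> Y)" by (simp add: part_Int)
      moreover have "cycle j (d j q)" using qr Suc by (auto simp: cycle_def d_d split: nat.split)
      ultimately obtain z where z: "z \<in> part i (X \<inter> Y)" "d j q = d j z"
        using acyclic_part_exact[OF XY] Suc by blast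
      note zc = part_carrier[OF z(1)]
      have "d j (q \<ominus>\<^bsub>P i\<^esub> z) = d j q \<ominus>\<^bsub>P j\<^esub> d j z" using qr zc Suc by (simp add: a_minus_def)
      then have "cycle i (q \<ominus>\<^bsub>P i\<^esub> z)" using zc Suc by (simp add: cycle_def z(2) P.r_neg a_minus_def)
      moreover have "cycle i (r \<oplus>\<^bsub>P i\<^esub> z)"
        using dqr qr zc Suc z(2) by (simp add: cycle_def P.a_comm)
      ultimately show ?thesis using z(1) by blast
    qed
    then obtain z where z: "z \<in> part i (X \<inter> Y)" "cycle i (q \<ominus>\<^bsub>P i\<^esub> z)" "cycle i (r \<oplus>\<^bsub>P i\<^esub> z)"
      by blast
    have z': "z \<in> part i X" "z \<in> part i Y" "z \<in> carrier (P i)"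
      using z(1) by (auto simp: part_Int part_carrier)
    obtain v where v: "v \<in> part (Suc i) X" "q \<ominus>\<^bsub>P i\<^esub> z = d i v"
      using acyclic_part_exact[OF X part_minus[OF q z'(1)] z(2)] by blast
    obtain w where w: "w \<in> part (Suc i) Y" "r \<oplus>\<^bsub>P i\<^esub> z = d i w"
      using acyclic_part_exact[OF Y part_add[OF r z'(2)] z(3)] by blast
    have "d i (v \<oplus>\<^bsub>P (Suc i)\<^esub> w) = (q \<ominus>\<^bsub>P i\<^esub> z) \<oplus>\<^bsub>P i\<^esub> (r \<oplus>\<^bsub>P i\<^esub> z)"
      using part_carrier[OF v(1)] part_carrier[OF w(1)] by (simp add: v(2) w(2))
    also have "\<dots> = p"
      using qr z'(3) by (simp add: pqr a_minus_def P.a_ac P.r_neg P.l_neg P.r_neg1 P.r_neg2)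
    finally have "p = d i (v \<oplus>\<^bsub>P (Suc i)\<^esub> w)" by simp
    moreover have "v \<oplus>\<^bsub>P (Suc i)\<^esub> w \<in> part (Suc i) (X \<union> Y)"
      using part_mono[of X "X \<union> Y"] part_mono[of Y "X \<union> Y"] v(1) w(1) by (intro part_add) auto
    ultimately show ?thesis by blast
  qed
  moreover have "a \<odot>\<^bsub>P i\<^esub> p \<in> part i (X \<union> Y)"
    if a: "a \<in> carrier R" "\<forall>D. a D \<noteq> 0 \<longrightarrow> D \<in> X \<union> Y" and p: "p \<in> carrier (P i)" for a p i
  proof -
    define a1 where "a1 = (\<lambda>D. if D \<in> X then a D else 0)"
    define a2 where "a2 = (\<lambda>D. if D \<in> X then 0 else a D)"
    have a12: "a1 \<in> carrier R" "a2 \<in> carrier R" "a = a1 \<oplus> a2"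
      using a(1) by (auto simp: a1_def a2_def carrier_R add_R)
    have "a1 \<odot>\<^bsub>P i\<^esub> p \<in> part i X"
      by (intro acyclic_part_smult[OF X] a12 p) (simp add: a1_def split: if_splits)
    moreover have "a2 \<odot>\<^bsub>P i\<^esub> p \<in> part i Y"
      using a(2) by (intro acyclic_part_smult[OF Y] a12 p) (auto simp: a2_def split: if_splits)
    ultimately show ?thesis using a12 p part_mono[of X "X \<union> Y"] part_mono[of Y "X \<union> Y"]
      by (auto simp: P.smult_l_distr intro!: part_add)
  qed
  ultimately show ?thesis unfolding acyclic_part_def by blast
qed

text \<open>Inclusion-exclusion. Splitting off one cell \<open>X\<close>, its overlap with the union
  of the others is the union of the sets \<open>X \<inter> Y\<close>, a family with fewer members
  than the original one, whose intersections are again intersections of given cells.\<close>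

lemma acyclic_part_Union:
  assumes "finite F" "\<And>T. T \<subseteq> F \<Longrightarrow> T \<noteq> {} \<Longrightarrow> acyclic_part (\<Inter>T)"
  shows "acyclic_part (\<Union>F)"
proof -
  \<comment> \<open>The cardinality is bounded and not fixed, because different cells may have the
    same overlap with \<open>X\<close>.\<close>
  have "acyclic_part (\<Union>F)" if "finite F" "card F \<le> n" "\<And>T. T \<subseteq> F \<Longrightarrow> T \<noteq> {} \<Longrightarrow> acyclic_part (\<Inter>T)"
    for n and F :: "'b set set"
    using that
  proof (induction n arbitrary: F)
    case 0
    then show ?case using acyclic_part_empty by simp
  next
    case (Suc n)
    show ?case
    proof (cases "F = {}")
      case False
      then obtain X G where F: "F = insert X G" "X \<notin> G" by (meson all_not_in_conv mk_disjoint_insert)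
      have G: "finite G" "card G \<le> n" using Suc.prems(1,2) F by auto
      have "acyclic_part (\<Union>G)" using Suc.prems(3) F by (intro Suc.IH G) auto
      moreover have "acyclic_part X" using Suc.prems(3)[of "{X}"] F by simp
      moreover have "acyclic_part (\<Union>((\<inter>) X ` G))"
      proof (rule Suc.IH)
        show "finite ((\<inter>) X ` G)" using G by simp
        show "card ((\<inter>) X ` G) \<le> n" using card_image_le[OF G(1), of "(\<inter>) X"] G(2) by simp
        fix T assume "T \<subseteq> (\<inter>) X ` G" "T \<noteq> {}"
        then obtain T' where T': "T' \<subseteq> G" "T = (\<inter>) X ` T'" "T' \<noteq> {}"
          by (metis image_empty subset_imageE)
        then have "\<Inter>T = \<Inter>(insert X T')" by auto
        then show "acyclic_part (\<Inter>T)" using Suc.prems(3)[of "insert X T'"] F T'(1) by auto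
      qed
      moreover have "\<Union>((\<inter>) X ` G) = X \<inter> \<Union>G" by blast
      ultimately show ?thesis using acyclic_part_Un F by simp
    qed (simp add: acyclic_part_empty)
  qed
  then show ?thesis using assms by blast
qed

text \<open>A cycle of the part has the form \<open>u q\<close>. Since
  \<open>u \<otimes> e = u\<close>, it may be rewritten as \<open>u z\<close> with \<open>z\<close>
  a multiple by \<open>e\<close>. Such a \<open>z\<close> is a cycle of the augmented resolution
  itself, hence a boundary, and multiplying a preimage by \<open>u\<close> stays inside the
  part.\<close>

lemma acyclic_part_idempotent:
  assumes "idempotent_part R b0 X" shows "acyclic_part X"
proof -
  obtain u e where u: "u \<in> carrier R" and e: "e \<in> carrier R" "e b0 = 0" and ue: "u \<otimes> e = u"
    and span: "{f \<in> carrier R. \<forall>D. f D \<noteq> 0 \<longrightarrow> D \<in> X} = (\<lambda>a. u \<otimes> a) ` carrier R"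
    and ann: "\<And>a. a \<in> carrier R \<Longrightarrow> u \<otimes> a = \<zero> \<Longrightarrow> e \<otimes> a = \<zero>"
    using assms unfolding idempotent_part_def by blast
  have umult: "u \<odot>\<^bsub>P i\<^esub> q \<in> part i X" if q: "q \<in> carrier (P i)" for i q
  proof -
    have "c i x (u \<odot>\<^bsub>P i\<^esub> q) \<in> {f \<in> carrier R. \<forall>D. f D \<noteq> 0 \<longrightarrow> D \<in> X}" for x
      unfolding span coord_smult[OF u q] using coord_closed[OF q] by blast
    then show ?thesis using u q by (auto simp: part_def P.smult_closed)
  qed
  have "p \<in> d i ` part (Suc i) X" if p: "p \<in> part i X" and cyc: "cycle i p" for i p
  proof -
    note pc = part_carrier[OF p]
    let ?S = "{x. c i x p \<noteq> \<zero>}"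
    have "\<exists>a\<in>carrier R. c i x p = u \<otimes> a" for x
    proof -
      have "c i x p \<in> {f \<in> carrier R. \<forall>D. f D \<noteq> 0 \<longrightarrow> D \<in> X}"
        using part_coord[OF p] coord_closed[OF pc] by blast
      then show ?thesis unfolding span by blast
    qed
    then obtain a where a: "\<And>x. a x \<in> carrier R" "\<And>x. c i x p = u \<otimes> a x" by metis
    interpret u: abelian_group_hom "P i" "P i" "\<lambda>x. u \<odot>\<^bsub>P i\<^esub> x" using u by (rule P.smult_group_hom)
    define q where "q = (\<Oplus>\<^bsub>P i\<^esub>x\<in>?S. a x \<odot>\<^bsub>P i\<^esub> g i x)"
    have q: "q \<in> carrier (P i)" unfolding q_def using a g_closed by (intro P.finsum_closed) (auto simp: P.smult_closed)
    have "p = (\<Oplus>\<^bsub>P i\<^esub>x\<in>?S. c i x p \<odot>\<^bsub>P i\<^esub> g i x)"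
      using coord_expand[OF pc] by (simp add: linear_extension_def)
    also have "\<dots> = (\<Oplus>\<^bsub>P i\<^esub>x\<in>?S. u \<odot>\<^bsub>P i\<^esub> (a x \<odot>\<^bsub>P i\<^esub> g i x))"
      unfolding a(2) using u a(1) g_closed by (intro P.finsum_cong') (auto simp: P.smult_assoc P.smult_closed)
    also have "\<dots> = u \<odot>\<^bsub>P i\<^esub> q"
      unfolding q_def using a(1) g_closed coord_finite[OF pc]
      by (intro u.hom_finsum[symmetric]) (auto simp: P.smult_closed)
    finally have pq: "p = u \<odot>\<^bsub>P i\<^esub> q" .
    define z where "z = e \<odot>\<^bsub>P i\<^esub> (e \<odot>\<^bsub>P i\<^esub> q)"
    have eq: "e \<odot>\<^bsub>P i\<^esub> q \<in> carrier (P i)" using e q by (simp add: P.smult_closed)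
    have z: "z \<in> carrier (P i)" unfolding z_def using e eq by (simp add: P.smult_closed)
    have ueq: "u \<odot>\<^bsub>P i\<^esub> (e \<odot>\<^bsub>P i\<^esub> q) = p"
      using P.smult_assoc[OF u e(1) q, symmetric] ue pq by simp
    then have pz: "p = u \<odot>\<^bsub>P i\<^esub> z"
      unfolding z_def using P.smult_assoc[OF u e(1) eq, symmetric] ue by simp
    have "z \<in> d i ` carrier (P (Suc i))"
    proof (cases i)
      \<comment> \<open>In degree 0 the resolution is exact only on the kernel of
        \<open>\<eta>\<close>; this is where \<open>e b0 = 0\<close> is needed.\<close>
      case 0
      have "\<eta> z = 0" using eq e by (simp add: z_def 0 \<eta>_smult)
      then show ?thesis using exact_0[of z] z 0 by simp
    next
      case (Suc j)
      let ?v = "d j (e \<odot>\<^bsub>P i\<^esub> q)"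
      have v: "?v \<in> carrier (P j)" using eq Suc by simp
      have "u \<odot>\<^bsub>P j\<^esub> ?v = \<zero>\<^bsub>P j\<^esub>"
        using cyc ueq eq u Suc d_smult[of u "e \<odot>\<^bsub>P i\<^esub> q" j] by (simp add: cycle_def)
      \<comment> \<open>The annihilator condition concerns elements of the algebra, so it is applied
        to every coordinate and the result is reassembled from the coordinates.\<close>
      then have "u \<otimes> c j x ?v = \<zero>" for x using coord_smult[OF u v, of x] by simp
      then have "c j x (e \<odot>\<^bsub>P j\<^esub> ?v) = \<zero>" for x
        using coord_smult[OF e(1) v, of x] ann[OF coord_closed[OF v]] by simp
      then have "e \<odot>\<^bsub>P j\<^esub> ?v = \<zero>\<^bsub>P j\<^esub>"
        using coord_expand[of "e \<odot>\<^bsub>P j\<^esub> ?v" j] e(1) v by (simp add: linear_extension_def P.smult_closed)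
      then have "d j z = \<zero>\<^bsub>P j\<^esub>" using d_smult[OF e(1), of "e \<odot>\<^bsub>P i\<^esub> q" j] eq Suc by (simp add: z_def)
      then show ?thesis using exact_Suc[of z j] z Suc by simp
    qed
    then obtain w where w: "w \<in> carrier (P (Suc i))" "z = d i w" by blast
    then have "p = d i (u \<odot>\<^bsub>P (Suc i)\<^esub> w)" using pz u by (simp add: d_smult)
    then show ?thesis using umult[OF w(1)] by blast
  qed
  moreover have "a \<odot>\<^bsub>P i\<^esub> p \<in> part i X"
    if a: "a \<in> carrier R" "\<forall>D. a D \<noteq> 0 \<longrightarrow> D \<in> X" and p: "p \<in> carrier (P i)" for a p i
  proof -
    have "a \<in> (\<lambda>a. u \<otimes> a) ` carrier R" unfolding span[symmetric] using a by blast
    then obtain b where "b \<in> carrier R" "a = u \<otimes> b" by blast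
    then show ?thesis using umult[of "b \<odot>\<^bsub>P i\<^esub> p" i] u p by (simp add: P.smult_assoc P.smult_closed)
  qed
  ultimately show ?thesis unfolding acyclic_part_def by blast
qed

end

section \<open>A homotopy modulo the augmentation ideal\<close>

lemma module_hom_compose:
  "f \<in> module_hom R M N \<Longrightarrow> h \<in> module_hom R N L \<Longrightarrow> (\<lambda>x. h (f x)) \<in> module_hom R M L"
  by (auto simp: module_hom_def Pi_iff)

lemma module_hom_cong:
  assumes "left_module R M" "f \<in> module_hom R M N" "\<And>x. x \<in> carrier M \<Longrightarrow> f x = h x"
  shows "h \<in> module_hom R M N"
proof -
  interpret left_module R M by fact
  show ?thesis using assms(2,3) by (auto simp: module_hom_def smult_closed Pi_iff)
qed

lemma (in abelian_group) add_minus_cancel: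
  assumes "x \<in> carrier G" "y \<in> carrier G" shows "y \<oplus> (x \<ominus> y) = x"
  using assms by (simp add: a_minus_def a_lcomm[of y x] r_neg)

locale acyclic_resolution = augmented_resolution R B b0 P d \<eta> c g
  for R :: "('k::{comm_ring, comm_monoid_mult}, 'b \<Rightarrow> 'k) module" (structure) and B b0
    and P :: "nat \<Rightarrow> ('b \<Rightarrow> 'k, 'p) module" and d \<eta> and c :: "nat \<Rightarrow> 'x \<Rightarrow> 'p \<Rightarrow> 'b \<Rightarrow> 'k" and g +
  assumes smult_R: "s \<odot> f = (\<lambda>D. s * f D)"
    and acyclic: "acyclic_part (B - {b0})"
begin

abbreviation "N \<equiv> augmentation_module b0"
abbreviation "aug_part i \<equiv> part i (B - {b0})"

lemma N_simps [simp]: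
  "carrier N = UNIV" "\<zero>\<^bsub>N\<^esub> = 0" "x \<oplus>\<^bsub>N\<^esub> y = x + y" "a \<odot>\<^bsub>N\<^esub> x = a b0 * x"
  by (simp_all add: augmentation_module_def)

lemma aug_part_iff: "p \<in> aug_part i \<longleftrightarrow> p \<in> carrier (P i) \<and> (\<forall>x. c i x p b0 = 0)"
proof -
  have "c i x p D \<noteq> 0 \<Longrightarrow> D \<in> B" if "p \<in> carrier (P i)" for x D
    using coord_closed[OF that, of x] by (auto simp: carrier_R)
  then show ?thesis unfolding part_def by auto
qed

lemma aug_smult_mem: "a \<in> carrier R \<Longrightarrow> a b0 = 0 \<Longrightarrow> p \<in> carrier (P i) \<Longrightarrow> a \<odot>\<^bsub>P i\<^esub> p \<in> aug_part i"
  by (rule acyclic_part_smult[OF acyclic]) (auto simp: carrier_R)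

lemma left_module_N: "left_module R N"
proof (intro left_module.intro abelian_groupI left_module_axioms.intro)
  fix x assume "x \<in> carrier N"
  show "\<exists>y\<in>carrier N. y \<oplus>\<^bsub>N\<^esub> x = \<zero>\<^bsub>N\<^esub>" by (intro bexI[of _ "- x"]) simp_all
qed (simp_all add: add_R mult_base one_base algebra_simps)

lemma aug_part_smult:
  assumes "a \<in> carrier R" "p \<in> aug_part i" shows "a \<odot>\<^bsub>P i\<^esub> p \<in> aug_part i"
  using assms by (simp add: aug_part_iff P.smult_closed coord_smult mult_base coord_closed)

definition scalar :: "'k \<Rightarrow> 'b \<Rightarrow> 'k" where
  "scalar s = s \<odot> \<one>"

lemma scalar_eq: "scalar s = (\<lambda>D. s * \<one> D)"
  by (simp add: scalar_def smult_R)

lemma scalar_closed: "scalar s \<in> carrier R"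
  using one_closed by (simp add: scalar_eq carrier_R)

lemma scalar_base: "scalar s b0 = s"
  by (simp add: scalar_eq one_base)

lemma mult_scalar:
  assumes "f \<in> carrier R"
  shows "f \<otimes> scalar s = (\<lambda>D. s * f D)" "scalar s \<otimes> f = (\<lambda>D. s * f D)"
    "f \<otimes> scalar s \<in> carrier R" "scalar s \<otimes> f \<in> carrier R"
proof -
  show "f \<otimes> scalar s = (\<lambda>D. s * f D)" "scalar s \<otimes> f = (\<lambda>D. s * f D)"
    using assms by (simp_all add: scalar_eq mult_scalar_l mult_scalar_r l_one r_one)
  then show "f \<otimes> scalar s \<in> carrier R" "scalar s \<otimes> f \<in> carrier R"
    using assms by (simp_all add: carrier_R)
qed

section \<open>Homomorphisms prescribed on the generators\<close>

definition extend :: "nat \<Rightarrow> ('b \<Rightarrow> 'k, 'm) module \<Rightarrow> ('x \<Rightarrow> 'm) \<Rightarrow> 'p \<Rightarrow> 'm" where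
  "extend i M z p = linear_extension R M z (\<lambda>x. c i x p)"

lemma extend_hom: "left_module R M \<Longrightarrow> (\<And>x. z x \<in> carrier M) \<Longrightarrow> extend i M z \<in> module_hom R (P i) M"
  unfolding extend_def by (rule dual_basis_extension_hom[OF P.left_module_axioms basis])

lemma hom_extend:
  assumes "left_module R M" "left_module R L" "f \<in> module_hom R M L" "\<And>x. z x \<in> carrier M"
    "p \<in> carrier (P i)"
  shows "f (extend i M z p) = extend i L (\<lambda>x. f (z x)) p"
proof -
  interpret M: left_module R M by fact
  interpret L: left_module R L by fact
  interpret f: abelian_group_hom M L f by (rule module_hom_group_hom[OF assms(1-3)])
  have "f (extend i M z p) = (\<Oplus>\<^bsub>L\<^esub>x\<in>{x. c i x p \<noteq> \<zero>}. f (c i x p \<odot>\<^bsub>M\<^esub> z x))"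
    unfolding extend_def linear_extension_def using assms(4,5)
    by (intro f.hom_finsum coord_finite) (auto simp: M.smult_closed coord_closed)
  also have "\<dots> = extend i L (\<lambda>x. f (z x)) p"
    unfolding extend_def linear_extension_def using assms(4,5)
    by (intro L.finsum_cong') (auto simp: L.smult_closed coord_closed module_hom_smult[OF assms(3)])
  finally show ?thesis .
qed

lemma extend_add:
  assumes "left_module R M" "\<And>x. z x \<in> carrier M" "\<And>x. w x \<in> carrier M" "p \<in> carrier (P i)"
  shows "extend i M (\<lambda>x. z x \<oplus>\<^bsub>M\<^esub> w x) p = extend i M z p \<oplus>\<^bsub>M\<^esub> extend i M w p"
proof -
  interpret M: left_module R M by fact
  have "extend i M (\<lambda>x. z x \<oplus>\<^bsub>M\<^esub> w x) p =
      (\<Oplus>\<^bsub>M\<^esub>x\<in>{x. c i x p \<noteq> \<zero>}. c i x p \<odot>\<^bsub>M\<^esub> z x \<oplus>\<^bsub>M\<^esub> c i x p \<odot>\<^bsub>M\<^esub> w x)"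
    unfolding extend_def linear_extension_def using assms(2-)
    by (intro M.finsum_cong') (auto simp: M.smult_closed coord_closed M.smult_r_distr)
  also have "\<dots> = extend i M z p \<oplus>\<^bsub>M\<^esub> extend i M w p"
    unfolding extend_def linear_extension_def using assms(2-)
    by (intro M.finsum_addf) (auto simp: M.smult_closed coord_closed)
  finally show ?thesis .
qed

lemma extend_g: "p \<in> carrier (P i) \<Longrightarrow> extend i (P i) (g i) p = p"
  by (simp add: extend_def coord_expand)

lemma extend_aug_part:
  assumes "\<And>x. z x \<in> aug_part j" "p \<in> carrier (P i)"
  shows "extend i (P j) z p \<in> aug_part j"
  unfolding extend_def linear_extension_def
  using assms by (intro part_sum coord_finite aug_part_smult coord_closed)

text \<open>After expansion, each coordinate of \<open>p\<close> acts on the trivial module through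
  its value at \<open>b0\<close>, which is zero.\<close>

lemma hom_aug_part:
  assumes "\<phi> \<in> module_hom R (P i) N" "p \<in> aug_part i" shows "\<phi> p = 0"
proof -
  interpret N: left_module R N by (rule left_module_N)
  have p: "p \<in> carrier (P i)" "c i x p b0 = 0" for x using assms(2) by (auto simp: aug_part_iff)
  have "\<phi> p = \<phi> (extend i (P i) (g i) p)" using p by (simp add: extend_g)
  also have "\<dots> = extend i N (\<lambda>x. \<phi> (g i x)) p"
    by (intro hom_extend left_module_N P.left_module_axioms assms g_closed p)
  also have "\<dots> = (\<Oplus>\<^bsub>N\<^esub>x\<in>{x. c i x p \<noteq> \<zero>}. \<zero>\<^bsub>N\<^esub>)"
    unfolding extend_def linear_extension_def by (intro N.finsum_cong') (auto simp: p)
  also have "\<dots> = \<zero>\<^bsub>N\<^esub>" by (rule N.finsum_zero)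
  finally show ?thesis by simp
qed

text \<open>The generator \<open>g 0 x\<close> and the multiple of \<open>q0\<close> by
  \<open>\<eta> (g 0 x)\<close> have the same image under \<open>\<eta>\<close>, so they differ by a
  boundary. The trivial module need not lift to \<open>P 0\<close>; hence the remainder is kept as
  \<open>t\<close> times \<open>q0\<close>. It falls into the augmentation part as soon as
  \<open>\<eta> p = 0\<close>.\<close>

lemma homotopy_start:
  assumes q0: "q0 \<in> carrier (P 0)" "\<eta> q0 = 1"
  shows "\<exists>h\<in>module_hom R (P 0) (P 1).
    \<forall>p\<in>carrier (P 0). \<exists>t\<in>carrier R. t b0 = \<eta> p \<and> p = t \<odot>\<^bsub>P 0\<^esub> q0 \<oplus>\<^bsub>P 0\<^esub> d 0 (h p)"
proof -
  define s where "s x = scalar (\<eta> (g 0 x))" for x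
  have s: "s x \<in> carrier R" for x by (simp add: s_def scalar_closed)
  have sq: "s x \<odot>\<^bsub>P 0\<^esub> q0 \<in> carrier (P 0)" for x using s q0 by (simp add: P.smult_closed)
  have "\<exists>z\<in>carrier (P 1). g 0 x = s x \<odot>\<^bsub>P 0\<^esub> q0 \<oplus>\<^bsub>P 0\<^esub> d 0 z" for x
  proof -
    let ?y = "g 0 x \<ominus>\<^bsub>P 0\<^esub> s x \<odot>\<^bsub>P 0\<^esub> q0"
    have y: "?y \<in> carrier (P 0)" using g_closed sq by simp
    have eq: "s x \<odot>\<^bsub>P 0\<^esub> q0 \<oplus>\<^bsub>P 0\<^esub> ?y = g 0 x"
      by (rule P.add_minus_cancel[OF g_closed sq])
    then have "\<eta> (g 0 x) = \<eta> (s x \<odot>\<^bsub>P 0\<^esub> q0) + \<eta> ?y" using \<eta>_add[OF sq[of x] y] by simp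
    then have "\<eta> ?y = 0" using s q0 by (simp add: \<eta>_smult s_def scalar_base)
    then obtain z where "z \<in> carrier (P 1)" "?y = d 0 z" using exact_0[OF y] by blast
    then show ?thesis using eq by (intro bexI[of _ z]) simp_all
  qed
  then obtain z where z: "\<And>x. z x \<in> carrier (P 1)"
    "\<And>x. g 0 x = s x \<odot>\<^bsub>P 0\<^esub> q0 \<oplus>\<^bsub>P 0\<^esub> d 0 (z x)" by metis
  define h where "h = extend 0 (P 1) z"
  have h: "h \<in> module_hom R (P 0) (P 1)"
    unfolding h_def by (intro extend_hom P.left_module_axioms z)
  have "\<exists>t\<in>carrier R. t b0 = \<eta> p \<and> p = t \<odot>\<^bsub>P 0\<^esub> q0 \<oplus>\<^bsub>P 0\<^esub> d 0 (h p)" if p: "p \<in> carrier (P 0)" for p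
  proof -
    interpret q0: abelian_group_hom R "P 0" "\<lambda>a. a \<odot>\<^bsub>P 0\<^esub> q0"
      using q0 by (intro abelian_group_homI' R.abelian_group_axioms P.abelian_group_axioms)
        (auto simp: P.smult_closed P.smult_l_distr)
    define t where "t = (\<Oplus>x\<in>{x. c 0 x p \<noteq> \<zero>}. c 0 x p \<otimes> s x)"
    have cs: "c 0 x p \<otimes> s x \<in> carrier R" for x
      unfolding s_def by (intro mult_scalar coord_closed p)
    have t: "t \<in> carrier R" unfolding t_def using cs by (intro R.finsum_closed) auto
    have "extend 0 (P 0) (\<lambda>x. s x \<odot>\<^bsub>P 0\<^esub> q0) p =
        (\<Oplus>\<^bsub>P 0\<^esub>x\<in>{x. c 0 x p \<noteq> \<zero>}. (c 0 x p \<otimes> s x) \<odot>\<^bsub>P 0\<^esub> q0)"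
      unfolding extend_def linear_extension_def using s q0 p cs
      by (intro P.finsum_cong') (auto simp: P.smult_assoc coord_closed P.smult_closed)
    also have "\<dots> = t \<odot>\<^bsub>P 0\<^esub> q0"
      unfolding t_def using cs by (intro q0.hom_finsum[symmetric] coord_finite p) auto
    finally have tq: "extend 0 (P 0) (\<lambda>x. s x \<odot>\<^bsub>P 0\<^esub> q0) p = t \<odot>\<^bsub>P 0\<^esub> q0" .
    have "p = extend 0 (P 0) (\<lambda>x. s x \<odot>\<^bsub>P 0\<^esub> q0 \<oplus>\<^bsub>P 0\<^esub> d 0 (z x)) p"
      using extend_g[OF p] unfolding z(2)[symmetric] by simp
    also have "\<dots> = t \<odot>\<^bsub>P 0\<^esub> q0 \<oplus>\<^bsub>P 0\<^esub> extend 0 (P 0) (\<lambda>x. d 0 (z x)) p"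
      unfolding tq[symmetric] using z(1) by (intro extend_add P.left_module_axioms sq p) simp
    also have "extend 0 (P 0) (\<lambda>x. d 0 (z x)) p = d 0 (h p)"
      unfolding h_def using z(1) d_hom[of 0]
      by (intro hom_extend[symmetric] P.left_module_axioms p) auto
    finally have pt: "p = t \<odot>\<^bsub>P 0\<^esub> q0 \<oplus>\<^bsub>P 0\<^esub> d 0 (h p)" .
    have hp: "h p \<in> carrier (P (Suc 0))" using module_hom_closed[OF h p] by simp
    have "\<eta> p = \<eta> (t \<odot>\<^bsub>P 0\<^esub> q0) + \<eta> (d 0 (h p))"
      by (subst pt, rule \<eta>_add) (use t q0 hp in \<open>auto simp: P.smult_closed\<close>)
    then have "\<eta> p = t b0" using t q0 hp by (simp add: \<eta>_smult \<eta>_d)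
    then show ?thesis using t pt by auto
  qed
  then show ?thesis using h by blast
qed

text \<open>In the usual construction \<open>q\<close> minus \<open>h (d i q)\<close> would be a
  cycle. Here its boundary \<open>v0\<close> is only known to lie in the augmentation part. But
  \<open>v0\<close> is itself a cycle there, so by acyclicity it is the boundary of some
  \<open>v\<close> in that part. Subtracting \<open>v\<close> yields a true cycle, to which
  exactness of the resolution applies.\<close>

lemma homotopy_step:
  assumes h: "h \<in> module_hom R (P i) (P (Suc i))"
    and near: "\<forall>w\<in>carrier (P (Suc i)). \<exists>v\<in>aug_part i. d i w = d i (h (d i w)) \<oplus>\<^bsub>P i\<^esub> v"
  shows "\<exists>h'\<in>module_hom R (P (Suc i)) (P (Suc (Suc i))). \<forall>p\<in>carrier (P (Suc i)). \<exists>v\<in>aug_part (Suc i).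
    p = h (d i p) \<oplus>\<^bsub>P (Suc i)\<^esub> d (Suc i) (h' p) \<oplus>\<^bsub>P (Suc i)\<^esub> v"
proof -
  let ?P = "P (Suc i)"
  have hc: "h (d i q) \<in> carrier ?P" if "q \<in> carrier ?P" for q
    using that module_hom_closed[OF h] by simp
  define splits where "splits q z v \<longleftrightarrow> z \<in> carrier (P (Suc (Suc i))) \<and> v \<in> aug_part (Suc i) \<and>
      q = h (d i q) \<oplus>\<^bsub>?P\<^esub> d (Suc i) z \<oplus>\<^bsub>?P\<^esub> v" for q z v
  have "\<exists>z v. splits q z v" if q: "q \<in> carrier ?P" for q
  proof -
    obtain v0 where v0: "v0 \<in> aug_part i" "d i q = d i (h (d i q)) \<oplus>\<^bsub>P i\<^esub> v0" using near q by blast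
    note v0c = part_carrier[OF v0(1)]
    have "cycle i v0"
    proof (cases i)
      case (Suc j)
      have "d j (d i q) = d j (d i (h (d i q))) \<oplus>\<^bsub>P j\<^esub> d j v0"
        using v0(2) v0c hc[OF q] Suc by (metis d.hom_add d.hom_closed)
      then have "d j v0 = \<zero>\<^bsub>P j\<^esub>" using q hc[OF q] v0c Suc d_d[of _ j] by simp
      then show ?thesis by (simp add: cycle_def Suc)
    qed (simp add: cycle_def)
    then obtain v where v: "v \<in> aug_part (Suc i)" "v0 = d i v"
      using acyclic_part_exact[OF acyclic v0(1)] by blast
    note vc = part_carrier[OF v(1)]
    let ?y = "q \<ominus>\<^bsub>?P\<^esub> (h (d i q) \<oplus>\<^bsub>?P\<^esub> v)"
    have y: "?y \<in> carrier ?P" using q hc[OF q] vc by simp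
    have "d i ?y = d i q \<ominus>\<^bsub>P i\<^esub> (d i (h (d i q)) \<oplus>\<^bsub>P i\<^esub> d i v)"
      using q hc[OF q] vc by (simp add: a_minus_def)
    also have "\<dots> = \<zero>\<^bsub>P i\<^esub>" using v0 v q by (simp add: a_minus_def P.r_neg)
    finally obtain z where z: "z \<in> carrier (P (Suc (Suc i)))" "?y = d (Suc i) z"
      using exact_Suc[OF y] by blast
    have "q = (h (d i q) \<oplus>\<^bsub>?P\<^esub> v) \<oplus>\<^bsub>?P\<^esub> ?y"
      using q hc[OF q] vc by (intro P.add_minus_cancel[symmetric]) auto
    also have "\<dots> = h (d i q) \<oplus>\<^bsub>?P\<^esub> (v \<oplus>\<^bsub>?P\<^esub> ?y)" by (rule P.a_assoc[OF hc[OF q] vc y])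
    also have "v \<oplus>\<^bsub>?P\<^esub> ?y = ?y \<oplus>\<^bsub>?P\<^esub> v" by (rule P.a_comm[OF vc y])
    also have "h (d i q) \<oplus>\<^bsub>?P\<^esub> (?y \<oplus>\<^bsub>?P\<^esub> v) = h (d i q) \<oplus>\<^bsub>?P\<^esub> ?y \<oplus>\<^bsub>?P\<^esub> v"
      by (rule P.a_assoc[OF hc[OF q] y vc, symmetric])
    finally have "q = h (d i q) \<oplus>\<^bsub>?P\<^esub> ?y \<oplus>\<^bsub>?P\<^esub> v" .
    from this[unfolded z(2)] z(1) v(1) show ?thesis
      unfolding splits_def by (intro exI[of _ z] exI[of _ v] conjI)
  qed
  then have "\<forall>x. \<exists>z v. splits (g (Suc i) x) z v" using g_closed by blast
  then obtain z v where "\<And>x. splits (g (Suc i) x) (z x) (v x)" by metis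
  then have z: "z x \<in> carrier (P (Suc (Suc i)))" and v: "v x \<in> aug_part (Suc i)"
    and gzv: "g (Suc i) x = h (d i (g (Suc i) x)) \<oplus>\<^bsub>?P\<^esub> d (Suc i) (z x) \<oplus>\<^bsub>?P\<^esub> v x" for x
    unfolding splits_def by blast+
  define h' where "h' = extend (Suc i) (P (Suc (Suc i))) z"
  have "h' \<in> module_hom R ?P (P (Suc (Suc i)))"
    unfolding h'_def by (intro extend_hom P.left_module_axioms z)
  moreover have "\<exists>v\<in>aug_part (Suc i). p = h (d i p) \<oplus>\<^bsub>?P\<^esub> d (Suc i) (h' p) \<oplus>\<^bsub>?P\<^esub> v"
    if p: "p \<in> carrier ?P" for p
  proof -
    have cl: "h (d i (g (Suc i) x)) \<in> carrier ?P" "d (Suc i) (z x) \<in> carrier ?P" for x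
      using hc[OF g_closed] z by auto
    have "p = extend (Suc i) ?P (\<lambda>x. h (d i (g (Suc i) x)) \<oplus>\<^bsub>?P\<^esub> d (Suc i) (z x) \<oplus>\<^bsub>?P\<^esub> v x) p"
      using extend_g[OF p] unfolding gzv[symmetric] by simp
    also have "\<dots> = extend (Suc i) ?P (\<lambda>x. h (d i (g (Suc i) x))) p \<oplus>\<^bsub>?P\<^esub>
        extend (Suc i) ?P (\<lambda>x. d (Suc i) (z x)) p \<oplus>\<^bsub>?P\<^esub> extend (Suc i) ?P v p"
      by (subst extend_add; (intro P.left_module_axioms P.a_closed cl part_carrier[OF v] p refl)?)
         (subst extend_add; (intro P.left_module_axioms cl p refl)?)
    also have "extend (Suc i) ?P (\<lambda>x. h (d i (g (Suc i) x))) p = h (d i p)"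
      using hom_extend[where z = "g (Suc i)", OF P.left_module_axioms P.left_module_axioms
            module_hom_compose[OF d_hom h] g_closed p]
        extend_g[OF p] by simp
    also have "extend (Suc i) ?P (\<lambda>x. d (Suc i) (z x)) p = d (Suc i) (h' p)"
      unfolding h'_def by (intro hom_extend[symmetric] P.left_module_axioms d_hom z p)
    finally show ?thesis using extend_aug_part[where z = v, OF v p] by (rule bexI)
  qed
  ultimately show ?thesis by blast
qed

lemma homotopy_exists:
  "\<exists>h. \<forall>i. h i \<in> module_hom R (P i) (P (Suc i)) \<and> (\<forall>p\<in>carrier (P (Suc i)). \<exists>v\<in>aug_part (Suc i).
    p = h i (d i p) \<oplus>\<^bsub>P (Suc i)\<^esub> d (Suc i) (h (Suc i) p) \<oplus>\<^bsub>P (Suc i)\<^esub> v)"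
proof -
  \<comment> \<open>\<open>Q\<close> is the condition under which a homotopy can be continued,
    \<open>T\<close> the relation between two consecutive components.\<close>
  define Q where "Q i h \<longleftrightarrow> h \<in> module_hom R (P i) (P (Suc i)) \<and>
    (\<forall>w\<in>carrier (P (Suc i)). \<exists>v\<in>aug_part i. d i w = d i (h (d i w)) \<oplus>\<^bsub>P i\<^esub> v)" for i h
  define T where "T i h h' \<longleftrightarrow> (\<forall>p\<in>carrier (P (Suc i)). \<exists>v\<in>aug_part (Suc i).
    p = h (d i p) \<oplus>\<^bsub>P (Suc i)\<^esub> d (Suc i) (h' p) \<oplus>\<^bsub>P (Suc i)\<^esub> v)" for i h h'
  have "\<exists>h. \<forall>i. Q i (h i) \<and> T i (h i) (h (Suc i))"
  proof (rule dependent_nat_choice)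
    obtain q0 where q0: "q0 \<in> carrier (P 0)" "\<eta> q0 = 1" using \<eta>_surj by blast
    obtain h where h: "h \<in> module_hom R (P 0) (P 1)" and ht: "\<And>p. p \<in> carrier (P 0) \<Longrightarrow>
        \<exists>t\<in>carrier R. t b0 = \<eta> p \<and> p = t \<odot>\<^bsub>P 0\<^esub> q0 \<oplus>\<^bsub>P 0\<^esub> d 0 (h p)"
      using homotopy_start[OF q0] by blast
    have "\<exists>v\<in>aug_part 0. d 0 w = d 0 (h (d 0 w)) \<oplus>\<^bsub>P 0\<^esub> v" if w: "w \<in> carrier (P (Suc 0))" for w
    proof -
      obtain t where t: "t \<in> carrier R" "t b0 = 0" "d 0 w = t \<odot>\<^bsub>P 0\<^esub> q0 \<oplus>\<^bsub>P 0\<^esub> d 0 (h (d 0 w))"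
        using ht[of "d 0 w"] w by (auto simp: \<eta>_d)
      have "h (d 0 w) \<in> carrier (P (Suc 0))" using module_hom_closed[OF h] w by simp
      then have "d 0 w = d 0 (h (d 0 w)) \<oplus>\<^bsub>P 0\<^esub> t \<odot>\<^bsub>P 0\<^esub> q0"
        using t(1,3) q0 by (metis P.a_comm P.smult_closed d.hom_closed)
      then show ?thesis using aug_smult_mem[OF t(1,2) q0(1)] by blast
    qed
    then show "\<exists>h. Q 0 h" using h by (auto simp: Q_def)
  next
    fix h i assume Q: "Q i h"
    then obtain h' where h': "h' \<in> module_hom R (P (Suc i)) (P (Suc (Suc i)))" "T i h h'"
      using homotopy_step[of h i] unfolding Q_def T_def by blast
    interpret h: abelian_group_hom "P i" "P (Suc i)" h
      using Q unfolding Q_def by (intro module_hom_group_hom[where R = R] P.left_module_axioms) auto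
    \<comment> \<open>On a boundary the term \<open>h (d i (d (Suc i) w))\<close> vanishes, and the
      relation \<open>T\<close> turns into the condition \<open>Q\<close> one degree higher.\<close>
    have "\<exists>v\<in>aug_part (Suc i). d (Suc i) w = d (Suc i) (h' (d (Suc i) w)) \<oplus>\<^bsub>P (Suc i)\<^esub> v"
      if w: "w \<in> carrier (P (Suc (Suc i)))" for w
    proof -
      have "d (Suc i) (h' (d (Suc i) w)) \<in> carrier (P (Suc i))"
        using module_hom_closed[OF h'(1)] w by simp
      moreover have "\<exists>v\<in>aug_part (Suc i). d (Suc i) w = h (d i (d (Suc i) w)) \<oplus>\<^bsub>P (Suc i)\<^esub>
          d (Suc i) (h' (d (Suc i) w)) \<oplus>\<^bsub>P (Suc i)\<^esub> v"
        using h'(2) w unfolding T_def by (meson d.hom_closed)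
      ultimately show ?thesis using w by (simp add: d_d)
    qed
    then show "\<exists>h'. Q (Suc i) h' \<and> T i h h'" using h' by (auto simp: Q_def)
  qed
  then show ?thesis unfolding Q_def T_def by blast
qed

end

section \<open>Ext\<close>

lemma quotient_module_simps:
  "carrier (quotient_module M H) = a_rcosets\<^bsub>M\<^esub> H"
  "\<zero>\<^bsub>quotient_module M H\<^esub> = H"
  "X \<oplus>\<^bsub>quotient_module M H\<^esub> Y = X <+>\<^bsub>M\<^esub> Y"
  "a \<odot>\<^bsub>quotient_module M H\<^esub> X = (\<Union>x\<in>X. H +>\<^bsub>M\<^esub> (a \<odot>\<^bsub>M\<^esub> x))"
  by (simp_all add: quotient_module_def)

lemma hom_module_simps:
  "carrier (hom_module A M N) = module_hom A M N \<inter> extensional (carrier M)"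
  "\<zero>\<^bsub>hom_module A M N\<^esub> = (\<lambda>x\<in>carrier M. \<zero>\<^bsub>N\<^esub>)"
  "f \<oplus>\<^bsub>hom_module A M N\<^esub> h = (\<lambda>x\<in>carrier M. f x \<oplus>\<^bsub>N\<^esub> h x)"
  "s \<odot>\<^bsub>hom_module A M N\<^esub> f = (\<lambda>x\<in>carrier M. (s \<odot>\<^bsub>A\<^esub> \<one>\<^bsub>A\<^esub>) \<odot>\<^bsub>N\<^esub> f x)"
  by (simp_all add: hom_module_def)

lemma base_module_simps:
  "carrier base_module = UNIV" "\<zero>\<^bsub>base_module\<^esub> = 0" "x \<oplus>\<^bsub>base_module\<^esub> y = x + y" "s \<odot>\<^bsub>base_module\<^esub> x = s * x"
  by (simp_all add: base_module_def)

lemma base_ring_simps: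
  "carrier base_ring = UNIV" "\<zero>\<^bsub>base_ring\<^esub> = 0" "\<one>\<^bsub>base_ring\<^esub> = 1" "x \<oplus>\<^bsub>base_ring\<^esub> y = x + y" "x \<otimes>\<^bsub>base_ring\<^esub> y = x * y"
  by (simp_all add: base_ring_def)

context acyclic_resolution
begin

abbreviation "Hom i \<equiv> hom_module R (P i) N"
abbreviation "coboundary i \<equiv> (\<lambda>f. compose (carrier (P (Suc i))) f (d i))"

lemma coboundary_apply: "p \<in> carrier (P (Suc i)) \<Longrightarrow> coboundary i f p = f (d i p)"
  by (simp add: compose_def)

lemma coboundary_closed:
  assumes "f \<in> carrier (Hom i)" shows "coboundary i f \<in> carrier (Hom (Suc i))"
proof -
  have "(\<lambda>p. f (d i p)) \<in> module_hom R (P (Suc i)) N"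
    using assms by (intro module_hom_compose[OF d_hom]) (simp add: hom_module_simps)
  then have "coboundary i f \<in> module_hom R (P (Suc i)) N"
    by (rule module_hom_cong[OF P.left_module_axioms]) (simp add: coboundary_apply)
  then show ?thesis by (simp add: hom_module_simps compose_def)
qed

definition cocycles :: "nat \<Rightarrow> ('p \<Rightarrow> 'k) set" where
  "cocycles i = {f \<in> carrier (Hom i). \<forall>p\<in>carrier (P (Suc i)). f (d i p) = 0}"

lemma a_kernel_coboundary: "a_kernel (Hom i) (Hom (Suc i)) (coboundary i) = cocycles i"
proof -
  have "coboundary i f = \<zero>\<^bsub>Hom (Suc i)\<^esub> \<longleftrightarrow> (\<forall>p\<in>carrier (P (Suc i)). f (d i p) = 0)" for f
    by (auto simp: hom_module_simps compose_def fun_eq_iff restrict_def)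
  then show ?thesis by (auto simp: a_kernel_def kernel_def cocycles_def)
qed

lemma cocycle_add:
  assumes "f \<in> cocycles i" "h \<in> cocycles i" shows "f \<oplus>\<^bsub>Hom i\<^esub> h \<in> cocycles i"
proof -
  have "(\<lambda>p. f p + h p) \<in> module_hom R (P i) N"
    using assms by (auto simp: cocycles_def hom_module_simps module_hom_def algebra_simps)
  then have "f \<oplus>\<^bsub>Hom i\<^esub> h \<in> module_hom R (P i) N"
    by (rule module_hom_cong[OF P.left_module_axioms]) (simp add: hom_module_simps)
  then show ?thesis using assms by (simp add: cocycles_def hom_module_simps)
qed

lemma cocycle_smult:
  assumes "f \<in> cocycles i" shows "s \<odot>\<^bsub>Hom i\<^esub> f \<in> cocycles i"
proof -
  have "(\<lambda>p. s * f p) \<in> module_hom R (P i) N"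
    using assms by (auto simp: cocycles_def hom_module_simps module_hom_def algebra_simps)
  then have "s \<odot>\<^bsub>Hom i\<^esub> f \<in> module_hom R (P i) N"
    by (rule module_hom_cong[OF P.left_module_axioms])
       (simp add: hom_module_simps scalar_base[unfolded scalar_def])
  then show ?thesis using assms by (simp add: cocycles_def hom_module_simps)
qed

text \<open>A cocycle \<open>f\<close> vanishes on boundaries, and as a homomorphism to the trivial
  module it vanishes on the augmentation part. Applied to the homotopy identity it gives
  \<open>f p = f (h j (d j p))\<close>, so \<open>f\<close> is the coboundary of its composite with
  \<open>h j\<close>.\<close>

lemma Ext_pos:
  assumes "i > 0" shows "carrier (Ext R P d N i) = {\<zero>\<^bsub>Ext R P d N i\<^esub>}"
proof -
  obtain j where j: "i = Suc j" using assms by (cases i) auto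
  obtain h where h: "\<And>i. h i \<in> module_hom R (P i) (P (Suc i))"
    and ht: "\<And>i p. p \<in> carrier (P (Suc i)) \<Longrightarrow> \<exists>v\<in>aug_part (Suc i).
      p = h i (d i p) \<oplus>\<^bsub>P (Suc i)\<^esub> d (Suc i) (h (Suc i) p) \<oplus>\<^bsub>P (Suc i)\<^esub> v"
    using homotopy_exists by blast
  have "f \<in> coboundary j ` carrier (Hom j)" if f: "f \<in> cocycles i" for f
  proof (rule image_eqI)
    have fh: "f \<in> module_hom R (P (Suc j)) N" using f by (simp add: cocycles_def hom_module_simps j)
    have "(\<lambda>p. f (h j p)) \<in> module_hom R (P j) N" by (rule module_hom_compose[OF h fh])
    then have "restrict (\<lambda>p. f (h j p)) (carrier (P j)) \<in> module_hom R (P j) N"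
      by (rule module_hom_cong[OF P.left_module_axioms]) simp
    then show "restrict (\<lambda>p. f (h j p)) (carrier (P j)) \<in> carrier (Hom j)"
      by (simp add: hom_module_simps)
    show "f = coboundary j (restrict (\<lambda>p. f (h j p)) (carrier (P j)))"
    proof
      fix p
      show "f p = coboundary j (restrict (\<lambda>p. f (h j p)) (carrier (P j))) p"
      proof (cases "p \<in> carrier (P (Suc j))")
        case True
        obtain v where v: "v \<in> aug_part (Suc j)"
          "p = h j (d j p) \<oplus>\<^bsub>P (Suc j)\<^esub> d (Suc j) (h (Suc j) p) \<oplus>\<^bsub>P (Suc j)\<^esub> v"
          using ht[OF True] by blast
        have cl: "h j (d j p) \<in> carrier (P (Suc j))" "h (Suc j) p \<in> carrier (P (Suc (Suc j)))"
          using True module_hom_closed[OF h] by auto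
        have "f p = f (h j (d j p)) + f (d (Suc j) (h (Suc j) p)) + f v"
          using cl part_carrier[OF v(1)] by (subst v(2)) (simp add: module_hom_add[OF fh])
        also have "\<dots> = f (h j (d j p))"
          using f cl(2) hom_aug_part[OF fh v(1)] by (simp add: cocycles_def j)
        finally show ?thesis using True by (simp add: coboundary_apply)
      next
        case False
        then show ?thesis using f by (simp add: cocycles_def hom_module_simps j extensional_def compose_def)
      qed
    qed
  qed
  moreover have "coboundary j f \<in> cocycles i" if f: "f \<in> carrier (Hom j)" for f
  proof -
    have fh: "f \<in> module_hom R (P j) N" using f by (simp add: hom_module_simps)
    have "f \<zero>\<^bsub>P j\<^esub> = 0" using hom_aug_part[OF fh part_zero] .
    then show ?thesis
      using coboundary_closed[OF f] by (simp add: cocycles_def j coboundary_apply d_d)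
  qed
  ultimately have KH: "coboundary j ` carrier (Hom j) = cocycles i" by blast
  \<comment> \<open>The quotient is by the full group of cocycles, so its only coset is that group;
    differences are formed with the scalar \<open>- 1\<close>.\<close>
  have coset: "(\<Union>f\<in>cocycles i. {f \<oplus>\<^bsub>Hom i\<^esub> k}) = cocycles i" if k: "k \<in> cocycles i" for k
  proof (intro equalityI subsetI)
    fix f assume f: "f \<in> cocycles i"
    define f' where "f' = f \<oplus>\<^bsub>Hom i\<^esub> ((- 1) \<odot>\<^bsub>Hom i\<^esub> k)"
    have "f' \<in> cocycles i" unfolding f'_def using f k by (intro cocycle_add cocycle_smult)
    moreover have "f = f' \<oplus>\<^bsub>Hom i\<^esub> k"
    proof
      fix p show "f p = (f' \<oplus>\<^bsub>Hom i\<^esub> k) p"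
        using f scalar_base[unfolded scalar_def, of "- 1"]
        by (cases "p \<in> carrier (P i)") (simp_all add: f'_def hom_module_simps cocycles_def extensional_def)
    qed
    ultimately show "f \<in> (\<Union>f\<in>cocycles i. {f \<oplus>\<^bsub>Hom i\<^esub> k})" by blast
  qed (use cocycle_add k in auto)
  have "0 \<odot>\<^bsub>Hom i\<^esub> (\<lambda>x\<in>carrier (P i). 0) \<in> cocycles i"
    by (rule cocycle_smult) (auto simp: cocycles_def hom_module_simps module_hom_def P.smult_closed)
  then have K: "cocycles i \<noteq> {}" by blast
  have "Ext R P d N i = quotient_module ((Hom i)\<lparr>carrier := cocycles i\<rparr>) (cocycles i)"
    unfolding Ext_def cohomology_def a_kernel_coboundary using KH by (simp add: j)
  then show ?thesis using coset K
    by (simp add: quotient_module_simps A_RCOSETS_def RCOSETS_def r_coset_def)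
qed

text \<open>By the degree-0 homotopy every \<open>p\<close> is \<open>t\<close> times
  \<open>q0\<close> plus a boundary, so a cocycle \<open>f\<close> satisfies
  \<open>f p = \<eta> p * f q0\<close> and is determined by its value at \<open>q0\<close>. There
  are no nonzero coboundaries in degree 0, so the classes are singletons and evaluation at
  \<open>q0\<close> is the isomorphism.\<close>

lemma Ext_zero: "module_isomorphic base_ring (Ext R P d N 0) base_module"
proof -
  let ?E = "Ext R P d N 0"
  obtain q0 where q0: "q0 \<in> carrier (P 0)" "\<eta> q0 = 1" using \<eta>_surj by blast
  obtain h where h: "h \<in> module_hom R (P 0) (P 1)" and ht: "\<And>p. p \<in> carrier (P 0) \<Longrightarrow>
      \<exists>t\<in>carrier R. t b0 = \<eta> p \<and> p = t \<odot>\<^bsub>P 0\<^esub> q0 \<oplus>\<^bsub>P 0\<^esub> d 0 (h p)"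
    using homotopy_start[OF q0] by blast
  define M where "M = (Hom 0)\<lparr>carrier := cocycles 0\<rparr>"
  have E: "?E = quotient_module M {\<zero>\<^bsub>Hom 0\<^esub>}"
    unfolding Ext_def cohomology_def a_kernel_coboundary M_def by simp
  have coset: "{\<zero>\<^bsub>Hom 0\<^esub>} +>\<^bsub>M\<^esub> f = {f}" if "f \<in> cocycles 0" for f
    using that by (auto simp: a_r_coset_def r_coset_def M_def hom_module_simps cocycles_def
        extensional_def fun_eq_iff)
  have carr: "carrier (?E) = (\<lambda>f. {f}) ` cocycles 0"
    using coset by (auto simp: E quotient_module_simps A_RCOSETS_def RCOSETS_def a_r_coset_def M_def)
  have val: "f p = \<eta> p * f q0" if f: "f \<in> cocycles 0" and p: "p \<in> carrier (P 0)" for f p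
  proof -
    have fh: "f \<in> module_hom R (P 0) N" using f by (simp add: cocycles_def hom_module_simps)
    obtain t where t: "t \<in> carrier R" "t b0 = \<eta> p" "p = t \<odot>\<^bsub>P 0\<^esub> q0 \<oplus>\<^bsub>P 0\<^esub> d 0 (h p)"
      using ht[OF p] by blast
    have hp: "h p \<in> carrier (P (Suc 0))" using module_hom_closed[OF h p] by simp
    have "f p = f (t \<odot>\<^bsub>P 0\<^esub> q0 \<oplus>\<^bsub>P 0\<^esub> d 0 (h p))" using t(3) by simp
    also have "\<dots> = \<eta> p * f q0"
      using t(1,2) f q0 hp by (simp add: module_hom_add[OF fh] module_hom_smult[OF fh] P.smult_closed cocycles_def)
    finally show ?thesis .
  qed
  have "(\<lambda>X. the_elem X q0) \<in> module_hom base_ring (?E) base_module"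
    unfolding module_hom_def
  proof (intro CollectI conjI ballI funcsetI)
    fix X Y assume "X \<in> carrier (?E)" "Y \<in> carrier (?E)"
    then obtain f k where fk: "f \<in> cocycles 0" "k \<in> cocycles 0" "X = {f}" "Y = {k}" using carr by auto
    have "X \<oplus>\<^bsub>?E\<^esub> Y = {f \<oplus>\<^bsub>Hom 0\<^esub> k}"
      by (simp add: E quotient_module_simps fk set_add_def set_mult_def M_def)
    then show "the_elem (X \<oplus>\<^bsub>?E\<^esub> Y) q0 = the_elem X q0 \<oplus>\<^bsub>base_module\<^esub> the_elem Y q0"
      using q0 by (simp add: fk base_module_simps hom_module_simps)
  next
    fix s X assume "X \<in> carrier (?E)"
    then obtain f where f: "f \<in> cocycles 0" "X = {f}" using carr by auto
    have "s \<odot>\<^bsub>?E\<^esub> X = {\<zero>\<^bsub>Hom 0\<^esub>} +>\<^bsub>M\<^esub> (s \<odot>\<^bsub>Hom 0\<^esub> f)"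
      by (simp add: E quotient_module_simps f M_def)
    then have "s \<odot>\<^bsub>?E\<^esub> X = {s \<odot>\<^bsub>Hom 0\<^esub> f}" using coset[OF cocycle_smult[OF f(1)]] by simp
    then show "the_elem (s \<odot>\<^bsub>?E\<^esub> X) q0 = s \<odot>\<^bsub>base_module\<^esub> the_elem X q0"
      using q0 scalar_base[unfolded scalar_def] by (simp add: f base_module_simps hom_module_simps)
  qed (simp add: base_module_simps)
  moreover have "inj_on (\<lambda>X. the_elem X q0) (carrier (?E))"
  proof (rule inj_onI)
    fix X Y assume "X \<in> carrier (?E)" "Y \<in> carrier (?E)"
      and eq: "the_elem X q0 = the_elem Y q0"
    then obtain f k where fk: "f \<in> cocycles 0" "k \<in> cocycles 0" "X = {f}" "Y = {k}" using carr by auto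
    have "f p = k p" for p
    proof (cases "p \<in> carrier (P 0)")
      case True
      then show ?thesis using val[OF fk(1) True] val[OF fk(2) True] eq fk by simp
    next
      case False
      then show ?thesis using fk by (simp add: cocycles_def hom_module_simps extensional_def)
    qed
    then show "X = Y" using fk by auto
  qed
  moreover have "s \<in> (\<lambda>X. the_elem X q0) ` carrier (?E)" for s
  proof -
    \<comment> \<open>The preimage of \<open>s\<close> is the multiple of \<open>\<eta>\<close> by
      \<open>s\<close>, cut down to the carrier because cochains are extensional.\<close>
    define f where "f = (\<lambda>p\<in>carrier (P 0). s * \<eta> p)"
    have "f \<in> module_hom R (P 0) N"
      by (auto simp: f_def module_hom_def \<eta>_add \<eta>_smult algebra_simps P.smult_closed)
    then have "f \<in> cocycles 0" by (simp add: cocycles_def hom_module_simps f_def \<eta>_d)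
    moreover have "f q0 = s" using q0 by (simp add: f_def)
    ultimately show "s \<in> (\<lambda>X. the_elem X q0) ` carrier (?E)"
      by (intro image_eqI[of _ _ "{f}"]) (auto simp: carr)
  qed
  ultimately show ?thesis unfolding module_isomorphic_def
    by (intro bexI[where x = "\<lambda>X. the_elem X q0"]) (auto simp: bij_betw_def base_module_simps)
qed

end

section \<open>Tor\<close>

lemma ring_base_ring: "ring (base_ring :: 'k::{comm_ring, comm_monoid_mult} ring)"
proof (rule ringI)
  show "abelian_group (base_ring :: 'k ring)"
  proof (rule abelian_groupI)
    fix x :: 'k
    show "\<exists>y\<in>carrier base_ring. y \<oplus>\<^bsub>base_ring\<^esub> x = \<zero>\<^bsub>base_ring\<^esub>"
      by (intro bexI[of _ "- x"]) (simp_all add: base_ring_simps)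
  qed (simp_all add: base_ring_simps algebra_simps)
  show "Group.monoid (base_ring :: 'k ring)"
    by (rule monoidI) (simp_all add: base_ring_simps algebra_simps)
qed (simp_all add: base_ring_simps algebra_simps)

lemma finsum_free_module_apply:
  fixes f :: "'y \<Rightarrow> 'x \<Rightarrow> 'k::{comm_ring, comm_monoid_mult}"
  assumes "finite S" "\<And>q. q \<in> S \<Longrightarrow> f q \<in> carrier (free_module base_ring A)"
  shows "finsum (free_module base_ring A) f S z = (\<Sum>q\<in>S. f q z)"
proof -
  interpret F: left_module base_ring "free_module base_ring A :: ('k, 'x \<Rightarrow> 'k) module"
    by (rule left_module_free_module[OF ring_base_ring])
  show ?thesis using assms
  proof (induction S)
    case empty
    then show ?case by (simp add: free_module_simps base_ring_simps)
  next
    case (insert q S)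
    then have "f \<in> S \<rightarrow> carrier (free_module base_ring A)" "f q \<in> carrier (free_module base_ring A)" by auto
    then have "finsum (free_module base_ring A) f (insert q S) =
        f q \<oplus>\<^bsub>free_module base_ring A\<^esub> finsum (free_module base_ring A) f S"
      using insert.hyps by (intro F.finsum_insert)
    then show ?case using insert by (simp add: free_module_simps(3) base_ring_simps)
  qed
qed

lemma submodule_free_moduleD:
  fixes H :: "('x \<Rightarrow> 'k::{comm_ring, comm_monoid_mult}) set"
  assumes "submodule H base_ring (free_module base_ring A)"
  shows "f \<in> H \<Longrightarrow> f \<in> carrier (free_module base_ring A)" "(\<lambda>q. 0) \<in> H"
    "f \<in> H \<Longrightarrow> h \<in> H \<Longrightarrow> (\<lambda>q. f q + h q) \<in> H" "f \<in> H \<Longrightarrow> (\<lambda>q. s * f q) \<in> H"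
    "f \<in> H \<Longrightarrow> h \<in> H \<Longrightarrow> (\<lambda>q. f q - h q) \<in> H"
proof -
  interpret submodule H base_ring "free_module base_ring A" by fact
  show "f \<in> H \<Longrightarrow> f \<in> carrier (free_module base_ring A)" for f using mem_carrier by simp
  show "(\<lambda>q. 0) \<in> H" using one_closed by (simp add: free_module_simps base_ring_simps)
  show add: "f \<in> H \<Longrightarrow> h \<in> H \<Longrightarrow> (\<lambda>q. f q + h q) \<in> H" for f h
    using m_closed[of f h] by (simp add: free_module_simps base_ring_simps)
  show smult: "f \<in> H \<Longrightarrow> (\<lambda>q. s * f q) \<in> H" for f s
    using smult_closed[of s f] by (simp add: free_module_simps base_ring_simps)
  show "f \<in> H \<Longrightarrow> h \<in> H \<Longrightarrow> (\<lambda>q. f q - h q) \<in> H"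
    using add[of f "\<lambda>q. - 1 * h q"] smult[of h "- 1"] by simp
qed

lemma submoduleI_left_module:
  assumes "ring A" "left_module A M" "H \<subseteq> carrier M" "\<zero>\<^bsub>M\<^esub> \<in> H"
    "\<And>x y. x \<in> H \<Longrightarrow> y \<in> H \<Longrightarrow> x \<oplus>\<^bsub>M\<^esub> y \<in> H" "\<And>a x. a \<in> carrier A \<Longrightarrow> x \<in> H \<Longrightarrow> a \<odot>\<^bsub>M\<^esub> x \<in> H"
  shows "submodule H A M"
proof -
  interpret A: ring A by fact
  interpret M: left_module A M by fact
  have "\<ominus>\<^bsub>M\<^esub> x \<in> H" if "x \<in> H" for x
  proof -
    have x: "x \<in> carrier M" using that assms(3) by blast
    have "(\<ominus>\<^bsub>A\<^esub> \<one>\<^bsub>A\<^esub>) \<odot>\<^bsub>M\<^esub> x \<oplus>\<^bsub>M\<^esub> x = ((\<ominus>\<^bsub>A\<^esub> \<one>\<^bsub>A\<^esub>) \<oplus>\<^bsub>A\<^esub> \<one>\<^bsub>A\<^esub>) \<odot>\<^bsub>M\<^esub> x"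
      using x by (simp add: M.smult_l_distr M.smult_one)
    also have "\<dots> = \<zero>\<^bsub>M\<^esub>" using x by (simp add: A.l_neg left_module_smult_zero[OF assms(1,2)])
    finally have "\<ominus>\<^bsub>M\<^esub> x = (\<ominus>\<^bsub>A\<^esub> \<one>\<^bsub>A\<^esub>) \<odot>\<^bsub>M\<^esub> x"
      using x by (intro M.minus_equality M.smult_closed) auto
    then show ?thesis using that assms(6) by simp
  qed
  then show ?thesis
    using assms(3-6) unfolding submodule_def submodule_axioms_def
    by (auto intro!: M.add.subgroupI simp: a_inv_def[symmetric])
qed

section \<open>The relations of the tensor product, by evaluation in the resolution\<close>

context acyclic_resolution
begin

abbreviation "Free i \<equiv> free_module (base_ring :: 'k ring) (carrier (P i) \<times> (UNIV :: 'k set))"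
abbreviation "e \<equiv> free_basis (base_ring :: 'k ring)"
abbreviation "K i \<equiv> tensor_kernel R (P i) N"

lemma e_apply: "e q = (\<lambda>z. if z = q then 1 else 0)"
  by (rule ext) (simp add: free_basis_def base_ring_simps)

lemma e_carrier: "p \<in> carrier (P i) \<Longrightarrow> e (p, y) \<in> carrier (Free i)"
  by (rule free_basis_carrier[OF ring_base_ring]) simp

sublocale Free: left_module "base_ring :: 'k ring" "Free i" for i
  by (rule left_module_free_module[OF ring_base_ring])

text \<open>Restriction of scalars along \<open>scalar\<close>, so that linear extension over
  \<open>base_ring\<close> can take values in \<open>P i\<close>.\<close>

definition scalars :: "nat \<Rightarrow> ('k, 'p) module" where
  "scalars i = \<lparr>carrier = carrier (P i), mult = undefined, one = undefined, zero = \<zero>\<^bsub>P i\<^esub>,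
     add = (\<oplus>\<^bsub>P i\<^esub>), smult = (\<lambda>s p. scalar s \<odot>\<^bsub>P i\<^esub> p)\<rparr>"

lemma scalars_simps [simp]:
  "carrier (scalars i) = carrier (P i)" "\<zero>\<^bsub>scalars i\<^esub> = \<zero>\<^bsub>P i\<^esub>"
  "x \<oplus>\<^bsub>scalars i\<^esub> y = x \<oplus>\<^bsub>P i\<^esub> y" "s \<odot>\<^bsub>scalars i\<^esub> x = scalar s \<odot>\<^bsub>P i\<^esub> x"
  by (simp_all add: scalars_def)

lemma scalar_add: "scalar (s + t) = scalar s \<oplus> scalar t"
  by (simp add: scalar_eq add_R distrib_right)

lemma scalar_mult: "scalar (s * t) = scalar s \<otimes> scalar t"
  using l_one[OF one_closed] by (simp add: scalar_eq mult_scalar_l mult_scalar_r mult.assoc)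

lemma scalar_one: "scalar 1 = \<one>"
  by (simp add: scalar_eq)

lemma left_module_scalars: "left_module base_ring (scalars i)"
proof (intro left_module.intro abelian_groupI left_module_axioms.intro)
  fix x assume "x \<in> carrier (scalars i)"
  then show "\<exists>y\<in>carrier (scalars i). y \<oplus>\<^bsub>scalars i\<^esub> x = \<zero>\<^bsub>scalars i\<^esub>"
    by (intro bexI[of _ "\<ominus>\<^bsub>P i\<^esub> x"]) (simp_all add: P.l_neg)
qed (simp_all add: base_ring_simps P.a_ac scalar_add scalar_mult scalar_one
    scalar_closed P.smult_closed P.smult_l_distr P.smult_r_distr P.smult_assoc P.smult_one)

text \<open>It sends the generator for the tensor of \<open>p\<close> and \<open>y\<close> to
  \<open>y\<close> times \<open>p\<close>, and represents the isomorphism from the tensor product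
  with the trivial module to \<open>P i\<close> modulo its augmentation part. The map becomes
  balanced over the algebra only after passing to that quotient.\<close>

definition eval :: "nat \<Rightarrow> ('p \<times> 'k \<Rightarrow> 'k) \<Rightarrow> 'p" where
  "eval i = linear_extension base_ring (scalars i) (\<lambda>(p, y). scalar y \<odot>\<^bsub>P i\<^esub> p)"

lemma eval_hom: "eval i \<in> module_hom base_ring (Free i) (scalars i)"
  unfolding eval_def
  by (intro linear_extension_hom ring_base_ring left_module_scalars)
     (auto simp: P.smult_closed scalar_closed)

sublocale eval: abelian_group_hom "Free i" "P i" "eval i" for i
  using module_hom_closed[OF eval_hom] module_hom_add[OF eval_hom]
  by (intro abelian_group_homI' P.abelian_group_axioms Free.abelian_group_axioms) auto

lemma eval_smult: "t \<in> carrier (Free i) \<Longrightarrow> eval i (s \<odot>\<^bsub>Free i\<^esub> t) = scalar s \<odot>\<^bsub>P i\<^esub> eval i t"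
  using module_hom_smult[OF eval_hom, of s t i] by (simp add: base_ring_simps)

lemma eval_basis: "p \<in> carrier (P i) \<Longrightarrow> eval i (e (p, y)) = scalar y \<odot>\<^bsub>P i\<^esub> p"
  unfolding eval_def
  by (subst linear_extension_basis[where A = "carrier (P i) \<times> UNIV"])
     (auto intro!: ring_base_ring left_module_scalars simp: P.smult_closed scalar_closed)

lemma eval_basis_one: "p \<in> carrier (P i) \<Longrightarrow> eval i (e (p, 1)) = p"
  by (simp add: eval_basis scalar_one P.smult_one)

text \<open>The right-hand side is a \<open>k\<close>-submodule, so only the four kinds of relations
  have to be evaluated. The additivity and scalar relations evaluate to zero; the balancing relation
  evaluates to a multiple by an element of augmentation zero.\<close>

lemma tensor_kernel_subset: "K i \<subseteq> {t \<in> carrier (Free i). eval i t \<in> aug_part i}"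
proof -
  let ?H = "{t \<in> carrier (Free i). eval i t \<in> aug_part i}"
  have sub: "submodule ?H base_ring (Free i)"
  proof (rule submoduleI_left_module[OF ring_base_ring Free.left_module_axioms])
    show "s \<odot>\<^bsub>Free i\<^esub> t \<in> ?H" if "s \<in> carrier base_ring" "t \<in> ?H" for s t
      using that by (simp add: eval_smult aug_part_smult scalar_closed Free.smult_closed)
  qed (auto simp: part_zero part_add)
  \<comment> \<open>Relations are written as pointwise differences; this brings each of them into
    the form \<open>u - v\<close> with \<open>u\<close> and \<open>v\<close> in the free module, so
    that additivity of \<open>eval\<close> applies.\<close>
  have mem: "t \<in> ?H" if "u \<in> carrier (Free i)" "v \<in> carrier (Free i)" "t = (\<lambda>q. u q - v q)"
    "eval i u \<ominus>\<^bsub>P i\<^esub> eval i v \<in> aug_part i" for t u v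
  proof -
    have tv: "t \<oplus>\<^bsub>Free i\<^esub> v = u" using that(3) by (simp add: free_module_simps base_ring_simps)
    have "{q. t q \<noteq> 0} \<subseteq> {q. u q \<noteq> 0} \<union> {q. v q \<noteq> 0}" using that(3) by auto
    then have t: "t \<in> carrier (Free i)"
      using that(1-3) by (auto simp: free_module_simps base_ring_simps intro: finite_subset)
    then have "eval i t \<oplus>\<^bsub>P i\<^esub> eval i v = eval i u" using tv that(2) by (metis eval.hom_add)
    then have "eval i t = eval i u \<ominus>\<^bsub>P i\<^esub> eval i v"
      using t that(1,2) by (metis P.add.inv_solve_right a_minus_def eval.hom_closed)
    then show ?thesis using t that(4) by simp
  qed
  have "tensor_relations R (P i) N \<subseteq> ?H"
  proof
    fix t assume "t \<in> tensor_relations R (P i) N"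
    then consider x x' y where "x \<in> carrier (P i)" "x' \<in> carrier (P i)"
        "t = (\<lambda>q. e (x \<oplus>\<^bsub>P i\<^esub> x', y) q - e (x, y) q - e (x', y) q)"
      | x y y' where "x \<in> carrier (P i)" "t = (\<lambda>q. e (x, y + y') q - e (x, y) q - e (x, y') q)"
      | a x y where "a \<in> carrier R" "x \<in> carrier (P i)"
        "t = (\<lambda>q. e (a \<odot>\<^bsub>P i\<^esub> x, y) q - e (x, a b0 * y) q)"
      | s x y where "x \<in> carrier (P i)" "t = (\<lambda>q. e (scalar s \<odot>\<^bsub>P i\<^esub> x, y) q - s * e (x, y) q)"
      unfolding tensor_relations_def Let_def scalar_def by auto
    then show "t \<in> ?H"
    proof cases
      case 1
      have "eval i (e (x \<oplus>\<^bsub>P i\<^esub> x', y)) \<ominus>\<^bsub>P i\<^esub> eval i (e (x, y) \<oplus>\<^bsub>Free i\<^esub> e (x', y)) = \<zero>\<^bsub>P i\<^esub>"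
        using 1(1,2) by (simp add: eval_basis e_carrier P.smult_r_distr scalar_closed P.smult_closed
            a_minus_def P.r_neg)
      then have "eval i (e (x \<oplus>\<^bsub>P i\<^esub> x', y)) \<ominus>\<^bsub>P i\<^esub> eval i (e (x, y) \<oplus>\<^bsub>Free i\<^esub> e (x', y)) \<in> aug_part i"
        using part_zero by simp
      from mem[OF _ _ _ this, of t] 1 show ?thesis
        by (simp add: e_carrier) (simp add: free_module_simps(3) base_ring_simps diff_diff_eq)
    next
      case 2
      have "eval i (e (x, y + y')) \<ominus>\<^bsub>P i\<^esub> eval i (e (x, y) \<oplus>\<^bsub>Free i\<^esub> e (x, y')) = \<zero>\<^bsub>P i\<^esub>"
        using 2(1) by (simp add: eval_basis e_carrier P.smult_l_distr scalar_add scalar_closed P.smult_closed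
            a_minus_def P.r_neg)
      then have "eval i (e (x, y + y')) \<ominus>\<^bsub>P i\<^esub> eval i (e (x, y) \<oplus>\<^bsub>Free i\<^esub> e (x, y')) \<in> aug_part i"
        using part_zero by simp
      from mem[OF _ _ _ this, of t] 2 show ?thesis
        by (simp add: e_carrier) (simp add: free_module_simps(3) base_ring_simps diff_diff_eq)
    next
      case 3
      have b: "scalar y \<otimes> a \<in> carrier R" "scalar (a b0 * y) \<in> carrier R"
        using mult_scalar(4)[OF 3(1)] by (simp_all add: scalar_closed)
      have "eval i (e (a \<odot>\<^bsub>P i\<^esub> x, y)) \<ominus>\<^bsub>P i\<^esub> eval i (e (x, a b0 * y)) =
          (scalar y \<otimes> a \<ominus> scalar (a b0 * y)) \<odot>\<^bsub>P i\<^esub> x"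
      proof -
        interpret x: abelian_group_hom R "P i" "\<lambda>b. b \<odot>\<^bsub>P i\<^esub> x"
          using 3(2) by (intro abelian_group_homI' R.abelian_group_axioms P.abelian_group_axioms)
            (auto simp: P.smult_closed P.smult_l_distr)
        show ?thesis using 3(1,2) b
          by (simp add: eval_basis P.smult_closed scalar_closed a_minus_def P.smult_assoc)
      qed
      moreover have "(scalar y \<otimes> a \<ominus> scalar (a b0 * y)) b0 = 0"
        using b 3(1) by (simp add: a_minus_def add_R R_uminus mult_base scalar_closed
            scalar_base mult.commute)
      ultimately have "eval i (e (a \<odot>\<^bsub>P i\<^esub> x, y)) \<ominus>\<^bsub>P i\<^esub> eval i (e (x, a b0 * y)) \<in> aug_part i"
        using b 3(2) by (simp add: aug_smult_mem)
      from mem[OF _ _ _ this, of t] 3 show ?thesis by (simp add: e_carrier P.smult_closed)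
    next
      case 4
      have "eval i (e (scalar s \<odot>\<^bsub>P i\<^esub> x, y)) = eval i (s \<odot>\<^bsub>Free i\<^esub> e (x, y))"
        using 4(1) by (simp add: eval_basis eval_smult e_carrier P.smult_closed scalar_closed
            P.smult_assoc[symmetric] scalar_mult[symmetric] mult.commute)
      then have "eval i (e (scalar s \<odot>\<^bsub>P i\<^esub> x, y)) \<ominus>\<^bsub>P i\<^esub> eval i (s \<odot>\<^bsub>Free i\<^esub> e (x, y)) \<in> aug_part i"
        using 4(1) part_zero[of i "B - {b0}"]
        by (simp add: a_minus_def P.r_neg Free.smult_closed e_carrier base_ring_simps)
      from mem[OF _ _ _ this, of t] 4 show ?thesis
        by (simp add: e_carrier P.smult_closed scalar_closed Free.smult_closed base_ring_simps(1))
           (simp add: free_module_simps(4) base_ring_simps)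
    qed
  qed
  then show ?thesis using sub unfolding tensor_kernel_def N_simps by blast
qed

text \<open>Modulo any submodule \<open>H\<close> containing the relations, \<open>t\<close> is
  congruent to the single generator \<open>e (eval i t, 1)\<close>. That generator lies in
  \<open>H\<close>, because for \<open>a\<close> of augmentation zero the tensor of
  \<open>a p\<close> with \<open>1\<close> equals the tensor of \<open>p\<close> with
  \<open>0\<close>.\<close>

lemma tensor_kernel_supset:
  assumes t: "t \<in> carrier (Free i)" "eval i t \<in> aug_part i" shows "t \<in> K i"
  unfolding tensor_kernel_def N_simps
proof (rule InterI, elim CollectE conjE)
  fix H assume H: "submodule H base_ring (Free i)" and rel: "tensor_relations R (P i) N \<subseteq> H"
  note HD = submodule_free_moduleD[OF H]
  note rel_def = tensor_relations_def[of R "P i" N, unfolded Let_def]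
  have rel1: "(\<lambda>q. e (x \<oplus>\<^bsub>P i\<^esub> x', y) q - e (x, y) q - e (x', y) q) \<in> H"
    if "x \<in> carrier (P i)" "x' \<in> carrier (P i)" for x x' y
    by (rule subsetD[OF rel], unfold rel_def, rule UnI1, rule UnI1, rule UnI1) (use that in auto)
  have rel2: "(\<lambda>q. e (x, y + y') q - e (x, y) q - e (x, y') q) \<in> H" if "x \<in> carrier (P i)" for x y y'
    by (rule subsetD[OF rel], unfold rel_def, rule UnI1, rule UnI1, rule UnI2) (use that in auto)
  have rel3: "(\<lambda>q. e (a \<odot>\<^bsub>P i\<^esub> x, y) q - e (x, a b0 * y) q) \<in> H"
    if "a \<in> carrier R" "x \<in> carrier (P i)" for a x y
    by (rule subsetD[OF rel], unfold rel_def, rule UnI1, rule UnI2) (use that in auto)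
  have rel4: "(\<lambda>q. e (scalar s \<odot>\<^bsub>P i\<^esub> x, y) q - s * e (x, y) q) \<in> H" if "x \<in> carrier (P i)" for s x y
    by (rule subsetD[OF rel], unfold rel_def scalar_def, rule UnI2) (use that in auto)
  define L where "L = {t \<in> carrier (Free i). (\<lambda>q. t q - e (eval i t, 1) q) \<in> H}"
  \<comment> \<open>With both summands zero the additivity relation is the negative of this
    generator, hence the factor \<open>- 1\<close>.\<close>
  have e0: "e (\<zero>\<^bsub>P i\<^esub>, y) \<in> H" for y
    using HD(4)[OF rel1[of "\<zero>\<^bsub>P i\<^esub>" "\<zero>\<^bsub>P i\<^esub>" y], of "- 1"] by simp
  have L_add: "s \<oplus>\<^bsub>Free i\<^esub> t \<in> L" if st: "s \<in> L" "t \<in> L" for s t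
  proof -
    have c: "s \<in> carrier (Free i)" "t \<in> carrier (Free i)" using st by (auto simp: L_def)
    have "(\<lambda>q. ((s q - e (eval i s, 1) q) + (t q - e (eval i t, 1) q)) -
        (e (eval i s \<oplus>\<^bsub>P i\<^esub> eval i t, 1) q - e (eval i s, 1) q - e (eval i t, 1) q)) \<in> H"
      by (rule HD(5)[OF HD(3) rel1]) (use st c in \<open>simp_all add: L_def\<close>)
    moreover have "(s \<oplus>\<^bsub>Free i\<^esub> t) q = s q + t q" for q
      by (simp add: free_module_simps(3) base_ring_simps)
    ultimately show ?thesis using c by (simp add: L_def)
  qed
  have L_basis: "s \<odot>\<^bsub>Free i\<^esub> e (p, y) \<in> L" if p: "p \<in> carrier (P i)" for s p y
  proof -
    have c: "s \<odot>\<^bsub>Free i\<^esub> e (p, y) \<in> carrier (Free i)"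
      using p by (intro Free.smult_closed e_carrier) (simp_all add: base_ring_simps)
    let ?p = "scalar y \<odot>\<^bsub>P i\<^esub> p"
    have p': "?p \<in> carrier (P i)" using p by (simp add: P.smult_closed scalar_closed)
    have ev: "eval i (s \<odot>\<^bsub>Free i\<^esub> e (p, y)) = scalar s \<odot>\<^bsub>P i\<^esub> ?p"
      using p by (simp add: eval_smult eval_basis e_carrier)
    have "(\<lambda>q. e (?p, 1) q - e (p, y) q) \<in> H"
      using rel3[OF scalar_closed p, of y 1] by (simp add: scalar_base)
    from HD(4)[OF this, of "- s"]
    have "(\<lambda>q. (- s) * (e (?p, 1) q - e (p, y) q) - (e (scalar s \<odot>\<^bsub>P i\<^esub> ?p, 1) q - s * e (?p, 1) q)) \<in> H"
      by (rule HD(5)[OF _ rel4[OF p']])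
    moreover have "(- s) * (e (?p, 1) q - e (p, y) q) - (e (scalar s \<odot>\<^bsub>P i\<^esub> ?p, 1) q - s * e (?p, 1) q)
        = (s \<odot>\<^bsub>Free i\<^esub> e (p, y)) q - e (eval i (s \<odot>\<^bsub>Free i\<^esub> e (p, y)), 1) q" for q
      unfolding ev by (simp only: free_module_simps(4) base_ring_simps) (simp add: algebra_simps)
    ultimately show ?thesis using c by (simp add: L_def)
  qed
  have "linear_extension base_ring (Free i) e t \<in> L"
    unfolding linear_extension_def
  proof (rule Free.finsum_mem)
    show "finite {x. t x \<noteq> \<zero>\<^bsub>base_ring\<^esub>}" using t(1) by (simp add: free_module_simps)
    have "\<zero>\<^bsub>Free i\<^esub> q = 0" for q by (simp add: free_module_simps(2) base_ring_simps)
    then show "\<zero>\<^bsub>Free i\<^esub> \<in> L" using HD(4)[OF e0[of 1], of "- 1"] by (simp add: L_def)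
    show "t q \<odot>\<^bsub>Free i\<^esub> e q \<in> L" if "q \<in> {x. t x \<noteq> \<zero>\<^bsub>base_ring\<^esub>}" for q
    proof -
      have "fst q \<in> carrier (P i)" using that t(1) by (cases q) (auto simp: free_module_simps(1))
      from L_basis[OF this, of "t q" "snd q"] show ?thesis by simp
    qed
    show "L \<subseteq> carrier (Free i)" by (auto simp: L_def)
  qed (rule L_add)
  then have tL: "t \<in> L" using linear_extension_free_basis[OF ring_base_ring t(1)] by simp
  \<comment> \<open>Shown to contain all multiples by elements of augmentation zero and to be closed
    under sums; the expansion of \<open>eval i t\<close> in coordinates then places it in
    \<open>M\<close>.\<close>
  define M where "M = {p \<in> carrier (P i). e (p, 1) \<in> H}"
  have M: "a \<odot>\<^bsub>P i\<^esub> p \<in> M" if a: "a \<in> carrier R" "a b0 = 0" and p: "p \<in> carrier (P i)" for a p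
  proof -
    have "e (p, 0) \<in> H" using HD(4)[OF rel2[OF p, of 0 0], of "- 1"] by simp
    from HD(3)[OF rel3[OF a(1) p, of 1] this] show ?thesis using a p by (simp add: M_def P.smult_closed)
  qed
  have "linear_extension R (P i) (g i) (\<lambda>x. c i x (eval i t)) \<in> M"
    unfolding linear_extension_def
  proof (rule P.finsum_mem)
    show "p \<oplus>\<^bsub>P i\<^esub> p' \<in> M" if pp: "p \<in> M" "p' \<in> M" for p p'
    proof -
      have "(\<lambda>q. (e (p \<oplus>\<^bsub>P i\<^esub> p', 1) q - e (p, 1) q - e (p', 1) q) + (e (p, 1) q + e (p', 1) q)) \<in> H"
        by (rule HD(3)[OF rel1 HD(3)]) (use pp in \<open>simp_all add: M_def\<close>)
      then show ?thesis using pp by (simp add: M_def)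
    qed
    show "c i x (eval i t) \<odot>\<^bsub>P i\<^esub> g i x \<in> M" for x
      using t by (intro M coord_closed g_closed) (auto simp: aug_part_iff)
  qed (use t e0 coord_finite in \<open>auto simp: M_def\<close>)
  then have "e (eval i t, 1) \<in> H" using t by (simp add: coord_expand M_def)
  from HD(3)[OF _ this, of "\<lambda>q. t q - e (eval i t, 1) q"] tL show "t \<in> H" by (simp add: L_def)
qed

lemma tensor_kernel_eq: "K i = {t \<in> carrier (Free i). eval i t \<in> aug_part i}"
  using tensor_kernel_subset tensor_kernel_supset by blast

end

section \<open>The tensor complex as the resolution modulo its augmentation part\<close>

context acyclic_resolution
begin

lemma tensor_kernel_subgroup: "abelian_subgroup (K i) (Free i)"
proof (rule abelian_subgroupI3[OF _ Free.abelian_group_axioms], rule additive_subgroupI,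
    rule Free.add.subgroupI)
  have K0: "\<zero>\<^bsub>Free i\<^esub> \<in> K i" by (simp add: tensor_kernel_eq part_zero)
  show "K i \<noteq> {}" using K0 by blast
qed (auto simp: tensor_kernel_eq a_inv_def[symmetric] part_uminus part_add)

lemmas cls_self = abelian_subgroup.a_rcos_self[OF tensor_kernel_subgroup]
  and cls_eqI = abelian_subgroup.a_repr_independence'[OF tensor_kernel_subgroup]
  and cls_mem_iff = abelian_subgroup.a_rcos_module[OF tensor_kernel_subgroup]
  and cls_const = abelian_subgroup.a_rcos_const[OF tensor_kernel_subgroup]
  and cls_mem_carrier = abelian_subgroup.a_elemrcos_carrier[OF tensor_kernel_subgroup]
  and cls_sum = abelian_subgroup.a_rcos_sum[OF tensor_kernel_subgroup]

abbreviation "cls i t \<equiv> K i +>\<^bsub>Free i\<^esub> t"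
abbreviation "T i \<equiv> tensor R (P i) N"

text \<open>From here on tensors are compared through their evaluations, so the homology computation
  can take place in the resolution.\<close>

lemma cls_eq_iff:
  assumes "s \<in> carrier (Free i)" "t \<in> carrier (Free i)"
  shows "cls i s = cls i t \<longleftrightarrow> eval i s \<ominus>\<^bsub>P i\<^esub> eval i t \<in> aug_part i"
proof -
  have "cls i s = cls i t \<longleftrightarrow> s \<in> cls i t"
  proof
    show "s \<in> cls i t" if "cls i s = cls i t" using cls_self[OF assms(1)] by (simp only: that)
    show "s \<in> cls i t \<Longrightarrow> cls i s = cls i t" by (rule cls_eqI[OF _ assms(2), symmetric])
  qed
  also have "\<dots> \<longleftrightarrow> s \<oplus>\<^bsub>Free i\<^esub> \<ominus>\<^bsub>Free i\<^esub> t \<in> K i" by (rule cls_mem_iff[OF assms(2,1)])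
  also have "\<dots> \<longleftrightarrow> eval i s \<ominus>\<^bsub>P i\<^esub> eval i t \<in> aug_part i"
    using assms by (simp add: tensor_kernel_eq a_minus_def)
  finally show ?thesis .
qed

lemma cls_eq_kernel_iff:
  assumes "t \<in> carrier (Free i)" shows "cls i t = K i \<longleftrightarrow> eval i t \<in> aug_part i"
proof
  assume "cls i t = K i"
  then have "t \<in> K i" using cls_self[OF assms] by (simp only:)
  then show "eval i t \<in> aug_part i" using tensor_kernel_subset by blast
next
  show "eval i t \<in> aug_part i \<Longrightarrow> cls i t = K i"
    using assms by (intro cls_const) (simp add: tensor_kernel_eq)
qed

lemma cls_mem:
  assumes "t \<in> carrier (Free i)" "s \<in> cls i t"
  shows "s \<in> carrier (Free i)" "cls i s = cls i t"
  using cls_mem_carrier[OF assms] cls_eqI[OF assms(2,1)] by auto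

lemma tensor_eq: "T i = quotient_module (Free i) (K i)"
  by (simp add: tensor_def)

lemma tensor_carrier: "carrier (T i) = cls i ` carrier (Free i)"
  by (auto simp: tensor_eq quotient_module_simps A_RCOSETS_def')

lemma tensor_zero: "\<zero>\<^bsub>T i\<^esub> = K i"
  by (simp add: tensor_eq quotient_module_simps)

lemma tensor_add:
  "s \<in> carrier (Free i) \<Longrightarrow> t \<in> carrier (Free i) \<Longrightarrow> cls i s \<oplus>\<^bsub>T i\<^esub> cls i t = cls i (s \<oplus>\<^bsub>Free i\<^esub> t)"
  by (simp add: tensor_eq quotient_module_simps cls_sum)

lemma Free_smult_closed: "t \<in> carrier (Free i) \<Longrightarrow> s \<odot>\<^bsub>Free i\<^esub> t \<in> carrier (Free i)"
  by (rule Free.smult_closed) (simp_all add: base_ring_simps)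

lemma tensor_smult:
  assumes t: "t \<in> carrier (Free i)"
  shows "s \<odot>\<^bsub>T i\<^esub> cls i t = cls i (s \<odot>\<^bsub>Free i\<^esub> t)"
proof -
  interpret s: abelian_group_hom "P i" "P i" "\<lambda>p. scalar s \<odot>\<^bsub>P i\<^esub> p"
    by (rule P.smult_group_hom[OF scalar_closed])
  have "cls i (s \<odot>\<^bsub>Free i\<^esub> u) = cls i (s \<odot>\<^bsub>Free i\<^esub> t)" if u: "u \<in> cls i t" for u
  proof -
    note uc = cls_mem[OF t u]
    have "scalar s \<odot>\<^bsub>P i\<^esub> (eval i u \<ominus>\<^bsub>P i\<^esub> eval i t) \<in> aug_part i"
      using uc t cls_eq_iff[OF uc(1) t] by (intro aug_part_smult scalar_closed) simp
    moreover have "scalar s \<odot>\<^bsub>P i\<^esub> (eval i u \<ominus>\<^bsub>P i\<^esub> eval i t) =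
        eval i (s \<odot>\<^bsub>Free i\<^esub> u) \<ominus>\<^bsub>P i\<^esub> eval i (s \<odot>\<^bsub>Free i\<^esub> t)"
      using uc t by (simp add: a_minus_def eval_smult)
    ultimately show ?thesis
      using uc t cls_eq_iff[OF Free_smult_closed[OF uc(1)] Free_smult_closed[OF t]] by simp
  qed
  then have "(\<Union>u\<in>cls i t. cls i (s \<odot>\<^bsub>Free i\<^esub> u)) = cls i (s \<odot>\<^bsub>Free i\<^esub> t)"
    using cls_self[OF t] by blast
  then show ?thesis by (simp add: tensor_eq quotient_module_simps)
qed

definition push :: "nat \<Rightarrow> ('p \<times> 'k \<Rightarrow> 'k) \<Rightarrow> 'p \<times> 'k \<Rightarrow> 'k" where
  "push i t = (\<lambda>(x', y). \<Sum>x | t (x, y) \<noteq> 0 \<and> d i x = x'. t (x, y))"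

text \<open>\<open>push\<close> is the formula on representatives inside \<open>tensor_map\<close>.
  As a linear extension, its compatibility with \<open>eval\<close> needs to be checked on
  generators only.\<close>

lemma push_eq:
  assumes t: "t \<in> carrier (Free (Suc i))"
  shows "push i t = linear_extension base_ring (Free i) (\<lambda>(x, y). e (d i x, y)) t"
proof
  fix z :: "'p \<times> 'k"
  obtain x' y where z: "z = (x', y)" by fastforce
  let ?S = "{q. t q \<noteq> 0}"
  have sub: "fst q \<in> carrier (P (Suc i))" if "t q \<noteq> 0" for q
    using t that by (cases q) (auto simp: free_module_simps base_ring_simps)
  have fin: "finite ?S" using t by (auto simp: free_module_simps base_ring_simps)
  have "(case q of (x, y) \<Rightarrow> e (d i x, y)) \<in> carrier (Free i)" if "q \<in> ?S" for q
    using sub[of q] that by (simp add: case_prod_beta e_carrier d.hom_closed)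
  then have cl: "t q \<odot>\<^bsub>Free i\<^esub> (case q of (x, y) \<Rightarrow> e (d i x, y)) \<in> carrier (Free i)" if "q \<in> ?S" for q
    using that by (intro Free_smult_closed)
  have "linear_extension base_ring (Free i) (\<lambda>(x, y). e (d i x, y)) t z =
      (\<Sum>q\<in>?S. (t q \<odot>\<^bsub>Free i\<^esub> (case q of (x, y) \<Rightarrow> e (d i x, y))) z)"
    unfolding linear_extension_def base_ring_simps by (rule finsum_free_module_apply[OF fin cl])
  also have "\<dots> = (\<Sum>q\<in>?S. if d i (fst q) = x' \<and> snd q = y then t q else 0)"
    by (intro sum.cong refl) (auto simp: free_module_simps base_ring_simps e_apply z case_prod_beta)
  also have "\<dots> = (\<Sum>q\<in>{q \<in> ?S. d i (fst q) = x' \<and> snd q = y}. t q)"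
    by (rule sum.inter_filter[OF fin, symmetric])
  also have "\<dots> = (\<Sum>x | t (x, y) \<noteq> 0 \<and> d i x = x'. t (x, y))"
    by (rule sum.reindex_bij_witness[of _ "\<lambda>x. (x, y)" fst]) auto
  finally show "push i t z = linear_extension base_ring (Free i) (\<lambda>(x, y). e (d i x, y)) t z"
    by (simp add: push_def z)
qed

lemma push_target: "(\<lambda>(x, y). e (d i x, y)) \<in> carrier (P (Suc i)) \<times> UNIV \<rightarrow> carrier (Free i)"
  by (auto intro: e_carrier)

lemma push_closed: "t \<in> carrier (Free (Suc i)) \<Longrightarrow> push i t \<in> carrier (Free i)"
  using module_hom_closed[OF linear_extension_hom[OF ring_base_ring Free.left_module_axioms push_target]]
  by (simp add: push_eq)

lemma eval_push:
  assumes t: "t \<in> carrier (Free (Suc i))"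
  shows "eval i (push i t) = d i (eval (Suc i) t)"
proof -
  interpret S: left_module base_ring "scalars i" by (rule left_module_scalars)
  have dh: "d i \<in> module_hom base_ring (scalars (Suc i)) (scalars i)"
    by (auto simp: module_hom_def d_smult scalar_closed)
  have supp: "x \<in> carrier (P (Suc i))" if "t (x, y) \<noteq> 0" for x y
    using t that by (auto simp: free_module_simps base_ring_simps)
  have w: "(\<lambda>(p, y). scalar y \<odot>\<^bsub>P (Suc i)\<^esub> p) \<in> carrier (P (Suc i)) \<times> UNIV \<rightarrow> carrier (scalars (Suc i))"
    by (auto simp: P.smult_closed scalar_closed)
  have "eval i (push i t) =
      linear_extension base_ring (scalars i) (\<lambda>q. eval i (case q of (x, y) \<Rightarrow> e (d i x, y))) t"
    unfolding push_eq[OF t]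
    by (rule hom_linear_extension[OF ring_base_ring Free.left_module_axioms left_module_scalars
          eval_hom push_target t])
  also have "\<dots> = linear_extension base_ring (scalars i)
      (\<lambda>q. d i (case q of (p, y) \<Rightarrow> scalar y \<odot>\<^bsub>P (Suc i)\<^esub> p)) t"
    unfolding linear_extension_def
    by (rule S.finsum_cong')
       (auto simp: base_ring_simps eval_basis d_smult scalar_closed P.smult_closed dest!: supp)
  also have "\<dots> = d i (eval (Suc i) t)"
    unfolding eval_def[of "Suc i"]
    by (rule hom_linear_extension[OF ring_base_ring left_module_scalars left_module_scalars dh w t, symmetric])
  finally show ?thesis .
qed

lemma tensor_map_cls:
  assumes t: "t \<in> carrier (Free (Suc i))"
  shows "tensor_map R (P i) N (d i) (cls (Suc i) t) = cls i (push i t)"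
proof -
  have "cls i (push i u) = cls i (push i t)" if u: "u \<in> cls (Suc i) t" for u
  proof -
    note uc = cls_mem[OF t u]
    have "d i (eval (Suc i) u \<ominus>\<^bsub>P (Suc i)\<^esub> eval (Suc i) t) \<in> aug_part i"
      using uc cls_eq_iff[OF uc(1) t] by (intro acyclic_part_d[OF acyclic]) simp
    then have "d i (eval (Suc i) u) \<ominus>\<^bsub>P i\<^esub> d i (eval (Suc i) t) \<in> aug_part i"
      using uc t by (simp add: a_minus_def)
    then show ?thesis using uc t by (simp add: cls_eq_iff push_closed eval_push)
  qed
  then have "(\<Union>u\<in>cls (Suc i) t. cls i (push i u)) = cls i (push i t)"
    using cls_self[OF t] by blast
  then show ?thesis unfolding tensor_map_def N_simps push_def .
qed

text \<open>The class of \<open>t\<close> is a cycle when \<open>d j (eval i t)\<close> lies in the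
  augmentation part. By acyclicity this boundary is also that of some \<open>w\<close> in the
  augmentation part, so \<open>eval i t\<close> minus \<open>w\<close> is a true cycle and equals
  some \<open>d i z\<close>. Modulo the augmentation part \<open>eval i t\<close> is then a
  boundary.\<close>

lemma Tor_pos:
  assumes "i > 0" shows "carrier (Tor R P d N i) = {\<zero>\<^bsub>Tor R P d N i\<^esub>}"
proof -
  obtain j where j: "i = Suc j" using assms by (cases i) auto
  define Z where "Z = cls i ` {t \<in> carrier (Free i). d j (eval i t) \<in> aug_part j}"
  have "tensor_map R (P j) N (d j) (cls i t) = K j \<longleftrightarrow> d j (eval i t) \<in> aug_part j"
    if "t \<in> carrier (Free i)" for t
    using that by (simp only: j tensor_map_cls cls_eq_kernel_iff push_closed eval_push)
  then have "cycles T (\<lambda>i. tensor_map R (P i) N (d i)) i = Z"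
    unfolding j cycles.simps a_kernel_def' tensor_carrier tensor_zero Z_def by blast
  moreover have "tensor_map R (P i) N (d i) ` carrier (T (Suc i)) = Z"
  proof (intro equalityI subsetI)
    fix X assume "X \<in> tensor_map R (P i) N (d i) ` carrier (T (Suc i))"
    then obtain t where "t \<in> carrier (Free (Suc i))" "X = cls i (push i t)"
      by (auto simp: tensor_carrier tensor_map_cls)
    then show "X \<in> Z" by (auto simp: Z_def push_closed eval_push j d_d part_zero)
  next
    fix X assume "X \<in> Z"
    then obtain t where t: "t \<in> carrier (Free i)" "d j (eval i t) \<in> aug_part j" "X = cls i t"
      by (auto simp: Z_def)
    have ec: "eval i t \<in> carrier (P (Suc j))" using eval.hom_closed[OF t(1)] j by simp
    have "cycle j (d j (eval i t))"
      using d_d ec by (cases j) (auto simp: cycle_def)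
    then obtain w where w: "w \<in> aug_part i" "d j (eval i t) = d j w"
      using acyclic_part_exact[OF acyclic t(2)] j by blast
    note wc = part_carrier[OF w(1)]
    have "d j (eval i t \<ominus>\<^bsub>P i\<^esub> w) = \<zero>\<^bsub>P j\<^esub>"
      using w(2) ec wc by (simp add: a_minus_def j P.r_neg)
    then obtain z where z: "z \<in> carrier (P (Suc i))" "eval i t \<ominus>\<^bsub>P i\<^esub> w = d i z"
      using exact_Suc[of "eval i t \<ominus>\<^bsub>P i\<^esub> w" j] ec wc j by auto
    have "d i z = eval i t \<ominus>\<^bsub>P i\<^esub> w" using z(2) by simp
    then have "eval i t \<ominus>\<^bsub>P i\<^esub> d i z = w"
      using ec wc j by (simp add: a_minus_def P.minus_add P.r_neg1 P.r_neg2 P.minus_minus P.a_assoc[symmetric] P.r_neg)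
    then have "cls i t = cls i (push i (e (z, 1)))"
      \<comment> \<open>The generator at \<open>(z, 1)\<close> evaluates to \<open>z\<close>, so its
        image under \<open>push\<close> evaluates to \<open>d i z\<close>.\<close>
      using t(1) z(1) w(1) by (simp add: cls_eq_iff push_closed e_carrier eval_push eval_basis_one)
    then show "X \<in> tensor_map R (P i) N (d i) ` carrier (T (Suc i))"
      using t(3) e_carrier[OF z(1)] by (force simp: tensor_carrier tensor_map_cls[symmetric])
  qed
  ultimately have E: "Tor R P d N i = quotient_module ((T i)\<lparr>carrier := Z\<rparr>) Z"
    by (simp add: Tor_def homology_def)
  have Zadd: "X \<oplus>\<^bsub>T i\<^esub> Y \<in> Z" if "X \<in> Z" "Y \<in> Z" for X Y
    using that by (auto simp: Z_def tensor_add j part_add)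
  have coset: "(\<Union>X\<in>Z. {X \<oplus>\<^bsub>T i\<^esub> Y}) = Z" if Y: "Y \<in> Z" for Y
  proof (intro equalityI subsetI)
    fix X assume "X \<in> Z"
    then obtain s where s: "s \<in> carrier (Free i)" "d j (eval i s) \<in> aug_part j" "X = cls i s"
      by (auto simp: Z_def)
    obtain t where t: "t \<in> carrier (Free i)" "d j (eval i t) \<in> aug_part j" "Y = cls i t"
      using Y by (auto simp: Z_def)
    have "t \<oplus>\<^bsub>Free i\<^esub> (s \<ominus>\<^bsub>Free i\<^esub> t) = s" by (rule Free.add_minus_cancel[OF s(1) t(1)])
    then have "X = cls i (s \<ominus>\<^bsub>Free i\<^esub> t) \<oplus>\<^bsub>T i\<^esub> Y"
      using s t by (simp add: tensor_add Free.a_comm)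
    moreover have "cls i (s \<ominus>\<^bsub>Free i\<^esub> t) \<in> Z"
      unfolding Z_def using s t part_minus[OF s(2) t(2)] by (intro imageI) (simp add: a_minus_def j)
    ultimately show "X \<in> (\<Union>X\<in>Z. {X \<oplus>\<^bsub>T i\<^esub> Y})" by blast
  qed (use Zadd Y in auto)
  have "cls i \<zero>\<^bsub>Free i\<^esub> \<in> Z" unfolding Z_def by (intro imageI) (simp add: j part_zero)
  then have "Z \<noteq> {}" by blast
  then show ?thesis using coset
    by (simp add: E quotient_module_simps A_RCOSETS_def RCOSETS_def r_coset_def)
qed

text \<open>The composite of \<open>\<eta>\<close> and \<open>eval\<close> is constant on classes of
  tensors, and its fibres \<open>L v\<close> are the cosets of the boundaries: equal values under
  \<open>\<eta>\<close> mean a difference in the image of \<open>d 0\<close>. Homology in degree 0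
  is therefore the set of all \<open>L v\<close>, with \<open>v\<close> as the coordinate.\<close>

lemma Tor_zero: "module_isomorphic base_ring (Tor R P d N 0) base_module"
proof -
  obtain q0 where q0: "q0 \<in> carrier (P 0)" "\<eta> q0 = 1" using \<eta>_surj by blast
  define L where "L v = cls 0 ` {t \<in> carrier (Free 0). \<eta> (eval 0 t) = v}" for v
  have \<eta>_hom: "\<eta> \<in> module_hom R (P 0) N"
    by (auto simp: module_hom_def \<eta>_add \<eta>_smult)
  interpret \<eta>: abelian_group_hom "P 0" N \<eta>
    by (rule module_hom_group_hom[OF P.left_module_axioms left_module_N \<eta>_hom])
  have \<eta>_minus: "\<eta> (p \<ominus>\<^bsub>P 0\<^esub> q) = \<eta> p - \<eta> q" if "p \<in> carrier (P 0)" "q \<in> carrier (P 0)" for p q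
  proof -
    have "\<eta> (q \<oplus>\<^bsub>P 0\<^esub> (p \<ominus>\<^bsub>P 0\<^esub> q)) = \<eta> q + \<eta> (p \<ominus>\<^bsub>P 0\<^esub> q)" using that by (intro \<eta>_add) auto
    then show ?thesis using that by (simp add: P.add_minus_cancel)
  qed
  have value_eq: "\<eta> (eval 0 s) = \<eta> (eval 0 t)"
    if "s \<in> carrier (Free 0)" "t \<in> carrier (Free 0)" "cls 0 s = cls 0 t" for s t
    using that hom_aug_part[OF \<eta>_hom] \<eta>_minus[of "eval 0 s" "eval 0 t"] by (simp add: cls_eq_iff)
  \<comment> \<open>A lift \<open>q0\<close> of \<open>1\<close> makes every fibre nonempty;
    injectivity of \<open>L\<close> and the sum of two fibres both rest on these
    representatives.\<close>
  have witness: "e (q0, v) \<in> carrier (Free 0)" "\<eta> (eval 0 (e (q0, v))) = v" for v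
    using q0 by (simp_all add: e_carrier eval_basis \<eta>_smult scalar_closed scalar_base)
  have L_inj: "L v = L w \<Longrightarrow> v = w" for v w
  proof -
    assume "L v = L w"
    moreover have "cls 0 (e (q0, v)) \<in> L v" using witness by (simp add: L_def)
    ultimately obtain t where "t \<in> carrier (Free 0)" "\<eta> (eval 0 t) = w" "cls 0 (e (q0, v)) = cls 0 t"
      by (auto simp: L_def)
    then show "v = w" using value_eq[of "e (q0, v)" t] witness by simp
  qed
  have bd: "tensor_map R (P 0) N (d 0) ` carrier (T (Suc 0)) = L 0"
  proof (intro equalityI subsetI)
    fix X assume "X \<in> tensor_map R (P 0) N (d 0) ` carrier (T (Suc 0))"
    then obtain t where "t \<in> carrier (Free (Suc 0))" "X = cls 0 (push 0 t)"
      by (auto simp: tensor_carrier tensor_map_cls)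
    then show "X \<in> L 0" by (auto simp: L_def push_closed eval_push \<eta>_d)
  next
    fix X assume "X \<in> L 0"
    then obtain t where t: "t \<in> carrier (Free 0)" "\<eta> (eval 0 t) = 0" "X = cls 0 t"
      by (auto simp: L_def)
    then obtain z where z: "z \<in> carrier (P (Suc 0))" "eval 0 t = d 0 z" using exact_0[of "eval 0 t"] by auto
    then have "cls 0 t = cls 0 (push 0 (e (z, 1)))"
      using t(1) by (simp add: cls_eq_iff push_closed e_carrier eval_push eval_basis_one a_minus_def P.r_neg part_zero)
    then show "X \<in> tensor_map R (P 0) N (d 0) ` carrier (T (Suc 0))"
      using t(3) e_carrier[OF z(1)] by (force simp: tensor_carrier tensor_map_cls[symmetric])
  qed
  define H where "H = Tor R P d N 0"
  have E: "H = quotient_module (T 0) (L 0)"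
    unfolding H_def Tor_def homology_def cycles.simps bd by simp
  have coset: "L 0 +>\<^bsub>T 0\<^esub> cls 0 t = L (\<eta> (eval 0 t))" if t: "t \<in> carrier (Free 0)" for t
  proof (intro equalityI subsetI)
    fix X assume "X \<in> L 0 +>\<^bsub>T 0\<^esub> cls 0 t"
    then obtain s where s: "s \<in> carrier (Free 0)" "\<eta> (eval 0 s) = 0" "X = cls 0 s \<oplus>\<^bsub>T 0\<^esub> cls 0 t"
      by (auto simp: a_r_coset_def' L_def)
    then show "X \<in> L (\<eta> (eval 0 t))" using t
      by (auto simp: L_def tensor_add \<eta>_add intro!: imageI)
  next
    fix X assume "X \<in> L (\<eta> (eval 0 t))"
    then obtain s where s: "s \<in> carrier (Free 0)" "\<eta> (eval 0 s) = \<eta> (eval 0 t)" "X = cls 0 s"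
      by (auto simp: L_def)
    have "t \<oplus>\<^bsub>Free 0\<^esub> (s \<ominus>\<^bsub>Free 0\<^esub> t) = s" by (rule Free.add_minus_cancel[OF s(1) t])
    then have "X = cls 0 (s \<ominus>\<^bsub>Free 0\<^esub> t) \<oplus>\<^bsub>T 0\<^esub> cls 0 t"
      using s t by (simp add: tensor_add Free.a_comm)
    moreover have "\<eta> (eval 0 (s \<ominus>\<^bsub>Free 0\<^esub> t)) = 0"
      using s t \<eta>_minus[of "eval 0 s" "eval 0 t"] by (simp add: a_minus_def)
    then have "cls 0 (s \<ominus>\<^bsub>Free 0\<^esub> t) \<in> L 0" unfolding L_def using s t by (intro imageI) simp
    ultimately show "X \<in> L 0 +>\<^bsub>T 0\<^esub> cls 0 t" by (auto simp: a_r_coset_def')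
  qed
  have carr: "carrier H = range L"
  proof -
    have "carrier H = (\<lambda>t. L (\<eta> (eval 0 t))) ` carrier (Free 0)"
      by (auto simp: E quotient_module_simps A_RCOSETS_def' tensor_carrier coset)
    also have "\<dots> = L ` (\<lambda>t. \<eta> (eval 0 t)) ` carrier (Free 0)" by (simp add: image_image)
    also have "(\<lambda>t. \<eta> (eval 0 t)) ` carrier (Free 0) = UNIV" using witness by (metis UNIV_eq_I imageI)
    finally show ?thesis .
  qed
  have add: "L v \<oplus>\<^bsub>H\<^esub> L w = L (v + w)" for v w
  proof (intro equalityI subsetI)
    fix X assume "X \<in> L v \<oplus>\<^bsub>H\<^esub> L w"
    then obtain s t where st: "s \<in> carrier (Free 0)" "\<eta> (eval 0 s) = v" "t \<in> carrier (Free 0)" "\<eta> (eval 0 t) = w"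
      "X = cls 0 s \<oplus>\<^bsub>T 0\<^esub> cls 0 t"
      by (auto simp: E quotient_module_simps set_add_def' L_def)
    then show "X \<in> L (v + w)" by (auto simp: L_def tensor_add \<eta>_add intro!: imageI)
  next
    fix X assume "X \<in> L (v + w)"
    then obtain s where s: "s \<in> carrier (Free 0)" "\<eta> (eval 0 s) = v + w" "X = cls 0 s"
      by (auto simp: L_def)
    let ?t = "e (q0, v)"
    have X: "X = cls 0 ?t \<oplus>\<^bsub>T 0\<^esub> cls 0 (s \<ominus>\<^bsub>Free 0\<^esub> ?t)"
      using s witness(1) by (simp add: tensor_add Free.add_minus_cancel)
    have "\<eta> (eval 0 (s \<ominus>\<^bsub>Free 0\<^esub> ?t)) = w"
      using s witness \<eta>_minus[of "eval 0 s" "eval 0 ?t"] by (simp add: a_minus_def)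
    then have "cls 0 (s \<ominus>\<^bsub>Free 0\<^esub> ?t) \<in> L w" unfolding L_def using s witness(1) by (intro imageI) simp
    moreover have "cls 0 ?t \<in> L v" unfolding L_def using witness by (intro imageI) simp
    ultimately show "X \<in> L v \<oplus>\<^bsub>H\<^esub> L w" using X by (auto simp: E quotient_module_simps set_add_def')
  qed
  have smult: "s \<odot>\<^bsub>H\<^esub> L v = L (s * v)" for s v
  proof -
    have "L 0 +>\<^bsub>T 0\<^esub> (s \<odot>\<^bsub>T 0\<^esub> X) = L (s * v)" if X: "X \<in> L v" for X
    proof -
      obtain t where t: "t \<in> carrier (Free 0)" "\<eta> (eval 0 t) = v" "X = cls 0 t"
        using X by (auto simp: L_def)
      then show ?thesis
        by (simp add: tensor_smult coset Free_smult_closed eval_smult \<eta>_smult scalar_closed scalar_base)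
    qed
    moreover have "L v \<noteq> {}" using witness[of v] by (auto simp: L_def)
    ultimately show ?thesis by (auto simp: E quotient_module_simps)
  qed
  have inv: "inv_into UNIV L (L v) = v" for v using L_inj by (simp add: inj_def)
  have "inv_into UNIV L \<in> module_hom base_ring H base_module"
    by (auto simp: module_hom_def carr add smult inv base_module_simps)
  moreover have "bij_betw (inv_into UNIV L) (carrier H) (carrier base_module)"
    by (rule bij_betw_byWitness[where f' = L]) (auto simp: carr inv base_module_simps)
  ultimately show ?thesis unfolding module_isomorphic_def H_def by blast
qed

end

section \<open>The dilute Temperley--Lieb algebra\<close>

text \<open>The cells enter only through their intersections: the nonempty ones are acyclic by their
  idempotents and the empty one trivially, so their union, all basis elements except
  \<open>b0\<close>, is acyclic.\<close>

lemma acyclic_resolution_exists: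
  fixes R :: "('k::{comm_ring, comm_monoid_mult}, 'b \<Rightarrow> 'k) module"
    and P :: "nat \<Rightarrow> ('b \<Rightarrow> 'k, 'p) module"
  assumes "based_algebra R B b0" and "\<And>s f. s \<odot>\<^bsub>R\<^esub> f = (\<lambda>D. s * f D)"
    and res: "projective_resolution R P d \<eta> (augmentation_module b0)"
    and F: "finite F" "\<Union>F = B - {b0}"
      "\<And>T. T \<subseteq> F \<Longrightarrow> T \<noteq> {} \<Longrightarrow> \<Inter>T \<noteq> {} \<Longrightarrow> idempotent_part R b0 (\<Inter>T)"
  shows "\<exists>(c :: nat \<Rightarrow> 'p \<Rightarrow> 'p \<Rightarrow> 'b \<Rightarrow> 'k) g. acyclic_resolution R B b0 P d \<eta> c g"
proof -
  interpret based_algebra R B b0 by fact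
  have "\<forall>i. \<exists>(c :: 'p \<Rightarrow> 'p \<Rightarrow> 'b \<Rightarrow> 'k) g. dual_basis R (P i) c g"
    using res by (intro allI projective_dual_basis) (simp add: projective_resolution_def)
  then obtain c :: "nat \<Rightarrow> 'p \<Rightarrow> 'p \<Rightarrow> 'b \<Rightarrow> 'k" and g where
    "\<And>i. dual_basis R (P i) (c i) (g i)" by metis
  then interpret augmented_resolution R B b0 P d \<eta> c g using res by unfold_locales
  have "acyclic_part (\<Union>F)"
  proof (rule acyclic_part_Union[OF F(1)])
    fix T assume "T \<subseteq> F" "T \<noteq> {}"
    then show "acyclic_part (\<Inter>T)"
      using F(3) acyclic_part_idempotent acyclic_part_empty by (cases "\<Inter>T = {}") simp_all
  qed
  then have "acyclic_resolution R B b0 P d \<eta> c g" using assms(2) F(2) by unfold_locales simp_all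
  then show ?thesis by blast
qed

lemma trivial_module_eq: "trivial_module n = augmentation_module (identity_diagram n)"
  by (simp add: trivial_module_def augmentation_module_def augmentation_def)

lemma opposite_ring_simps:
  "carrier (opposite_ring A) = carrier A" "\<zero>\<^bsub>opposite_ring A\<^esub> = \<zero>\<^bsub>A\<^esub>"
  "\<one>\<^bsub>opposite_ring A\<^esub> = \<one>\<^bsub>A\<^esub>" "x \<oplus>\<^bsub>opposite_ring A\<^esub> y = x \<oplus>\<^bsub>A\<^esub> y"
  "x \<otimes>\<^bsub>opposite_ring A\<^esub> y = y \<otimes>\<^bsub>A\<^esub> x"
  by (simp_all add: opposite_ring_def)

lemma opposite_ring_smult:
  fixes A :: "('k, 'a) module"
  shows "s \<odot>\<^bsub>opposite_ring A\<^esub> x = s \<odot>\<^bsub>A\<^esub> x"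
  by (simp add: opposite_ring_def)

text \<open>An edge of the composite at \<open>Lft i\<close> forces \<open>D1\<close> to use that
  vertex, so the left support of \<open>D1\<close> is full. An edge of \<open>D1\<close> joining
  neighbours on the left would persist in the composite. The mirror image of \<open>D1\<close> thus
  has full right support and no cup, so it is the identity.\<close>

lemma composite_identity_left:
  assumes D1: "D1 \<in> diagrams n" and comp: "composite n D1 D2 = identity_diagram n"
  shows "D1 = identity_diagram n"
proof -
  have First: "i \<in> left_support D1" if "e \<in> edges3 D1 D2" "First i \<in> ends e" for e i
    using that by (auto simp: edges3_def ends_def left_support_def image_iff eq_commute[of "First i"])
  have "i \<in> left_support D1" if i: "i \<in> {1..n}" for i
  proof -
    have "{Lft i, Rgt i} \<in> composite n D1 D2" using i by (auto simp: comp identity_diagram_def)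
    then consider "connected3 D1 D2 (First i) (Last i)" | "connected3 D1 D2 (Last i) (First i)"
      by (auto simp: composite_def doubleton_eq_iff)
    then show ?thesis
    proof cases
      case 1
      then show ?thesis unfolding connected3_def
        by (cases rule: converse_rtranclpE) (use First in auto)
    next
      case 2
      then show ?thesis unfolding connected3_def
        by (cases rule: rtranclp.cases) (use First in auto)
    qed
  qed
  then have full: "right_support (mirror D1) = {1..n}" using left_support_subset[OF D1] by auto
  have "cup j \<notin> mirror D1" if j: "j \<in> {1..<n}" for j
  proof
    assume "cup j \<in> mirror D1"
    then have "{Lft j, Lft (Suc j)} \<in> D1" by (simp add: mem_mirror_iff cup_def)
    then have "Inl (left_half ` {Lft j, Lft (Suc j)}) \<in> edges3 D1 D2"
      unfolding edges3_def by (intro UnI1 imageI)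
    then have "Inl {First j, First (Suc j)} \<in> edges3 D1 D2" by simp
    then have "\<exists>e\<in>edges3 D1 D2. ends e = {First j, First (Suc j)}"
      by (rule bexI[rotated]) (simp add: ends_def)
    then have "connected3 D1 D2 (outer (Lft j)) (outer (Lft (Suc j)))"
      unfolding connected3_def outer.simps by (rule r_into_rtranclp)
    then have "{Lft j, Lft (Suc j)} \<in> composite n D1 D2"
      using j unfolding composite_def
      by (intro CollectI exI[of _ "Lft j"] exI[of _ "Lft (Suc j)"]) auto
    then show False by (auto simp: comp identity_diagram_def doubleton_eq_iff)
  qed
  then have "mirror D1 = identity_diagram n" using identity_or_cup[of "mirror D1" n] D1 full by auto
  then show ?thesis by (metis mirror_identity_diagram mirror_mirror)
qed

text \<open>This makes the augmentation multiplicative. The left factor must be the identity by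
  \<open>composite_identity_left\<close>; reflection then turns multiplication by it into the known
  right multiplication by a partial identity.\<close>

lemma diagram_product_identity:
  assumes D: "D1 \<in> diagrams n" "D2 \<in> diagrams n"
  shows "diagram_product n \<delta> D1 D2 (identity_diagram n) =
    (if D1 = identity_diagram n \<and> D2 = identity_diagram n then 1 else 0)"
proof -
  have right: "diagram_product n \<delta> D (identity_diagram n) (identity_diagram n) =
      (if D = identity_diagram n then 1 else 0)" if D: "D \<in> diagrams n" for D
  proof -
    have "diagram_product n \<delta> D (partial_identity {1..n} \<union> {}) (identity_diagram n) =
        (if right_support D = {1..n} \<and> identity_diagram n = D \<union> {} then 1 else 0)"
      by (rule diagram_product_cups[OF D]) (simp_all add: cups_def right_support_def)
    moreover have "right_support (identity_diagram n) = {1..n}" by (simp add: identity_diagram_eq)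
    ultimately show ?thesis by (auto simp: identity_diagram_eq)
  qed
  show ?thesis
  proof (cases "D1 = identity_diagram n")
    case True
    then show ?thesis
      using diagram_product_mirror[OF D, of \<delta> "identity_diagram n"] right[of "mirror D2"] D(2)
      by (metis mirror_diagrams mirror_identity_diagram mirror_mirror)
  next
    case False
    then show ?thesis using composite_identity_left[OF D(1)] by (auto simp: diagram_product_def)
  qed
qed

lemma dTL_mult_identity:
  "(f \<otimes>\<^bsub>dTL n \<delta>\<^esub> g) (identity_diagram n) = f (identity_diagram n) * g (identity_diagram n)"
proof -
  have "(f \<otimes>\<^bsub>dTL n \<delta>\<^esub> g) (identity_diagram n) = (\<Sum>D1\<in>diagrams n. \<Sum>D2\<in>diagrams n.
      if D2 = identity_diagram n then if D1 = identity_diagram n then f D1 * g D2 else 0 else 0)"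
    unfolding dTL_mult by (intro sum.cong refl) (simp add: diagram_product_identity)
  then show ?thesis by (simp add: sum.delta finite_diagrams identity_diagram_diagrams)
qed

lemma based_algebra_dTL: "based_algebra (dTL n \<delta>) (diagrams n) (identity_diagram n)"
proof
  show "(f \<otimes>\<^bsub>dTL n \<delta>\<^esub> g) (identity_diagram n) = f (identity_diagram n) * g (identity_diagram n)" for f g
    by (rule dTL_mult_identity)
  show "(f \<oplus>\<^bsub>dTL n \<delta>\<^esub> g) \<otimes>\<^bsub>dTL n \<delta>\<^esub> h = f \<otimes>\<^bsub>dTL n \<delta>\<^esub> h \<oplus>\<^bsub>dTL n \<delta>\<^esub> g \<otimes>\<^bsub>dTL n \<delta>\<^esub> h" for f g h
    by (rule ext) (simp add: dTL_mult dTL_simps(3) sum.distrib algebra_simps)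
  show "h \<otimes>\<^bsub>dTL n \<delta>\<^esub> (f \<oplus>\<^bsub>dTL n \<delta>\<^esub> g) = h \<otimes>\<^bsub>dTL n \<delta>\<^esub> f \<oplus>\<^bsub>dTL n \<delta>\<^esub> h \<otimes>\<^bsub>dTL n \<delta>\<^esub> g" for f g h
    by (rule ext) (simp add: dTL_mult dTL_simps(3) sum.distrib algebra_simps)
  show "(\<lambda>D. a * f D) \<otimes>\<^bsub>dTL n \<delta>\<^esub> g = (\<lambda>D. a * (f \<otimes>\<^bsub>dTL n \<delta>\<^esub> g) D)" for a f g
    by (rule ext) (simp add: dTL_mult sum_distrib_left mult.assoc)
  show "f \<otimes>\<^bsub>dTL n \<delta>\<^esub> (\<lambda>D. a * g D) = (\<lambda>D. a * (f \<otimes>\<^bsub>dTL n \<delta>\<^esub> g) D)" for a f g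
    by (rule ext) (simp add: dTL_mult sum_distrib_left mult.assoc mult.left_commute)
  show "\<one>\<^bsub>dTL n \<delta>\<^esub> \<in> carrier (dTL n \<delta>)"
    using diagrams_subset[OF identity_diagram_diagrams] by (auto simp: dTL_simps)
qed (simp_all add: dTL_left_one dTL_right_one, simp_all add: dTL_simps)

lemma based_algebra_opposite:
  assumes "based_algebra A B b0" shows "based_algebra (opposite_ring A) B b0"
proof -
  interpret based_algebra A B b0 by fact
  show ?thesis
    by unfold_locales
       (simp_all add: opposite_ring_simps carrier_R[symmetric] zero_R add_R[symmetric] l_distr r_distr
         mult_scalar_l mult_scalar_r one_closed l_one r_one one_base mult_base mult.commute)
qed

text \<open>\<open>u\<close> adds the cups and \<open>e\<close> is the same element without them.
  For both, \<open>a u\<close> and \<open>a e\<close> vanish exactly when \<open>a\<close> vanishes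
  on the diagrams of right support \<open>S\<close>, which gives the annihilator clause. As
  \<open>S\<close> is proper, \<open>e\<close> has augmentation zero.\<close>

lemma idempotent_part_right_part:
  assumes S: "S \<subset> {1..n}" and C: "C \<in> cups n" and disj: "S \<inter> right_support C = {}"
  shows "idempotent_part (opposite_ring (dTL n \<delta>)) (identity_diagram n) (right_part n S C)"
proof -
  let ?A = "dTL n \<delta>" and ?Z = "right_part n S C" and ?id = "identity_diagram n"
  define u :: "diagram \<Rightarrow> 'a" where "u = diagram_element (partial_identity S \<union> C)"
  define e :: "diagram \<Rightarrow> 'a" where "e = diagram_element (partial_identity S \<union> {})"
  have S': "S \<subseteq> {1..n}" using S by blast
  have E: "{} \<in> cups n" "S \<inter> right_support {} = {}" by (simp_all add: cups_def right_support_def)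
  note mult_u = dTL_mult_cups[OF C S' disj, where \<delta> = \<delta>, folded u_def]
  note mult_e = dTL_mult_cups[OF E(1) S' E(2), where \<delta> = \<delta>, folded e_def]
  have u: "u \<in> carrier (?A)"
    using cups_element_diagram[OF C S' disj] by (auto simp: u_def diagram_element_def dTL_simps)
  have e: "e \<in> carrier (?A)"
    using cups_element_diagram[OF E(1) S' E(2)] by (auto simp: e_def diagram_element_def dTL_simps)
  have id: "?id \<noteq> partial_identity S" "right_support (?id) = {1..n}"
    using S by (metis identity_diagram_eq order.irrefl support_partial_identity(1))
      (simp add: identity_diagram_eq)
  have "?id \<notin> ?Z"
  proof
    assume mem: "?id \<in> ?Z"
    have "C \<noteq> {}" using mem id(2) S by (auto simp: right_part_def right_support_def)
    then obtain c where c: "c \<in> C" by blast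
    then obtain j where "c = cup j" using cupsE[OF C] by blast
    moreover have "c \<in> ?id" using mem c by (auto simp: right_part_def)
    ultimately show False by (auto simp: cup_def identity_diagram_def doubleton_eq_iff)
  qed
  moreover have "e (?id) = 0" using id by (simp add: e_def diagram_element_def)
  moreover have "e \<otimes>\<^bsub>?A\<^esub> u = u"
  proof
    fix D
    have "(e \<otimes>\<^bsub>?A\<^esub> u) D = (if D \<in> ?Z \<and> D - C = partial_identity S then 1 else 0)"
      by (simp add: mult_u e_def diagram_element_def)
    also have "D \<in> ?Z \<and> D - C = partial_identity S \<longleftrightarrow> D = partial_identity S \<union> C"
      using right_part_Diff(3)[OF C S' disj] right_part_Un[OF C S' disj partial_identity_diagram[OF S']] by auto
    finally show "(e \<otimes>\<^bsub>?A\<^esub> u) D = u D" by (simp add: u_def diagram_element_def)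
  qed
  moreover have "{f \<in> carrier (?A). \<forall>D. f D \<noteq> 0 \<longrightarrow> D \<in> ?Z} =
      (\<lambda>a. a \<otimes>\<^bsub>?A\<^esub> u) ` carrier (?A)"
  proof (intro equalityI subsetI)
    fix f assume f: "f \<in> {f \<in> carrier (?A). \<forall>D. f D \<noteq> 0 \<longrightarrow> D \<in> ?Z}"
    \<comment> \<open>The preimage of \<open>f\<close> under multiplication by \<open>u\<close>
      reads off coefficients after adding the cups to the diagram.\<close>
    define a where "a D = (if D \<in> diagrams n then f (D \<union> C) else 0)" for D
    have "f = a \<otimes>\<^bsub>?A\<^esub> u"
      using f right_part_Diff[OF C S' disj] by (auto simp: mult_u a_def fun_eq_iff)
    moreover have "a \<in> carrier (?A)" by (simp add: a_def dTL_simps)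
    ultimately show "f \<in> (\<lambda>a. a \<otimes>\<^bsub>?A\<^esub> u) ` carrier (?A)" by blast
  next
    fix f assume "f \<in> (\<lambda>a. a \<otimes>\<^bsub>?A\<^esub> u) ` carrier (?A)"
    then show "f \<in> {f \<in> carrier (?A). \<forall>D. f D \<noteq> 0 \<longrightarrow> D \<in> ?Z}"
      by (auto simp: mult_u dTL_simps right_part_def split: if_splits)
  qed
  moreover have "a \<otimes>\<^bsub>?A\<^esub> e = \<zero>\<^bsub>?A\<^esub>" if a: "a \<otimes>\<^bsub>?A\<^esub> u = \<zero>\<^bsub>?A\<^esub>" for a
  proof
    fix D
    show "(a \<otimes>\<^bsub>?A\<^esub> e) D = \<zero>\<^bsub>?A\<^esub> D"
    proof (cases "D \<in> right_part n S {}")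
      case True
      then have D: "D \<in> diagrams n" "right_support D = S" by (auto simp: right_part_empty)
      have "(a \<otimes>\<^bsub>?A\<^esub> u) (D \<union> C) = a D"
        using right_part_Un[OF C S' disj D] by (simp add: mult_u)
      then show ?thesis using a by (simp add: mult_e dTL_simps)
    qed (simp add: mult_e dTL_simps)
  qed
  ultimately show ?thesis unfolding idempotent_part_def opposite_ring_simps using u e by blast
qed

text \<open>The anti-automorphism \<open>reflect\<close> exchanges \<open>dTL n \<delta>\<close>
  with its opposite and fixes the identity diagram, so \<open>reflect u\<close> and
  \<open>reflect e\<close> serve for the reflected set.\<close>

lemma idempotent_part_mirror:
  assumes "idempotent_part (opposite_ring (dTL n \<delta>)) (identity_diagram n) X"
  shows "idempotent_part (dTL n \<delta>) (identity_diagram n) (mirror ` X)"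
proof -
  let ?A = "dTL n \<delta>"
  obtain u e where u: "u \<in> carrier ?A" and e: "e \<in> carrier ?A" "e (identity_diagram n) = 0"
    and ue: "e \<otimes>\<^bsub>?A\<^esub> u = u" and X: "identity_diagram n \<notin> X"
    and span: "{f \<in> carrier ?A. \<forall>D. f D \<noteq> 0 \<longrightarrow> D \<in> X} = (\<lambda>a. a \<otimes>\<^bsub>?A\<^esub> u) ` carrier ?A"
    and ann: "\<And>a. a \<in> carrier ?A \<Longrightarrow> a \<otimes>\<^bsub>?A\<^esub> u = \<zero>\<^bsub>?A\<^esub> \<Longrightarrow> a \<otimes>\<^bsub>?A\<^esub> e = \<zero>\<^bsub>?A\<^esub>"
    using assms unfolding idempotent_part_def opposite_ring_simps by blast
  have mem: "D \<in> mirror ` X \<longleftrightarrow> mirror D \<in> X" for D by (metis image_iff mirror_mirror)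
  have mult: "reflect f \<otimes>\<^bsub>?A\<^esub> g = reflect (reflect g \<otimes>\<^bsub>?A\<^esub> f)" for f g
    using reflect_mult[where f = f and g = "reflect g" and n = n and \<delta> = \<delta>] by simp
  have "reflect \<zero>\<^bsub>?A\<^esub> = \<zero>\<^bsub>?A\<^esub>" by (simp add: reflect_def dTL_simps)
  then have zero: "reflect f = \<zero>\<^bsub>?A\<^esub> \<longleftrightarrow> f = \<zero>\<^bsub>?A\<^esub>" for f by (metis reflect_reflect)
  have s1: "f \<in> {f \<in> carrier ?A. \<forall>D. f D \<noteq> 0 \<longrightarrow> D \<in> mirror ` X} \<longleftrightarrow>
      reflect f \<in> {f \<in> carrier ?A. \<forall>D. f D \<noteq> 0 \<longrightarrow> D \<in> X}" for f
  proof -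
    have "(\<forall>D. f D \<noteq> 0 \<longrightarrow> mirror D \<in> X) \<longleftrightarrow> (\<forall>D. f (mirror D) \<noteq> 0 \<longrightarrow> D \<in> X)"
      by (metis mirror_mirror)
    moreover have "reflect f \<in> carrier ?A \<longleftrightarrow> f \<in> carrier ?A"
      using reflect_carrier[where f = f] reflect_carrier[where f = "reflect f"] by auto
    ultimately show ?thesis by (simp add: mem reflect_def)
  qed
  have s2: "reflect f \<in> (\<lambda>a. a \<otimes>\<^bsub>?A\<^esub> u) ` carrier ?A \<longleftrightarrow> f \<in> (\<lambda>a. reflect u \<otimes>\<^bsub>?A\<^esub> a) ` carrier ?A" for f
  proof -
    have eq: "reflect f = a \<otimes>\<^bsub>?A\<^esub> u \<longleftrightarrow> f = reflect u \<otimes>\<^bsub>?A\<^esub> reflect a" for a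
      using mult[of u "reflect a"] by (metis reflect_reflect)
    show ?thesis
    proof
      assume "reflect f \<in> (\<lambda>a. a \<otimes>\<^bsub>?A\<^esub> u) ` carrier ?A"
      then show "f \<in> (\<lambda>a. reflect u \<otimes>\<^bsub>?A\<^esub> a) ` carrier ?A"
        using eq reflect_carrier by blast
    next
      assume "f \<in> (\<lambda>a. reflect u \<otimes>\<^bsub>?A\<^esub> a) ` carrier ?A"
      then obtain a where "a \<in> carrier ?A" "f = reflect u \<otimes>\<^bsub>?A\<^esub> reflect (reflect a)" by auto
      then show "reflect f \<in> (\<lambda>a. a \<otimes>\<^bsub>?A\<^esub> u) ` carrier ?A"
        using eq[of "reflect a"] reflect_carrier by blast
    qed
  qed
  have span': "{f \<in> carrier ?A. \<forall>D. f D \<noteq> 0 \<longrightarrow> D \<in> mirror ` X} =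
      (\<lambda>a. reflect u \<otimes>\<^bsub>?A\<^esub> a) ` carrier ?A"
    by (rule Set.set_eqI) (simp only: s1 span s2)
  have "identity_diagram n \<notin> mirror ` X" using X by (simp add: mem)
  moreover have "reflect e (identity_diagram n) = 0" using e by (simp add: reflect_def)
  moreover have "reflect u \<otimes>\<^bsub>?A\<^esub> reflect e = reflect u" by (simp add: reflect_mult ue)
  moreover have "reflect e \<otimes>\<^bsub>?A\<^esub> a = \<zero>\<^bsub>?A\<^esub>"
    if "a \<in> carrier ?A" "reflect u \<otimes>\<^bsub>?A\<^esub> a = \<zero>\<^bsub>?A\<^esub>" for a
    using that(2) ann[OF reflect_carrier[OF that(1)]] unfolding mult[of u a] mult[of e a] zero by blast
  ultimately show ?thesis
    unfolding idempotent_part_def using span' reflect_carrier[OF u] reflect_carrier[OF e(1)] by blast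
qed

lemma right_cells_cover:
  assumes "T \<subseteq> right_cells n" "T \<noteq> {}" "\<Inter>T \<noteq> {}"
  shows "idempotent_part (opposite_ring (dTL n \<delta>)) (identity_diagram n) (\<Inter>T)"
  using Inter_right_cells[OF assms] idempotent_part_right_part by metis

lemma left_cells_cover:
  assumes "T \<subseteq> (`) mirror ` right_cells n" "T \<noteq> {}" "\<Inter>T \<noteq> {}"
  shows "idempotent_part (dTL n \<delta>) (identity_diagram n) (\<Inter>T)"
proof -
  obtain T' where T': "T' \<subseteq> right_cells n" "T = (`) mirror ` T'" using assms(1) by (metis subset_imageE)
  have inj: "inj mirror" by (metis injI mirror_mirror)
  have T'_ne: "T' \<noteq> {}" using T'(2) assms(2) by blast
  then have eq: "\<Inter>T = mirror ` \<Inter>T'"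
    using T'(2) image_INT[OF inj_on_subset[OF inj subset_UNIV], of T' "\<lambda>X. X"] by auto
  have "\<Inter>T' \<noteq> {}" using assms(3) unfolding eq by blast
  then show ?thesis
    unfolding eq by (intro idempotent_part_mirror right_cells_cover T' T'_ne)
qed

lemma Union_left_cells: "\<Union>((`) mirror ` right_cells n) = diagrams n - {identity_diagram n}"
proof -
  have "mirror D \<in> diagrams n - {identity_diagram n} \<longleftrightarrow> D \<in> diagrams n - {identity_diagram n}" for D
    using mirror_mirror[of D] by (auto simp del: mirror_mirror)
  then have "mirror ` (diagrams n - {identity_diagram n}) = diagrams n - {identity_diagram n}"
    by (intro equalityI subsetI) (blast, metis imageI mirror_mirror)
  then show ?thesis by (simp add: Union_right_cells[symmetric] image_Union)
qed

text \<open>The tensor product refers to the algebra only through its carrier, unit and scalar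
  multiplication; its ring multiplication enters through the module actions alone. Hence Tor may be
  computed with the opposite algebra in this place.\<close>

lemma tensor_kernel_opposite_ring: "tensor_kernel (opposite_ring A) M N = tensor_kernel A M N"
  by (simp add: tensor_kernel_def tensor_relations_def opposite_ring_simps opposite_ring_smult)

lemma tensor_map_opposite_ring: "tensor_map (opposite_ring A) M N f = tensor_map A M N f"
  by (rule ext) (simp add: tensor_map_def tensor_kernel_opposite_ring)

lemma Tor_opposite_ring: "Tor (opposite_ring A) P d N = Tor A P d N"
  by (simp add: Tor_def tensor_def tensor_map_opposite_ring tensor_kernel_opposite_ring)

theorem theorem1p1:
  fixes \<delta> :: "'k::{comm_ring, comm_monoid_mult}"
    and n :: nat
  assumes "n > 0"
  shows "(\<forall>(P :: nat \<Rightarrow> (diagram \<Rightarrow> 'k, 'p) module) d \<eta>.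
            projective_resolution (opposite_ring (dTL n \<delta>)) P d \<eta> (trivial_module n) \<longrightarrow>
              module_isomorphic base_ring (Tor (dTL n \<delta>) P d (trivial_module n) 0) base_module \<and>
              (\<forall>i>0. carrier (Tor (dTL n \<delta>) P d (trivial_module n) i) =
                       {\<zero>\<^bsub>Tor (dTL n \<delta>) P d (trivial_module n) i\<^esub>})) \<and>
         (\<forall>(Q :: nat \<Rightarrow> (diagram \<Rightarrow> 'k, 'q) module) d \<eta>.
            projective_resolution (dTL n \<delta>) Q d \<eta> (trivial_module n) \<longrightarrow>
              module_isomorphic base_ring (Ext (dTL n \<delta>) Q d (trivial_module n) 0) base_module \<and>
              (\<forall>i>0. carrier (Ext (dTL n \<delta>) Q d (trivial_module n) i) =
                       {\<zero>\<^bsub>Ext (dTL n \<delta>) Q d (trivial_module n) i\<^esub>}))"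
proof (intro conjI allI impI)
  fix P :: "nat \<Rightarrow> (diagram \<Rightarrow> 'k, 'p) module" and d \<eta>
  assume res: "projective_resolution (opposite_ring (dTL n \<delta>)) P d \<eta> (trivial_module n)"
  \<comment> \<open>Homology resolves right modules, that is, left modules over the opposite
    algebra; the ideals in question are spanned by cells given by right-hand ends.\<close>
  have "\<exists>(c :: nat \<Rightarrow> 'p \<Rightarrow> 'p \<Rightarrow> diagram \<Rightarrow> 'k) g. acyclic_resolution (opposite_ring (dTL n \<delta>))
      (diagrams n) (identity_diagram n) P d \<eta> c g"
    by (rule acyclic_resolution_exists[OF based_algebra_opposite[OF based_algebra_dTL] _ _
        finite_right_cells Union_right_cells right_cells_cover])
      (use res in \<open>simp_all add: opposite_ring_smult dTL_simps trivial_module_eq\<close>)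
  then obtain c :: "nat \<Rightarrow> 'p \<Rightarrow> 'p \<Rightarrow> diagram \<Rightarrow> 'k" and g where
    "acyclic_resolution (opposite_ring (dTL n \<delta>)) (diagrams n) (identity_diagram n) P d \<eta> c g" by blast
  then interpret acyclic_resolution "opposite_ring (dTL n \<delta>)" "diagrams n" "identity_diagram n" P d \<eta> c g .
  show "module_isomorphic base_ring (Tor (dTL n \<delta>) P d (trivial_module n) 0) base_module"
    using Tor_zero by (simp add: Tor_opposite_ring trivial_module_eq)
  show "carrier (Tor (dTL n \<delta>) P d (trivial_module n) i) = {\<zero>\<^bsub>Tor (dTL n \<delta>) P d (trivial_module n) i\<^esub>}"
    if "i > 0" for i
    using Tor_pos[OF that] by (simp add: Tor_opposite_ring trivial_module_eq)
next
  fix Q :: "nat \<Rightarrow> (diagram \<Rightarrow> 'k, 'q) module" and d \<eta>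
  assume res: "projective_resolution (dTL n \<delta>) Q d \<eta> (trivial_module n)"
  \<comment> \<open>Cohomology resolves left modules, so the reflected cells are used.\<close>
  have "\<exists>(c :: nat \<Rightarrow> 'q \<Rightarrow> 'q \<Rightarrow> diagram \<Rightarrow> 'k) g. acyclic_resolution (dTL n \<delta>)
      (diagrams n) (identity_diagram n) Q d \<eta> c g"
    by (rule acyclic_resolution_exists[OF based_algebra_dTL _ _
        finite_imageI[OF finite_right_cells] Union_left_cells left_cells_cover])
      (use res in \<open>simp_all add: dTL_simps trivial_module_eq\<close>)
  then obtain c :: "nat \<Rightarrow> 'q \<Rightarrow> 'q \<Rightarrow> diagram \<Rightarrow> 'k" and g where
    "acyclic_resolution (dTL n \<delta>) (diagrams n) (identity_diagram n) Q d \<eta> c g" by blast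
  then interpret acyclic_resolution "dTL n \<delta>" "diagrams n" "identity_diagram n" Q d \<eta> c g .
  show "module_isomorphic base_ring (Ext (dTL n \<delta>) Q d (trivial_module n) 0) base_module"
    using Ext_zero by (simp add: trivial_module_eq)
  show "carrier (Ext (dTL n \<delta>) Q d (trivial_module n) i) = {\<zero>\<^bsub>Ext (dTL n \<delta>) Q d (trivial_module n) i\<^esub>}"
    if "i > 0" for i
    using Ext_pos[OF that] by (simp add: trivial_module_eq)
qed

end
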